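(* Let $X^{(\alpha)}$, $V(\alpha)$, $B(\alpha)$, $C(\alpha)$ be as defined in the context. Then \[ V(\alpha)=\begin{cases} 0, & \alpha=0,\\[1mm] C(\alpha)\,\dfrac{\Gamma\left(1-\frac{\alpha}{2\alpha-1}\right)}{\sqrt{2(1-2\alpha)}\,\Gamma\left(\frac32-\frac{\alpha}{2\alpha-1}\right)}, & 0<\alpha<1/2,\\[3mm] 1/e, & \alpha=1/2,\\[1mm] C(\alpha)\,\dfrac{\Gamma\left(\frac{\alpha}{2\alpha-1}-\frac12\right)}{\sqrt{2(2\alpha-1)}\,\Gamma\left(\frac{\alpha}{2\alpha-1}\right)}, & \alpha>1/2, \end{cases} \] and for every $\alpha>0$ the stopping time \[ \tau^*(\alpha)=\inf\{t\ge 0:\ X^{(\alpha)}_t\ge B(\alpha)\sqrt{1-t}\} \] is optimal, i.e. $\mathbb{E}X^{(\alpha)}_{\tau^*(\alpha)}=V(\alpha)$.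
   Context: Let $W=(W_t)_{t\in[0,1]}$ be standard Brownian motion and $\mathcal{F}=(\mathcal{F}_t)_{t\in[0,1]}$ its natural filtration. For $\alpha\ge 0$ the $\alpha$-Brownian bridge is \[ X^{(\alpha)}_t=\int_0^t\left(\frac{1-t}{1-s}\right)^{\alpha}dW_s,\qquad 0\le t<1, \] which is the unique strong solution of $dX^{(\alpha)}_t=dW_t-\frac{\alpha X^{(\alpha)}_t}{1-t}dt$, $X^{(\alpha)}_0=0$. For $\alpha>0$ one has $X^{(\alpha)}_t\to 0$ a.s. as $t\to1$, and one sets $X^{(\alpha)}_1=0$; for $\alpha=0$, $X^{(0)}=W$ on $[0,1]$. The value of the optimal stopping problem is \[ V(\alpha)=\sup_{0\le\tau\le1}\mathbb{E}X^{(\alpha)}_\tau, \] the supremum being over all $\mathcal{F}$-stopping times $\tau$ with $0\le\tau\le1$. $M(\gamma,\beta,z)=\sum_{n\ge0}\frac{\gamma^{(n)}z^n}{\beta^{(n)}n!}$ is the confluent hypergeometric function of the first kind, where $\gamma^{(0)}=1$, $\gamma^{(n)}=(\gamma+n-1)\gamma^{(n-1)}$. For $\alpha>0$, $\alpha\ne1/2$, put $\gamma(\alpha)=\alpha/(2\alpha-1)$, $z(y,\alpha)=y^2(2\alpha-1)/2$ and, for $y\in\mathbb{R}$, \[ F(y,\alpha)= y\,M(\gamma(\alpha),3/2,z(y,\alpha))+K(\alpha)\,M(\gamma(\alpha)-1/2,1/2,z(y,\alpha)), \] where $K(\alpha)=\frac{\Gamma(1-\gamma(\alpha))}{\sqrt{2(1-2\alpha)}\,\Gamma(3/2-\gamma(\alpha))}$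 if $0<\alpha<1/2$ and $K(\alpha)=\frac{\Gamma(\gamma(\alpha)-1/2)}{\sqrt{2(2\alpha-1)}\,\Gamma(\gamma(\alpha))}$ if $\alpha>1/2$. For $\alpha>0$, $\alpha\neq1/2$, $B(\alpha)$ is the (unique) positive solution $B$ of $B=F(B,\alpha)/F'(B,\alpha)$, where $F'=\partial F/\partial y$, and $C(\alpha)$ is determined by $B(\alpha)=C(\alpha)F(B(\alpha),\alpha)$. For $\alpha=1/2$, $B(1/2)=1$. *)

theory Defs
  imports "HOL-Probability.Probability"
begin

section \<open>Brownian motion, its natural filtration and the Wiener integral\<close>

text \<open>Processes are functions of type \<open>real \<Rightarrow> 'a \<Rightarrow> real\<close>; only their values at times in
  \<open>{0..1}\<close> matter.\<close>

locale standard_brownian_motion = prob_space M for M :: "'a measure" +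
  fixes W :: "real \<Rightarrow> 'a \<Rightarrow> real"
  assumes W_measurable: "\<And>t. t \<in> {0..1} \<Longrightarrow> W t \<in> borel_measurable M"
    and W_zero: "\<And>\<omega>. \<omega> \<in> space M \<Longrightarrow> W 0 \<omega> = 0"
    and W_indep_increments:
      "\<And>n (p :: nat \<Rightarrow> real). mono_on {..n} p \<Longrightarrow> p ` {..n} \<subseteq> {0..1} \<Longrightarrow>
         indep_vars (\<lambda>_. borel) (\<lambda>i \<omega>. W (p (Suc i)) \<omega> - W (p i) \<omega>) {..<n}"
    and W_normal_increments:
      "\<And>s t. 0 \<le> s \<Longrightarrow> s < t \<Longrightarrow> t \<le> 1 \<Longrightarrow>
         distributed M lborel (\<lambda>\<omega>. W t \<omega> - W s \<omega>) (normal_density 0 (sqrt (t - s)))"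
    and W_continuous: "\<And>\<omega>. \<omega> \<in> space M \<Longrightarrow> continuous_on {0..1} (\<lambda>t. W t \<omega>)"

text \<open>The filtration is indexed by all reals so that the library's \<^const>\<open>stopping_time\<close> applies;
  it is trivial before time 0 and constant after time 1.\<close>

definition natural_filtration ::
    "'a measure \<Rightarrow> (real \<Rightarrow> 'a \<Rightarrow> real) \<Rightarrow> real \<Rightarrow> 'a measure" where
  "natural_filtration M W t =
     sigma (space M) {W s -` A \<inter> space M | s A. s \<in> {0..1} \<and> s \<le> t \<and> A \<in> sets borel}"

definition step_function :: "nat \<Rightarrow> (nat \<Rightarrow> real) \<Rightarrow> (nat \<Rightarrow> real) \<Rightarrow> real \<Rightarrow> real" where
  "step_function n p c s = (\<Sum>i<n. c i * indicator {p i<..p (Suc i)} s)"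

definition step_integral ::
    "(real \<Rightarrow> 'a \<Rightarrow> real) \<Rightarrow> nat \<Rightarrow> (nat \<Rightarrow> real) \<Rightarrow> (nat \<Rightarrow> real) \<Rightarrow> 'a \<Rightarrow> real" where
  "step_integral W n p c \<omega> = (\<Sum>i<n. c i * (W (p (Suc i)) \<omega> - W (p i) \<omega>))"

text \<open>\<open>has_wiener_integral M W t f I\<close>: the random variable \<open>I\<close> is a version of the stochastic
  integral of the deterministic function \<open>f\<close> over \<open>[0, t]\<close> with respect to \<open>W\<close>, i.e. the
  \<open>L\<^sup>2(M)\<close>-limit of the integrals of step functions that converge to \<open>f\<close> in \<open>L\<^sup>2[0, t]\<close>.
  By the Ito isometry \<open>I\<close> is almost surely unique.  Nonnegative integrals are used so that
  non-integrable differences are not assigned the value 0.\<close>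

definition has_wiener_integral ::
    "'a measure \<Rightarrow> (real \<Rightarrow> 'a \<Rightarrow> real) \<Rightarrow> real \<Rightarrow> (real \<Rightarrow> real) \<Rightarrow> ('a \<Rightarrow> real) \<Rightarrow> bool" where
  "has_wiener_integral M W t f I \<longleftrightarrow>
     f \<in> borel_measurable borel \<and> I \<in> borel_measurable M \<and>
     (\<exists>(n :: nat \<Rightarrow> nat) (p :: nat \<Rightarrow> nat \<Rightarrow> real) (c :: nat \<Rightarrow> nat \<Rightarrow> real).
        (\<forall>k. mono_on {..n k} (p k) \<and> p k ` {..n k} \<subseteq> {0..t}) \<and>
        (\<lambda>k. \<integral>\<^sup>+s\<in>{0..t}. ennreal ((f s - step_function (n k) (p k) (c k) s)\<^sup>2) \<partial>lborel)
          \<longlonglongrightarrow> 0 \<and>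
        (\<lambda>k. \<integral>\<^sup>+\<omega>. ennreal ((I \<omega> - step_integral W (n k) (p k) (c k) \<omega>)\<^sup>2) \<partial>M)
          \<longlonglongrightarrow> 0)"

section \<open>The bridge and its optimal stopping problem\<close>

text \<open>The stochastic integral defines \<open>X t\<close> only up to null sets for each \<open>t < 1\<close>; as usual
  the adapted version with continuous paths on \<open>[0, 1)\<close> is meant.\<close>

locale alpha_brownian_bridge = standard_brownian_motion M W
    for M :: "'a measure" and W :: "real \<Rightarrow> 'a \<Rightarrow> real" +
  fixes \<alpha> :: real and X :: "real \<Rightarrow> 'a \<Rightarrow> real"
  assumes alpha_nonneg: "0 \<le> \<alpha>"
    and X_integral: "\<And>t. 0 \<le> t \<Longrightarrow> t < 1 \<Longrightarrow>
          has_wiener_integral M W t (\<lambda>s. ((1 - t) / (1 - s)) powr \<alpha>) (X t)"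
    and X_adapted: "\<And>t. 0 \<le> t \<Longrightarrow> t < 1 \<Longrightarrow> X t \<in> borel_measurable (natural_filtration M W t)"
    and X_continuous: "\<And>\<omega>. \<omega> \<in> space M \<Longrightarrow> continuous_on {0..<1} (\<lambda>t. X t \<omega>)"
    and X_one: "\<And>\<omega>. \<omega> \<in> space M \<Longrightarrow> X 1 \<omega> = (if \<alpha> = 0 then W 1 \<omega> else 0)"

definition admissible_times ::
    "'a measure \<Rightarrow> (real \<Rightarrow> 'a \<Rightarrow> real) \<Rightarrow> ('a \<Rightarrow> real) set" where
  "admissible_times M W =
     {\<tau>. stopping_time (natural_filtration M W) \<tau> \<and> (\<forall>\<omega>\<in>space M. 0 \<le> \<tau> \<omega> \<and> \<tau> \<omega> \<le> 1)}"

definition stopped_expectation ::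
    "'a measure \<Rightarrow> (real \<Rightarrow> 'a \<Rightarrow> real) \<Rightarrow> ('a \<Rightarrow> real) \<Rightarrow> real" where
  "stopped_expectation M X \<tau> = (\<integral>\<omega>. X (\<tau> \<omega>) \<omega> \<partial>M)"

text \<open>The supremum is taken in \<^typ>\<open>ereal\<close>, so that it is meaningful without assuming
  boundedness.\<close>

definition stopping_value ::
    "'a measure \<Rightarrow> (real \<Rightarrow> 'a \<Rightarrow> real) \<Rightarrow> (real \<Rightarrow> 'a \<Rightarrow> real) \<Rightarrow> ereal" where
  "stopping_value M W X = (SUP \<tau>\<in>admissible_times M W. ereal (stopped_expectation M X \<tau>))"

section \<open>The functions F, B and C\<close>

text \<open>The library's \<^const>\<open>pochhammer\<close> is the rising factorial.\<close>

definition hypergeom_M :: "real \<Rightarrow> real \<Rightarrow> real \<Rightarrow> real" where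
  "hypergeom_M \<gamma> \<beta> z = (\<Sum>n. pochhammer \<gamma> n * z ^ n / (pochhammer \<beta> n * fact n))"

definition gamma_par :: "real \<Rightarrow> real" where
  "gamma_par \<alpha> = \<alpha> / (2 * \<alpha> - 1)"

definition z_arg :: "real \<Rightarrow> real \<Rightarrow> real" where
  "z_arg y \<alpha> = y\<^sup>2 * (2 * \<alpha> - 1) / 2"

definition K_coeff :: "real \<Rightarrow> real" where
  "K_coeff \<alpha> =
     (if \<alpha> < 1/2
      then Gamma (1 - gamma_par \<alpha>) / (sqrt (2 * (1 - 2 * \<alpha>)) * Gamma (3/2 - gamma_par \<alpha>))
      else Gamma (gamma_par \<alpha> - 1/2) / (sqrt (2 * (2 * \<alpha> - 1)) * Gamma (gamma_par \<alpha>)))"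

definition F_fun :: "real \<Rightarrow> real \<Rightarrow> real" where
  "F_fun y \<alpha> = y * hypergeom_M (gamma_par \<alpha>) (3/2) (z_arg y \<alpha>)
     + K_coeff \<alpha> * hypergeom_M (gamma_par \<alpha> - 1/2) (1/2) (z_arg y \<alpha>)"

definition B_bound :: "real \<Rightarrow> real" where
  "B_bound \<alpha> =
     (if \<alpha> = 1/2 then 1
      else (THE B. 0 < B \<and> B = F_fun B \<alpha> / deriv (\<lambda>y. F_fun y \<alpha>) B))"

definition C_coeff :: "real \<Rightarrow> real" where
  "C_coeff \<alpha> = (THE C. B_bound \<alpha> = C * F_fun (B_bound \<alpha>) \<alpha>)"

text \<open>For \<open>\<alpha> > 0\<close> the set below contains \<open>t = 1\<close>, as \<open>X 1 = 0\<close>.\<close>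

definition tau_star :: "real \<Rightarrow> (real \<Rightarrow> 'a \<Rightarrow> real) \<Rightarrow> 'a \<Rightarrow> real" where
  "tau_star \<alpha> X \<omega> = Inf {t. 0 \<le> t \<and> t \<le> 1 \<and> B_bound \<alpha> * sqrt (1 - t) \<le> X t \<omega>}"

end

theory Submission
  imports Defs
begin

text \<open>
  Write \<open>N t = (1 - t)\<^sup>-\<^sup>\<alpha> X t\<close>.  The increment \<open>N t - N s\<close> is independent of the past of \<open>s\<close> and
  normal, so \<open>H t (N t)\<close> is a martingale as soon as averaging \<open>H t\<close> over that normal law gives
  \<open>H s\<close>; no stochastic calculus is needed.  For \<open>f = C F\<close> the function
  \<open>sqrt (1 - t) f (X t / sqrt (1 - t))\<close> is of this form, since up to scaling \<open>F y\<close> is the mixture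
  \<open>\<integral>\<^sub>0\<^sup>\<infinity> u\<^sup>p\<^sup>-\<^sup>1 exp (u y - u\<^sup>2/2) du\<close> of exponentials with \<open>p = 1/(2\<alpha> - 1)\<close> if \<open>\<alpha> > 1/2\<close>, and the
  moment \<open>E max 0 (y + Z)\<^sup>q\<close> of a shifted standard normal variable with \<open>q = 1/(1 - 2\<alpha>)\<close> if
  \<open>\<alpha> < 1/2\<close>; for \<open>\<alpha> = 1/2\<close> one takes \<open>f y = exp (y - 1)\<close>.

  The function \<open>f\<close> is convex, and \<open>B\<close> is the point where its tangent passes through the origin; this
  tangent is the diagonal, so \<open>y \<le> f y\<close> with equality at \<open>B\<close>.  Hence \<open>X\<close> is dominated by a
  nonnegative martingale started at \<open>f 0 = C F 0\<close>, which bounds the value.  The stopping time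
  \<open>\<tau>\<^sup>*\<close> stops where the domination is an equality, and up to then the martingale is bounded.

  For \<open>\<alpha> = 0\<close> the exponential martingales of Brownian motion give
  \<open>E exp (r X \<tau>) \<le> exp (r\<^sup>2/2)\<close>, and \<open>r\<close> tends to 0.
\<close>

section \<open>Independence and normality of the increments\<close>

text \<open>The paths of \<open>X\<close> are continuous on [0, 1) only, so optional stopping is
  carried out up to times \<open>T\<close> < 1. For \<alpha> > 0 the passage to time 1 uses Fatou's
  lemma and \<open>X 1\<close> = 0 for the upper bound; for \<open>tau_star\<close> the martingale
  is squeezed to 0 by \<open>B_bound \<alpha> * sqrt (1 - t)\<close>. Expectations of martingales
  are integrals with values in [0, \<infinity>], so they make sense before integrability is known;
  hence nonnegativity is part of \<open>heat_martingale\<close>. The exponents come from scaling. If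
  w is the clock plus a constant, exp (u n - u^2 w / 2) is a martingale in n = \<open>N t\<close>,
  and its mixture with weight u^(p - 1) is w^(- p / 2) times a function of n / sqrt w. For \<alpha>
  > 1/2 the constant can be chosen to make w a multiple of (1 - t)^(1 - 2 \<alpha>), and p = 1/(2
  \<alpha> - 1) turns w^(- p / 2) into a multiple of sqrt (1 - t). For \<alpha> < 1/2 the clock has
  a finite limit at time 1, and one averages the q-th power of the positive part over the variance
  still to come; q is fixed by the same scaling.\<close>

lemma space_natural_filtration [simp]: "space (natural_filtration M W t) = space M"
  unfolding natural_filtration_def by (rule space_measure_of) auto

lemma sets_natural_filtration:
  "sets (natural_filtration M W t) = sigma_sets (space M)
     {W s -` A \<inter> space M | s A. s \<in> {0..1} \<and> s \<le> t \<and> A \<in> sets borel}"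
  unfolding natural_filtration_def by (rule sets_measure_of) auto

lemma sets_natural_filtration_mono:
  assumes "s \<le> t"
  shows "sets (natural_filtration M W s) \<subseteq> sets (natural_filtration M W t)"
  unfolding sets_natural_filtration by (rule sigma_sets_mono') (use assms in force)

section \<open>Step functions, step integrals and the isometry between them\<close>

abbreviation sqnorm :: "'b measure \<Rightarrow> ('b \<Rightarrow> real) \<Rightarrow> ennreal" where
  "sqnorm M f \<equiv> (\<integral>\<^sup>+x. ennreal ((f x)\<^sup>2) \<partial>M)"

abbreviation sqnorm_on :: "real set \<Rightarrow> (real \<Rightarrow> real) \<Rightarrow> ennreal" where
  "sqnorm_on A f \<equiv> (\<integral>\<^sup>+x\<in>A. ennreal ((f x)\<^sup>2) \<partial>lborel)"

abbreviation gauss_mean :: "real \<Rightarrow> (real \<Rightarrow> ennreal) \<Rightarrow> ennreal" where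
  "gauss_mean \<sigma> h \<equiv> (\<integral>\<^sup>+d. ennreal (normal_density 0 \<sigma> d) * h d \<partial>lborel)"

definition step_variance :: "nat \<Rightarrow> (nat \<Rightarrow> real) \<Rightarrow> (nat \<Rightarrow> real) \<Rightarrow> real" where
  "step_variance n p c = (\<Sum>i<n. (c i)\<^sup>2 * (p (Suc i) - p i))"

lemma step_function_measurable [measurable]: "step_function n p c \<in> borel_measurable borel"
  unfolding step_function_def by measurable

text \<open>The length of the overlap is also the covariance of the two Brownian increments over
  these intervals; \<open>isometry\<close> rests on this coincidence.\<close>

lemma has_bochner_integral_indicator_Ioc_mult:
  fixes x y x' y' :: real
  shows "has_bochner_integral lborel (\<lambda>s. indicator {x<..y} s * indicator {x'<..y'} s :: real)
           (max 0 (min y y' - max x x'))"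
proof -
  have eq: "(\<lambda>s. indicator {x<..y} s * indicator {x'<..y'} s :: real)
      = indicator {max x x'<..min y y'}"
    by (auto simp: indicator_def fun_eq_iff)
  have "has_bochner_integral lborel (indicator {max x x'<..min y y'} :: real \<Rightarrow> real)
          (measure lborel {max x x'<..min y y'})"
    by (rule has_bochner_integral_real_indicator)
      (auto intro: le_less_trans[OF emeasure_mono[of _ "{max x x'..min y y'}"]]
        simp: emeasure_lborel_Icc_eq)
  moreover have "measure lborel {max x x'<..min y y'} = max 0 (min y y' - max x x')"
    by (cases "max x x' \<le> min y y'") auto
  ultimately show ?thesis
    by (simp add: eq)
qed

lemma has_bochner_integral_square_sum:
  fixes f :: "'i \<Rightarrow> 'b \<Rightarrow> real"
  assumes "finite J"
    and "\<And>i j. i \<in> J \<Longrightarrow> j \<in> J \<Longrightarrow> has_bochner_integral M (\<lambda>x. f i x * f j x) (g i j)"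
  shows "has_bochner_integral M (\<lambda>x. (\<Sum>i\<in>J. a i * f i x)\<^sup>2) (\<Sum>i\<in>J. \<Sum>j\<in>J. a i * a j * g i j)"
proof -
  have "(\<lambda>x. (\<Sum>i\<in>J. a i * f i x)\<^sup>2) = (\<lambda>x. \<Sum>i\<in>J. \<Sum>j\<in>J. a i * a j * (f i x * f j x))"
    by (simp add: power2_eq_square sum_product ac_simps)
  moreover have "has_bochner_integral M (\<lambda>x. \<Sum>i\<in>J. \<Sum>j\<in>J. a i * a j * (f i x * f j x))
      (\<Sum>i\<in>J. \<Sum>j\<in>J. a i * a j * g i j)"
    by (intro has_bochner_integral_sum has_bochner_integral_mult_right) (use assms in auto)
  ultimately show ?thesis by simp
qed

lemma nn_integral_of_has_bochner_integral:
  fixes f :: "'b \<Rightarrow> real"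
  assumes "has_bochner_integral M f v" "\<And>x. 0 \<le> f x"
  shows "(\<integral>\<^sup>+x. ennreal (f x) \<partial>M) = ennreal v"
  using assms nn_integral_eq_integral[of M f] by (auto simp: has_bochner_integral_iff)

text \<open>The cells of a monotone partition are disjoint, so only the diagonal of the double sum
  survives.\<close>

lemma nn_integral_step_function_square:
  assumes "mono_on {..n} p"
  shows "sqnorm lborel (\<lambda>s. step_function n p c s) = ennreal (step_variance n p c)"
proof -
  have "has_bochner_integral lborel (\<lambda>s. (step_function n p c s)\<^sup>2)
     (\<Sum>i<n. \<Sum>j<n. c i * c j * max 0 (min (p (Suc i)) (p (Suc j)) - max (p i) (p j)))"
    unfolding step_function_def
    by (rule has_bochner_integral_square_sum) (auto intro: has_bochner_integral_indicator_Ioc_mult)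
  moreover have "(\<Sum>i<n. \<Sum>j<n. c i * c j * max 0 (min (p (Suc i)) (p (Suc j)) - max (p i) (p j)))
      = step_variance n p c"
    unfolding step_variance_def
  proof (rule sum.cong[OF refl])
    fix i assume i: "i \<in> {..<n}"
    have "c i * c j * max 0 (min (p (Suc i)) (p (Suc j)) - max (p i) (p j))
        = (if j = i then (c i)\<^sup>2 * (p (Suc i) - p i) else 0)" if j: "j < n" for j
    proof (cases i j rule: linorder_cases)
      case less
      then have "p (Suc i) \<le> p j" using j assms by (auto intro!: mono_onD[OF assms])
      then show ?thesis using less by (auto simp: max_def min_def)
    next
      case greater
      then have "p (Suc j) \<le> p i" using i assms by (auto intro!: mono_onD[OF assms])
      then show ?thesis using greater by (auto simp: max_def min_def)
    next
      case equal
      then have "p i \<le> p (Suc i)" using i by (auto intro!: mono_onD[OF assms])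
      then show ?thesis using equal by (auto simp: max_def power2_eq_square)
    qed
    then show "(\<Sum>j<n. c i * c j * max 0 (min (p (Suc i)) (p (Suc j)) - max (p i) (p j)))
        = (c i)\<^sup>2 * (p (Suc i) - p i)"
      using i by simp
  qed
  ultimately show ?thesis
    by (intro nn_integral_of_has_bochner_integral) auto
qed

lemma char_normal_density:
  assumes "0 < \<sigma>"
  shows "char (density lborel (normal_density 0 \<sigma>)) t = exp (- (t * \<sigma>)\<^sup>2 / 2)"
proof -
  interpret S: real_distribution std_normal_distribution by (rule real_dist_normal_dist)
  have eq: "density lborel (normal_density 0 \<sigma>) = distr std_normal_distribution borel (\<lambda>x. \<sigma> * x)"
  proof -
    have "distributed std_normal_distribution lborel (\<lambda>x. x) std_normal_density"
      unfolding distributed_def by (auto simp: distr_id2)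
    from S.normal_density_affine[OF this _, of \<sigma> 0] assms
    have "distributed std_normal_distribution lborel (\<lambda>x. \<sigma> * x) (normal_density 0 \<sigma>)"
      by simp
    from distributed_distr_eq_density[OF this] show ?thesis
      by (simp cong: distr_cong)
  qed
  have "char (density lborel (normal_density 0 \<sigma>)) t = char std_normal_distribution (t * \<sigma>)"
    unfolding eq char_def by (subst integral_distr) (auto simp: ac_simps)
  then show ?thesis by (simp add: char_std_normal_distribution)
qed

context standard_brownian_motion
begin

lemma natural_filtration_subset: "sets (natural_filtration M W t) \<subseteq> events"
  unfolding sets_natural_filtration
  by (rule sets.sigma_sets_subset) (use W_measurable in \<open>auto intro!: measurable_sets\<close>)

lemma has_bochner_integral_increment_square:
  assumes "0 \<le> s" "s \<le> t" "t \<le> 1"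
  shows "has_bochner_integral M (\<lambda>\<omega>. (W t \<omega> - W s \<omega>)\<^sup>2) (t - s)"
proof (cases "s = t")
  case False
  then have st: "s < t" using assms by simp
  let ?d = "normal_density 0 (sqrt (t - s))"
  have D: "distributed M lborel (\<lambda>\<omega>. W t \<omega> - W s \<omega>) ?d"
    using W_normal_increments[of s t] st assms by simp
  have "has_bochner_integral lborel (\<lambda>x. ?d x * (x - 0) ^ (2 * 1))
      (fact (2 * 1) / ((2 / (sqrt (t - s))\<^sup>2) ^ 1 * fact 1))"
    by (rule normal_moment_even) (use st in simp)
  then have "has_bochner_integral lborel (\<lambda>x. ?d x * x\<^sup>2) (t - s)"
    using st by (simp add: diff_divide_distrib)
  then have "integrable lborel (\<lambda>x. ?d x * x\<^sup>2)" "(\<integral>x. ?d x * x\<^sup>2 \<partial>lborel) = t - s"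
    by (auto simp: has_bochner_integral_iff)
  then show ?thesis
    using distributed_integrable[OF D, of "\<lambda>x. x\<^sup>2"] distributed_integral[OF D, of "\<lambda>x. x\<^sup>2"]
    by (auto simp: has_bochner_integral_iff)
qed (auto simp: has_bochner_integral_zero)

text \<open>Polarisation: the product is half of (W s)^2 + (W t)^2 - (W t - W s)^2, so covariances
  follow from the variances of increments.\<close>

lemma has_bochner_integral_W_mult:
  assumes "s \<in> {0..1}" "t \<in> {0..1}"
  shows "has_bochner_integral M (\<lambda>\<omega>. W s \<omega> * W t \<omega>) (min s t)"
proof -
  have sq: "has_bochner_integral M (\<lambda>\<omega>. (W t \<omega>)\<^sup>2) t" if "t \<in> {0..1}" for t
  proof -
    have "has_bochner_integral M (\<lambda>\<omega>. (W t \<omega> - W 0 \<omega>)\<^sup>2) (t - 0)"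
      using that by (intro has_bochner_integral_increment_square) auto
    then show ?thesis
      by (rule has_bochner_integral_cong[THEN iffD1, rotated -1]) (auto simp: W_zero)
  qed
  have *: "has_bochner_integral M (\<lambda>\<omega>. W s \<omega> * W t \<omega>) s"
    if "s \<le> t" "s \<in> {0..1}" "t \<in> {0..1}" for s t
  proof -
    have "has_bochner_integral M
       (\<lambda>\<omega>. ((W s \<omega>)\<^sup>2 + (W t \<omega>)\<^sup>2 - (W t \<omega> - W s \<omega>)\<^sup>2) / 2) ((s + t - (t - s)) / 2)"
      by (intro has_bochner_integral_divide has_bochner_integral_diff has_bochner_integral_add
          sq has_bochner_integral_increment_square) (use that in auto)
    then show ?thesis
      by (rule has_bochner_integral_cong[THEN iffD1, rotated -1])
        (auto simp: power2_eq_square algebra_simps)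
  qed
  show ?thesis
    using *[of s t] *[of t s] assms by (cases "s \<le> t") (auto simp: min_def mult.commute)
qed

lemma has_bochner_integral_increment_mult:
  assumes "0 \<le> x" "x \<le> y" "y \<le> 1" "0 \<le> x'" "x' \<le> y'" "y' \<le> 1"
  shows "has_bochner_integral M (\<lambda>\<omega>. (W y \<omega> - W x \<omega>) * (W y' \<omega> - W x' \<omega>))
           (max 0 (min y y' - max x x'))"
proof -
  have "has_bochner_integral M
      (\<lambda>\<omega>. W y \<omega> * W y' \<omega> - W y \<omega> * W x' \<omega> - W x \<omega> * W y' \<omega> + W x \<omega> * W x' \<omega>)
      (min y y' - min y x' - min x y' + min x x')"
    by (intro has_bochner_integral_diff has_bochner_integral_add has_bochner_integral_W_mult)
      (use assms in auto)
  moreover have "min y y' - min y x' - min x y' + min x x' = max 0 (min y y' - max x x')"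
    using assms by (auto simp: min_def max_def)
  ultimately show ?thesis
    by (simp add: algebra_simps)
qed

text \<open>The intervals may overlap: both squares expand into the same double sum over the
  pairwise overlaps.\<close>

lemma isometry:
  assumes "finite J" "\<And>i. i \<in> J \<Longrightarrow> 0 \<le> x i \<and> x i \<le> y i \<and> y i \<le> 1"
  shows "sqnorm M (\<lambda>\<omega>. \<Sum>i\<in>J. a i * (W (y i) \<omega> - W (x i) \<omega>))
       = sqnorm lborel (\<lambda>s. \<Sum>i\<in>J. a i * indicator {x i<..y i} s)"
proof -
  let ?v = "\<Sum>i\<in>J. \<Sum>j\<in>J. a i * a j * max 0 (min (y i) (y j) - max (x i) (x j))"
  have "sqnorm M (\<lambda>\<omega>. \<Sum>i\<in>J. a i * (W (y i) \<omega> - W (x i) \<omega>)) = ennreal ?v"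
    by (intro nn_integral_of_has_bochner_integral has_bochner_integral_square_sum
        has_bochner_integral_increment_mult) (use assms in auto)
  moreover have "sqnorm lborel (\<lambda>s. \<Sum>i\<in>J. a i * indicator {x i<..y i} s) = ennreal ?v"
    by (intro nn_integral_of_has_bochner_integral has_bochner_integral_square_sum
        has_bochner_integral_indicator_Ioc_mult) (use assms in auto)
  ultimately show ?thesis by simp
qed

lemma isometry_step_diff:
  assumes p: "mono_on {..n} p" "p ` {..n} \<subseteq> {0..1}" and q: "mono_on {..m} q" "q ` {..m} \<subseteq> {0..1}"
  shows "sqnorm M (\<lambda>\<omega>. step_integral W n p c \<omega> - step_integral W m q d \<omega>)
       = sqnorm lborel (\<lambda>s. step_function n p c s - step_function m q d s)"
proof -
  note in01 = image_subset_iff[THEN iffD1, OF p(2), THEN bspec]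
    image_subset_iff[THEN iffD1, OF q(2), THEN bspec]
  \<comment> \<open>Summing over the disjoint union of the index sets avoids a common refinement of the partitions.\<close>
  let ?J = "{..<n} <+> {..<m}"
  let ?x = "case_sum p q" and ?y = "case_sum (\<lambda>i. p (Suc i)) (\<lambda>i. q (Suc i))"
  let ?a = "case_sum c (\<lambda>i. - d i)"
  have "sqnorm M (\<lambda>\<omega>. \<Sum>i\<in>?J. ?a i * (W (?y i) \<omega> - W (?x i) \<omega>))
       = sqnorm lborel (\<lambda>s. \<Sum>i\<in>?J. ?a i * indicator {?x i<..?y i} s)"
    by (rule isometry) (use in01 in \<open>auto intro!: mono_onD[OF p(1)] mono_onD[OF q(1)]\<close>)
  then show ?thesis
    by (simp only: sum.Plus finite_lessThan o_def sum.case mult_minus_left sum_negf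
        add_uminus_conv_diff step_integral_def step_function_def)
qed

lemma step_integral_measurable:
  assumes "p ` {..n} \<subseteq> {0..1}"
  shows "step_integral W n p c \<in> borel_measurable M"
  unfolding step_integral_def
  by (intro borel_measurable_sum borel_measurable_times borel_measurable_diff W_measurable)
    (use assms[unfolded image_subset_iff, THEN bspec] in auto)

text \<open>Independence of the increments turns the characteristic function into a product. A cell
  of length zero has no normal density and contributes the factor 1.\<close>

lemma char_step_integral:
  assumes p: "mono_on {..n} p" "p ` {..n} \<subseteq> {0..1}"
  shows "char (distr M borel (step_integral W n p c)) t = exp (- t\<^sup>2 * step_variance n p c / 2)"
proof -
  let ?D = "\<lambda>i \<omega>. W (p (Suc i)) \<omega> - W (p i) \<omega>"
  have "indep_vars (\<lambda>_. borel) (\<lambda>i \<omega>. c i * ?D i \<omega>) {..<n}"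
    by (rule indep_vars_compose2[OF W_indep_increments[OF p]]) auto
  from char_distr_sum[OF this, of t]
  have "char (distr M borel (step_integral W n p c)) t
      = (\<Prod>i<n. char (distr M borel (\<lambda>\<omega>. c i * ?D i \<omega>)) t)"
    by (simp add: step_integral_def[abs_def])
  also have "\<dots> = (\<Prod>i<n. complex_of_real (exp (- t\<^sup>2 * ((c i)\<^sup>2 * (p (Suc i) - p i)) / 2)))"
  proof (rule prod.cong[OF refl])
    fix i assume i: "i \<in> {..<n}"
    have le: "p i \<le> p (Suc i)" using i by (auto intro!: mono_onD[OF p(1)])
    have in01: "0 \<le> p i" "p (Suc i) \<le> 1" using i p(2)[unfolded image_subset_iff, THEN bspec] by auto
    have meas [measurable]: "?D i \<in> borel_measurable M"
      by (intro borel_measurable_diff W_measurable) (use i p(2)[unfolded image_subset_iff, THEN bspec] in auto)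
    have eq: "char (distr M borel (\<lambda>\<omega>. c i * ?D i \<omega>)) t = char (distr M borel (?D i)) (t * c i)"
      unfolding char_def by (simp add: integral_distr ac_simps)
    show "char (distr M borel (\<lambda>\<omega>. c i * ?D i \<omega>)) t
        = complex_of_real (exp (- t\<^sup>2 * ((c i)\<^sup>2 * (p (Suc i) - p i)) / 2))"
    proof (cases "p i = p (Suc i)")
      case True
      then show ?thesis unfolding eq by (simp add: char_def integral_distr prob_space del: distr_const)
    next
      case False
      then have lt: "p i < p (Suc i)" using le by simp
      have "distr M borel (?D i) = density lborel (normal_density 0 (sqrt (p (Suc i) - p i)))"
        using distributed_distr_eq_density[OF W_normal_increments[of "p i" "p (Suc i)"]] lt in01
        by (simp cong: distr_cong)
      then show ?thesis
        unfolding eq using lt by (simp add: char_normal_density power_mult_distrib ac_simps)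
    qed
  qed
  also have "\<dots> = exp (- t\<^sup>2 * step_variance n p c / 2)"
    by (simp add: step_variance_def exp_sum[symmetric] sum_distrib_left sum_negf sum_divide_distrib
        flip: of_real_prod)
  finally show ?thesis .
qed

end

section \<open>Independence of later step integrals from the past\<close>

lemma Collect_mem_sets:
  assumes "f \<in> measurable M N" "A \<in> sets N"
  shows "{x \<in> space M. f x \<in> A} \<in> sets M"
  using measurable_sets[OF assms] by (simp add: vimage_def Int_def conj_commute)

context standard_brownian_motion
begin

definition cylinder :: "real set \<Rightarrow> (real \<Rightarrow> real set) \<Rightarrow> 'a set" where
  "cylinder U A = {\<omega>\<in>space M. \<forall>u\<in>U. W u \<omega> \<in> A u}"

text \<open>An intersection-stable class whose generated sigma-algebra contains the natural
  filtration at \<open>s\<close>, so that independence of the past can be tested on finitely many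
  times.\<close>

definition cylinders :: "real \<Rightarrow> 'a set set" where
  "cylinders s = {cylinder U A | U A. finite U \<and> U \<subseteq> {0..s} \<and> (\<forall>u. A u \<in> sets borel)}"

lemma Int_stable_cylinders: "Int_stable (cylinders s)"
proof (rule Int_stableI)
  fix a b assume "a \<in> cylinders s" "b \<in> cylinders s"
  then obtain U A V B where a: "a = cylinder U A" "finite U" "U \<subseteq> {0..s}" "\<And>u. A u \<in> sets borel"
    and b: "b = cylinder V B" "finite V" "V \<subseteq> {0..s}" "\<And>u. B u \<in> sets borel"
    by (auto simp: cylinders_def)
  \<comment> \<open>Padding with \<open>UNIV\<close> puts both conditions over the common set of
    times \<open>U \<union> V\<close>.\<close>
  let ?C = "\<lambda>u. (if u \<in> U then A u else UNIV) \<inter> (if u \<in> V then B u else UNIV)"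
  have "a \<inter> b = cylinder (U \<union> V) ?C"
    unfolding a b cylinder_def by auto
  moreover have "\<And>u. ?C u \<in> sets borel"
    using a b by auto
  ultimately show "a \<inter> b \<in> cylinders s"
    using a b unfolding cylinders_def by blast
qed

lemma sets_natural_filtration_le_cylinders:
  "sets (natural_filtration M W s) \<subseteq> sigma_sets (space M) (cylinders s)"
  unfolding sets_natural_filtration
proof (rule sigma_sets_mono', rule subsetI)
  fix a assume "a \<in> {W u -` A \<inter> space M |u A. u \<in> {0..1} \<and> u \<le> s \<and> A \<in> sets borel}"
  then obtain u A where "a = W u -` A \<inter> space M" "0 \<le> u" "u \<le> s" "A \<in> sets borel" by auto
  then have "a = cylinder {u} (\<lambda>_. A)" "{u} \<subseteq> {0..s}" "\<forall>v::real. A \<in> sets borel"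
    by (auto simp: cylinder_def)
  then show "a \<in> cylinders s" unfolding cylinders_def by blast
qed

text \<open>All times are arranged on one grid \<open>r\<close>: the times up to \<open>s\<close>
  first, then the partition \<open>p\<close>. The cylinder is a function of the first block of
  increments and the step integral of the last block, and disjoint blocks of independent increments
  are independent.\<close>

lemma prob_cylinder_Int_step_integral:
  assumes s: "0 \<le> s" "s \<le> 1" and U: "finite U" "U \<subseteq> {0..s}" and A: "\<And>u. A u \<in> sets borel"
    and p: "mono_on {..n} p" "p ` {..n} \<subseteq> {s..1}" and B: "B \<in> sets borel"
  shows "prob (cylinder U A \<inter> (step_integral W n p c -` B \<inter> space M))
       = prob (cylinder U A) * prob (step_integral W n p c -` B \<inter> space M)"
proof -
  \<comment> \<open>Inserting 0 makes every \<open>W u\<close> a telescoping sum of increments, as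
    \<open>W 0\<close> vanishes.\<close>
  define L where "L = sorted_list_of_set (insert 0 (insert s U))"
  define m where "m = length L - 1"
  define r where "r = (\<lambda>i. if i \<le> m then L ! i else p (i - Suc m))"
  have setL: "set L = insert 0 (insert s U)" unfolding L_def using U by (intro set_sorted_list_of_set) simp
  have sortL: "sorted L" unfolding L_def by simp
  have lenL: "length L = Suc m" using setL unfolding m_def by (cases L) auto
  have Lin: "L ! i \<in> {0..s}" if "i \<le> m" for i
  proof -
    have "L ! i \<in> set L" using that lenL by (intro nth_mem) simp
    then show ?thesis using setL U s by auto
  qed
  have pin: "p i \<in> {s..1}" if "i \<le> n" for i using p(2) that by auto
  have r_mono: "mono_on {..Suc m + n} r"
  proof (rule mono_onI)
    fix i j assume ij: "i \<in> {..Suc m + n}" "j \<in> {..Suc m + n}" "i \<le> j"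
    consider "j \<le> m" | "i \<le> m" "j > m" | "i > m" by linarith
    then show "r i \<le> r j"
    proof cases
      case 1
      then show ?thesis using ij lenL sortL by (auto simp: r_def sorted_iff_nth_mono)
    next
      case 2
      then have "L ! i \<le> s" "s \<le> p (j - Suc m)" using ij Lin[of i] pin[of "j - Suc m"] by auto
      then show ?thesis using 2 by (simp add: r_def)
    next
      case 3
      then show ?thesis using ij by (auto simp: r_def intro!: mono_onD[OF p(1)])
    qed
  qed
  have r_in: "r ` {..Suc m + n} \<subseteq> {0..1}"
  proof (rule image_subsetI)
    fix i assume i: "i \<in> {..Suc m + n}"
    show "r i \<in> {0..1}"
    proof (cases "i \<le> m")
      case True
      then show ?thesis using Lin[of i] s by (simp add: r_def)
    next
      case False
      then have "i - Suc m \<le> n" using i by simp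
      from pin[OF this] have "s \<le> p (i - Suc m)" "p (i - Suc m) \<le> 1" by auto
      then show ?thesis using False s(1) by (simp add: r_def)
    qed
  qed
  let ?D = "\<lambda>i \<omega>. W (r (Suc i)) \<omega> - W (r i) \<omega>"
  \<comment> \<open>The increment with index \<open>m\<close>, from the last entry of
    \<open>L\<close> to \<open>p 0\<close>, belongs to neither block.\<close>
  let ?I = "{..<m}" and ?J = "{Suc m..<Suc m + n}"
  have indep: "indep_vars (\<lambda>_. borel) ?D {..<Suc m + n}"
    by (rule W_indep_increments[OF r_mono r_in])
  have ind2: "indep_var (PiM ?I (\<lambda>_. borel)) (\<lambda>\<omega>. restrict (\<lambda>i. ?D i \<omega>) ?I)
                (PiM ?J (\<lambda>_. borel)) (\<lambda>\<omega>. restrict (\<lambda>i. ?D i \<omega>) ?J)"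
    by (rule indep_var_restrict[OF indep]) auto
  have "\<exists>k. \<forall>u\<in>U. k u \<le> m \<and> L ! k u = u"
  proof -
    have "\<exists>k\<le>m. L ! k = u" if "u \<in> U" for u
    proof -
      have "u \<in> set L" using that setL by simp
      then show ?thesis using lenL by (auto simp: in_set_conv_nth less_Suc_eq_le)
    qed
    then show ?thesis by metis
  qed
  then obtain k where k: "\<And>u. u \<in> U \<Longrightarrow> k u \<le> m" "\<And>u. u \<in> U \<Longrightarrow> L ! k u = u" by blast
  have L0: "L ! 0 = 0"
  proof -
    have "0 \<in> set L" using setL by simp
    then obtain i where "i \<le> m" "L ! i = 0" using lenL by (auto simp: in_set_conv_nth less_Suc_eq_le)
    moreover have "L ! 0 \<le> L ! i"
      using sortL \<open>i \<le> m\<close> lenL by (auto simp: sorted_iff_nth_mono)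
    moreover have "0 \<le> L ! 0" using Lin[of 0] by auto
    ultimately show ?thesis by simp
  qed
  have W_sum: "W u \<omega> = (\<Sum>i<k u. ?D i \<omega>)" if "u \<in> U" "\<omega> \<in> space M" for u \<omega>
  proof -
    have "(\<Sum>i<k u. ?D i \<omega>) = W (r (k u)) \<omega> - W (r 0) \<omega>"
      by (rule sum_lessThan_telescope)
    then show ?thesis using k[OF that(1)] L0 W_zero[OF that(2)] by (simp add: r_def)
  qed
  define S where "S = {f \<in> space (PiM ?I (\<lambda>_. borel :: real measure)). \<forall>u\<in>U. (\<Sum>i<k u. f i) \<in> A u}"
  define T where "T = {f \<in> space (PiM ?J (\<lambda>_. borel :: real measure)). (\<Sum>i<n. c i * f (Suc m + i)) \<in> B}"
  have S: "S \<in> sets (PiM ?I (\<lambda>_. borel))"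
  proof -
    have "(\<lambda>f. \<Sum>i<k u. f i) \<in> borel_measurable (PiM ?I (\<lambda>_. borel :: real measure))" if "u \<in> U" for u
      using k(1)[OF that] by (intro borel_measurable_sum measurable_component_singleton) auto
    then show ?thesis
      unfolding S_def using A U(1)
      by (intro sets.sets_Collect_finite_All Collect_mem_sets) auto
  qed
  have T: "T \<in> sets (PiM ?J (\<lambda>_. borel))"
  proof -
    have "(\<lambda>f. \<Sum>i<n. c i * f (Suc m + i)) \<in> borel_measurable (PiM ?J (\<lambda>_. borel :: real measure))"
      by (intro borel_measurable_sum borel_measurable_times borel_measurable_const
          measurable_component_singleton) auto
    then show ?thesis
      unfolding T_def by (rule Collect_mem_sets[OF _ B])
  qed
  have Seq: "(\<lambda>\<omega>. restrict (\<lambda>i. ?D i \<omega>) ?I) -` S \<inter> space M = cylinder U A"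
  proof -
    have "(\<Sum>i<k u. restrict (\<lambda>i. ?D i \<omega>) ?I i) = W u \<omega>" if "u \<in> U" "\<omega> \<in> space M" for u \<omega>
      unfolding W_sum[OF that] by (rule sum.cong) (use k(1)[OF that(1)] in auto)
    then show ?thesis unfolding S_def cylinder_def by (auto simp: space_PiM)
  qed
  have Teq: "(\<lambda>\<omega>. restrict (\<lambda>i. ?D i \<omega>) ?J) -` T \<inter> space M = step_integral W n p c -` B \<inter> space M"
  proof -
    have "(\<Sum>i<n. c i * restrict (\<lambda>i. ?D i \<omega>) ?J (Suc m + i)) = step_integral W n p c \<omega>" for \<omega>
      unfolding step_integral_def by (rule sum.cong) (auto simp: r_def)
    then show ?thesis unfolding T_def by (auto simp: space_PiM)
  qed
  have "prob ((\<lambda>\<omega>. (restrict (\<lambda>i. ?D i \<omega>) ?I, restrict (\<lambda>i. ?D i \<omega>) ?J)) -` (S \<times> T) \<inter> space M)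
      = prob (cylinder U A) * prob (step_integral W n p c -` B \<inter> space M)"
    unfolding indep_varD[OF ind2 S T] Seq Teq ..
  also have "(\<lambda>\<omega>. (restrict (\<lambda>i. ?D i \<omega>) ?I, restrict (\<lambda>i. ?D i \<omega>) ?J)) -` (S \<times> T) \<inter> space M
      = cylinder U A \<inter> (step_integral W n p c -` B \<inter> space M)"
    unfolding Seq[symmetric] Teq[symmetric] by blast
  finally show ?thesis .
qed

text \<open>The pi-lambda argument is contained in \<open>indep_set_sigma_sets\<close>; its second
  class consists of the one event of the step integral.\<close>

lemma prob_filtration_Int_step_integral:
  assumes s: "0 \<le> s" "s \<le> 1" and p: "mono_on {..n} p" "p ` {..n} \<subseteq> {s..1}"
    and A: "A \<in> sets (natural_filtration M W s)" and B: "B \<in> sets borel"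
  shows "prob (A \<inter> (step_integral W n p c -` B \<inter> space M))
       = prob A * prob (step_integral W n p c -` B \<inter> space M)"
proof -
  let ?I = "step_integral W n p c"
  let ?b = "?I -` B \<inter> space M"
  have p01: "p ` {..n} \<subseteq> {0..1}" using subset_trans[OF p(2), of "{0..1}"] s by simp
  have I: "?I \<in> borel_measurable M" by (rule step_integral_measurable[OF p01])
  have cyl: "cylinder U A \<in> events"
    if "finite U" "U \<subseteq> {0..s}" "\<And>u. A u \<in> sets borel" for U A
    unfolding cylinder_def
    by (intro sets.sets_Collect_finite_All Collect_mem_sets[OF W_measurable]) (use that s in auto)
  have "indep_set (cylinders s) {?b}"
  proof (rule indep_setI)
    show "cylinders s \<subseteq> events" using cyl by (auto simp: cylinders_def)
    show "{?b} \<subseteq> events" using I B by (auto intro: measurable_sets)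
    show "prob (a \<inter> b) = prob a * prob b" if "a \<in> cylinders s" "b \<in> {?b}" for a b
      using that prob_cylinder_Int_step_integral[OF s _ _ _ p B] by (auto simp: cylinders_def)
  qed
  moreover have "Int_stable {?b}" by (rule Int_stableI) auto
  ultimately have "indep_set (sigma_sets (space M) (cylinders s)) (sigma_sets (space M) {?b})"
    by (intro indep_set_sigma_sets Int_stable_cylinders)
  moreover have "A \<in> sigma_sets (space M) (cylinders s)"
    by (rule subsetD[OF sets_natural_filtration_le_cylinders A])
  moreover have "?b \<in> sigma_sets (space M) {?b}" by (rule sigma_sets.Basic) simp
  ultimately show ?thesis by (rule indep_setD)
qed

end

section \<open>Limits in mean square and increments of the Wiener integral\<close>

lemma tendsto_0_ennreal_le:
  fixes f g :: "'b \<Rightarrow> ennreal"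
  assumes "(g \<longlongrightarrow> 0) F" "\<And>x. f x \<le> g x"
  shows "(f \<longlongrightarrow> 0) F"
  by (rule tendsto_sandwich[OF _ _ tendsto_const assms(1)]) (use assms(2) in auto)

lemma square_sum3_le: "(a + b - c)\<^sup>2 \<le> 3 * (a\<^sup>2 + b\<^sup>2 + c\<^sup>2)" for a b c :: real
proof -
  have "0 \<le> (a - b)\<^sup>2 + (a + c)\<^sup>2 + (b + c)\<^sup>2" by simp
  then show ?thesis by (simp add: power2_eq_square algebra_simps)
qed

text \<open>Young's inequality with a factor of b^2 arbitrarily close to 1. It plays the part of the
  triangle inequality while working with integrals of squares directly.\<close>

lemma square_le_weighted:
  fixes a b e :: real
  assumes "0 < e"
  shows "a\<^sup>2 \<le> (1 + e) * b\<^sup>2 + (1 + 1 / e) * (a - b)\<^sup>2"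
proof -
  have "0 \<le> (e * b - (a - b))\<^sup>2 / e" using assms by simp
  also have "\<dots> = (1 + e) * b\<^sup>2 + (1 + 1 / e) * (a - b)\<^sup>2 - a\<^sup>2"
    using assms by (simp add: power2_eq_square field_simps)
  finally show ?thesis by simp
qed

lemma nn_integral_square_le_weighted:
  fixes f g :: "'b \<Rightarrow> real"
  assumes [measurable]: "f \<in> borel_measurable M" "g \<in> borel_measurable M" and e: "0 < e"
  shows "sqnorm M (\<lambda>x. f x)
    \<le> ennreal (1 + e) * sqnorm M (\<lambda>x. g x)
      + ennreal (1 + 1 / e) * sqnorm M (\<lambda>x. f x - g x)"
proof -
  have "sqnorm M (\<lambda>x. f x)
      \<le> (\<integral>\<^sup>+x. ennreal (1 + e) * ennreal ((g x)\<^sup>2) + ennreal (1 + 1 / e) * ennreal ((f x - g x)\<^sup>2) \<partial>M)"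
    using square_le_weighted[OF e] e
    by (intro nn_integral_mono) (simp flip: ennreal_mult ennreal_plus)
  then show ?thesis
    by (simp add: nn_integral_add nn_integral_cmult)
qed

text \<open>Continuity of the squared norm, from the weighted inequality applied in both directions
  with a weight that is small compared with the limit.\<close>

lemma tendsto_nn_integral_square:
  fixes f :: "nat \<Rightarrow> 'b \<Rightarrow> real" and g :: "'b \<Rightarrow> real"
  assumes [measurable]: "\<And>k. f k \<in> borel_measurable M" "g \<in> borel_measurable M"
    and fin: "sqnorm M (\<lambda>x. g x) = ennreal v" and v: "0 \<le> v"
    and lim: "(\<lambda>k. sqnorm M (\<lambda>x. g x - f k x)) \<longlonglongrightarrow> 0"
    and fk: "\<And>k. sqnorm M (\<lambda>x. f k x) = ennreal (u k)" and u: "\<And>k. 0 \<le> u k"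
  shows "u \<longlonglongrightarrow> v"
proof (rule LIMSEQ_I)
  fix \<epsilon> :: real assume \<epsilon>: "0 < \<epsilon>"
  \<comment> \<open>This \<open>e\<close> keeps \<open>e * v\<close> and
    \<open>e * (v + \<epsilon> / 2)\<close> below \<epsilon>/4, and \<open>\<eta>\<close> makes the
    contribution of the difference equal to \<epsilon>/4.\<close>
  define e where "e = \<epsilon> / (4 * (1 + v + \<epsilon>))"
  have e: "0 < e" "e \<le> 1/4" using \<epsilon> v by (auto simp: e_def field_simps)
  define \<eta> where "\<eta> = \<epsilon> / (4 * (1 + 1 / e))"
  have e1: "0 < 1 + 1 / e" using e by (simp add: add_pos_pos)
  have \<eta>: "0 < \<eta>" using e1 \<epsilon> by (simp add: \<eta>_def)
  have ev: "eventually (\<lambda>k. sqnorm M (\<lambda>x. g x - f k x) < ennreal \<eta>) sequentially"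
    using lim by (rule order_tendstoD) (use \<eta> in simp)
  have "norm (u k - v) < \<epsilon>" if "sqnorm M (\<lambda>x. g x - f k x) < ennreal \<eta>" for k
  proof -
    let ?d = "sqnorm M (\<lambda>x. g x - f k x)"
    have d: "?d \<le> ennreal \<eta>" using that by simp
    have d': "sqnorm M (\<lambda>x. f k x - g x) \<le> ennreal \<eta>"
      using d by (simp add: power2_commute)
    have "ennreal (u k) \<le> ennreal (1 + e) * ennreal v + ennreal (1 + 1 / e) * ennreal \<eta>"
    proof -
      have "ennreal (u k) \<le> ennreal (1 + e) * ennreal v
          + ennreal (1 + 1 / e) * sqnorm M (\<lambda>x. f k x - g x)"
        using nn_integral_square_le_weighted[of "f k" M g e] e by (simp only: fin fk assms(1,2))
      also have "\<dots> \<le> ennreal (1 + e) * ennreal v + ennreal (1 + 1 / e) * ennreal \<eta>"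
        by (intro add_left_mono mult_left_mono d') simp
      finally show ?thesis .
    qed
    also have "\<dots> = ennreal ((1 + e) * v + (1 + 1 / e) * \<eta>)"
      using e e1 v \<eta> by (simp add: ennreal_mult)
    finally have 1: "u k \<le> (1 + e) * v + (1 + 1 / e) * \<eta>"
      using e e1 v \<eta> by (subst (asm) ennreal_le_iff) auto
    have "ennreal v \<le> ennreal (1 + e) * ennreal (u k) + ennreal (1 + 1 / e) * ennreal \<eta>"
    proof -
      have "ennreal v \<le> ennreal (1 + e) * ennreal (u k)
          + ennreal (1 + 1 / e) * sqnorm M (\<lambda>x. g x - f k x)"
        using nn_integral_square_le_weighted[of g M "f k" e] e by (simp only: fin fk assms(1,2))
      also have "\<dots> \<le> ennreal (1 + e) * ennreal (u k) + ennreal (1 + 1 / e) * ennreal \<eta>"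
        by (intro add_left_mono mult_left_mono d) simp
      finally show ?thesis .
    qed
    also have "\<dots> = ennreal ((1 + e) * u k + (1 + 1 / e) * \<eta>)"
      using e e1 u \<eta> by (simp add: ennreal_mult)
    finally have 2: "v \<le> (1 + e) * u k + (1 + 1 / e) * \<eta>"
      using e e1 u \<eta> by (subst (asm) ennreal_le_iff) auto
    have 3: "(1 + 1 / e) * \<eta> = \<epsilon> / 4" using e1 by (simp only: \<eta>_def) (simp add: field_simps)
    have ev: "e * v \<le> \<epsilon> / 4" using \<epsilon> v by (simp add: e_def field_simps)
    have up: "u k \<le> v + \<epsilon> / 2" using 1 3 ev by (simp add: algebra_simps)
    have "e * u k \<le> e * (v + \<epsilon> / 2)" using up e by (intro mult_left_mono) auto
    also have "\<dots> \<le> \<epsilon> / 4" using \<epsilon> v by (simp add: e_def field_simps)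
    finally have "v \<le> u k + \<epsilon> / 2" using 2 3 by (simp add: algebra_simps)
    then show ?thesis using up \<epsilon> by auto
  qed
  then show "\<exists>k0. \<forall>k\<ge>k0. norm (u k - v) < \<epsilon>"
    using ev unfolding eventually_sequentially by blast
qed

context standard_brownian_motion
begin

lemma has_wiener_integral_cmult:
  assumes "has_wiener_integral M W t f I" and t: "t \<le> 1"
  shows "has_wiener_integral M W t (\<lambda>s. r * f s) (\<lambda>\<omega>. r * I \<omega>)"
proof -
  obtain n p c where f [measurable]: "f \<in> borel_measurable borel" and I [measurable]: "I \<in> borel_measurable M"
    and p: "\<And>k. mono_on {..n k} (p k) \<and> p k ` {..n k} \<subseteq> {0..t}"
    and 1: "(\<lambda>k. sqnorm_on {0..t} (\<lambda>s. f s - step_function (n k) (p k) (c k) s)) \<longlonglongrightarrow> 0"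
    and 2: "(\<lambda>k. sqnorm M (\<lambda>\<omega>. I \<omega> - step_integral W (n k) (p k) (c k) \<omega>)) \<longlonglongrightarrow> 0"
    using assms unfolding has_wiener_integral_def by auto
  have p01: "p k ` {..n k} \<subseteq> {0..1}" for k using subset_trans[of _ "{0..t}" "{0..1}"] p[of k] t by simp
  note [measurable] = step_integral_measurable[OF p01]
  let ?c = "\<lambda>k i. r * c k i"
  have sf: "step_function n p (\<lambda>i. r * c i) s = r * step_function n p c s" for n p c s
    by (simp only: step_function_def sum_distrib_left mult.assoc)
  have si: "step_integral W n p (\<lambda>i. r * c i) s = r * step_integral W n p c s" for n p c s
    by (simp only: step_integral_def sum_distrib_left mult.assoc)
  have sq: "ennreal ((r * a - r * b)\<^sup>2) = ennreal (r\<^sup>2) * ennreal ((a - b)\<^sup>2)" for a b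
    by (simp add: right_diff_distrib[symmetric] power_mult_distrib ennreal_mult)
  have "(\<lambda>k. ennreal (r\<^sup>2) * sqnorm_on {0..t} (\<lambda>s. f s - step_function (n k) (p k) (c k) s)) \<longlonglongrightarrow> ennreal (r\<^sup>2) * 0"
    by (intro tendsto_mult_ennreal tendsto_const 1) auto
  then have "(\<lambda>k. sqnorm_on {0..t} (\<lambda>s. r * f s - step_function (n k) (p k) (?c k) s)) \<longlonglongrightarrow> 0"
    by (simp add: sf sq mult.assoc nn_integral_cmult)
  moreover have "(\<lambda>k. ennreal (r\<^sup>2) * sqnorm M (\<lambda>\<omega>. I \<omega> - step_integral W (n k) (p k) (c k) \<omega>)) \<longlonglongrightarrow> ennreal (r\<^sup>2) * 0"
    by (intro tendsto_mult_ennreal tendsto_const 2) auto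
  then have "(\<lambda>k. sqnorm M (\<lambda>\<omega>. r * I \<omega> - step_integral W (n k) (p k) (?c k) \<omega>)) \<longlonglongrightarrow> 0"
    by (simp add: si sq nn_integral_cmult)
  ultimately show ?thesis
    unfolding has_wiener_integral_def using p
    by (intro conjI exI[of _ n] exI[of _ p] exI[of _ ?c] allI) auto
qed

text \<open>The two integrals come with unrelated approximating sequences. The part of the second
  sequence before \<open>s\<close> approximates the same integrand as the first sequence, so by the
  isometry the two differ by a quantity that tends to 0 in mean square.\<close>

lemma wiener_integral_increment:
  assumes I: "has_wiener_integral M W s f I" and J: "has_wiener_integral M W t f J"
    and st: "0 \<le> s" "s \<le> t" "t \<le> 1"
  obtains n p c where "\<And>k::nat. mono_on {..n k} (p k)" "\<And>k. p k ` {..n k} \<subseteq> {s..t}"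
    and "(\<lambda>k. sqnorm_on {s<..t} (\<lambda>u. f u - step_function (n k) (p k) (c k) u)) \<longlonglongrightarrow> 0"
    and "(\<lambda>k. sqnorm M (\<lambda>\<omega>. J \<omega> - I \<omega> - step_integral W (n k) (p k) (c k) \<omega>)) \<longlonglongrightarrow> 0"
proof -
  obtain n p c where f [measurable]: "f \<in> borel_measurable borel" and J_meas [measurable]: "J \<in> borel_measurable M"
    and p: "\<And>k. mono_on {..n k} (p k) \<and> p k ` {..n k} \<subseteq> {0..t}"
    and J1: "(\<lambda>k. sqnorm_on {0..t} (\<lambda>u. f u - step_function (n k) (p k) (c k) u)) \<longlonglongrightarrow> 0"
    and J2: "(\<lambda>k. sqnorm M (\<lambda>\<omega>. J \<omega> - step_integral W (n k) (p k) (c k) \<omega>)) \<longlonglongrightarrow> 0"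
    using J unfolding has_wiener_integral_def by auto
  obtain m q d where I_meas [measurable]: "I \<in> borel_measurable M"
    and q: "\<And>k. mono_on {..m k} (q k) \<and> q k ` {..m k} \<subseteq> {0..s}"
    and I1: "(\<lambda>k. sqnorm_on {0..s} (\<lambda>u. f u - step_function (m k) (q k) (d k) u)) \<longlonglongrightarrow> 0"
    and I2: "(\<lambda>k. sqnorm M (\<lambda>\<omega>. I \<omega> - step_integral W (m k) (q k) (d k) \<omega>)) \<longlonglongrightarrow> 0"
    using I unfolding has_wiener_integral_def by auto
  \<comment> \<open>Clipping the partition from below and from above at \<open>s\<close> splits a step integral at time \<open>s\<close>.\<close>
  define hi where "hi k i = max s (p k i)" for k i
  define lo where "lo k i = min s (p k i)" for k i
  have p_mem: "0 \<le> p k i" "p k i \<le> t" if "i \<le> n k" for k i using p[of k] that by auto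
  have q_mem: "0 \<le> q k i" "q k i \<le> s" if "i \<le> m k" for k i using q[of k] that by auto
  have p_le: "p k i \<le> p k j" if "i \<le> j" "j \<le> n k" for k i j
    using p[of k] that by (auto intro: mono_onD)
  have hi_mono: "mono_on {..n k} (hi k)" for k
    using p_le[of _ _ k] unfolding hi_def by (intro mono_onI max.mono) auto
  have lo_mono: "mono_on {..n k} (lo k)" for k
    using p_le[of _ _ k] unfolding lo_def by (intro mono_onI min.mono) auto
  have hi_in: "hi k ` {..n k} \<subseteq> {s..t}" for k using p_mem[of _ k] st by (auto simp: hi_def)
  have lo_in: "lo k ` {..n k} \<subseteq> {0..1}" for k
    using p_mem[of _ k] st by (auto simp: lo_def intro: order_trans)
  have p_in: "p k ` {..n k} \<subseteq> {0..1}" for k using p_mem[of _ k] st by force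
  have q_in: "q k ` {..m k} \<subseteq> {0..1}" for k using q_mem[of _ k] st by force
  have hi_in': "hi k ` {..n k} \<subseteq> {0..1}" for k using subset_trans[OF hi_in[of k], of "{0..1}"] st by simp
  let ?P = "\<lambda>k. step_integral W (n k) (p k) (c k)" and ?Q = "\<lambda>k. step_integral W (m k) (q k) (d k)"
  let ?H = "\<lambda>k. step_integral W (n k) (hi k) (c k)" and ?L = "\<lambda>k. step_integral W (n k) (lo k) (c k)"
  note [measurable] = step_integral_measurable[OF p_in] step_integral_measurable[OF q_in]
    step_integral_measurable[OF hi_in'] step_integral_measurable[OF lo_in]
  have split: "?P k \<omega> = ?L k \<omega> + ?H k \<omega>" for k \<omega>
  proof -
    have eq: "W (p k i) \<omega> = W (lo k i) \<omega> + W (hi k i) \<omega> - W s \<omega>" for i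
      by (cases "p k i \<le> s") (auto simp: lo_def hi_def)
    have "c k i * (W (p k (Suc i)) \<omega> - W (p k i) \<omega>)
        = c k i * (W (lo k (Suc i)) \<omega> - W (lo k i) \<omega>) + c k i * (W (hi k (Suc i)) \<omega> - W (hi k i) \<omega>)" for i
      unfolding eq by (simp only: distrib_left[symmetric]) (simp add: algebra_simps)
    then show ?thesis
      unfolding step_integral_def by (simp add: sum.distrib)
  qed
  have step_hi: "step_function (n k) (hi k) (c k) u = step_function (n k) (p k) (c k) u" if "s < u" for k u
    unfolding step_function_def using that
    by (intro sum.cong) (auto simp: hi_def indicator_def max_def)
  have step_lo: "step_function (n k) (lo k) (c k) u
      = (if u \<le> s then step_function (n k) (p k) (c k) u else 0)" for k u
    unfolding step_function_def
    by (auto simp: lo_def indicator_def min_def intro!: sum.cong sum.neutral)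
  have step_q: "step_function (m k) (q k) (d k) u = 0" if "u \<notin> {0..s}" for k u
    unfolding step_function_def
  proof (rule sum.neutral, rule ballI)
    fix i assume "i \<in> {..<m k}"
    then show "d k i * indicator {q k i<..q k (Suc i)} u = 0"
      using q_mem[of i k] q_mem[of "Suc i" k] that by (auto simp: indicator_def)
  qed
  have step_p0: "step_function (n k) (p k) (c k) u = 0" if "u < 0" for k u
    unfolding step_function_def
  proof (rule sum.neutral, rule ballI)
    fix i assume "i \<in> {..<n k}"
    then show "c k i * indicator {p k i<..p k (Suc i)} u = 0"
      using p_mem[of i k] that by (auto simp: indicator_def)
  qed
  show ?thesis
  proof
    show "mono_on {..n k} (hi k)" "hi k ` {..n k} \<subseteq> {s..t}" for k by (rule hi_mono hi_in)+
    show "(\<lambda>k. sqnorm_on {s<..t} (\<lambda>u. f u - step_function (n k) (hi k) (c k) u)) \<longlonglongrightarrow> 0"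
    proof (rule tendsto_0_ennreal_le[OF J1])
      show "sqnorm_on {s<..t} (\<lambda>u. f u - step_function (n k) (hi k) (c k) u)
          \<le> sqnorm_on {0..t} (\<lambda>u. f u - step_function (n k) (p k) (c k) u)" for k
        using st by (intro nn_integral_mono) (auto simp: indicator_def step_hi)
    qed
    have LQ: "(\<lambda>k. sqnorm M (\<lambda>\<omega>. ?L k \<omega> - ?Q k \<omega>)) \<longlonglongrightarrow> 0"
    proof (rule tendsto_0_ennreal_le)
      show "(\<lambda>k. ennreal 2 * sqnorm_on {0..t} (\<lambda>u. f u - step_function (n k) (p k) (c k) u)
         + ennreal 2 * sqnorm_on {0..s} (\<lambda>u. f u - step_function (m k) (q k) (d k) u)) \<longlonglongrightarrow> 0"
      proof -
        have "(\<lambda>k. ennreal 2 * sqnorm_on {0..t} (\<lambda>u. f u - step_function (n k) (p k) (c k) u)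
         + ennreal 2 * sqnorm_on {0..s} (\<lambda>u. f u - step_function (m k) (q k) (d k) u)) \<longlonglongrightarrow> ennreal 2 * 0 + ennreal 2 * 0"
          by (intro tendsto_add tendsto_mult_ennreal tendsto_const J1 I1) auto
        then show ?thesis by simp
      qed
      fix k
      have "sqnorm M (\<lambda>\<omega>. ?L k \<omega> - ?Q k \<omega>)
        = sqnorm lborel (\<lambda>u. step_function (n k) (lo k) (c k) u - step_function (m k) (q k) (d k) u)"
        using q by (intro isometry_step_diff lo_mono lo_in q_in) auto
      also have "\<dots> \<le> (\<integral>\<^sup>+u. ennreal 2 * (ennreal ((f u - step_function (n k) (p k) (c k) u)\<^sup>2) * indicator {0..t} u)
         + ennreal 2 * (ennreal ((f u - step_function (m k) (q k) (d k) u)\<^sup>2) * indicator {0..s} u) \<partial>lborel)"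
      \<comment> \<open>On [0, s] both step functions are compared with \<open>f\<close>; outside
        this interval both vanish.\<close>
      proof (rule nn_integral_mono)
        fix u
        have "(a - b)\<^sup>2 \<le> 2 * (y - a)\<^sup>2 + 2 * (y - b)\<^sup>2" for a b y :: real
          using zero_le_power2[of "(y - a) + (y - b)"] by (simp add: power2_eq_square algebra_simps)
        then have key: "ennreal ((a - b)\<^sup>2) \<le> ennreal 2 * ennreal ((y - a)\<^sup>2) + ennreal 2 * ennreal ((y - b)\<^sup>2)"
          for a b y :: real
          using ennreal_leI[of "(a - b)\<^sup>2" "2 * (y - a)\<^sup>2 + 2 * (y - b)\<^sup>2"]
          by (simp add: ennreal_mult)
        show "ennreal ((step_function (n k) (lo k) (c k) u - step_function (m k) (q k) (d k) u)\<^sup>2)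
          \<le> ennreal 2 * (ennreal ((f u - step_function (n k) (p k) (c k) u)\<^sup>2) * indicator {0..t} u)
         + ennreal 2 * (ennreal ((f u - step_function (m k) (q k) (d k) u)\<^sup>2) * indicator {0..s} u)"
        proof (cases "u \<in> {0..s}")
          case True
          then have "u \<in> {0..t}" "step_function (n k) (lo k) (c k) u = step_function (n k) (p k) (c k) u"
            using st by (auto simp: step_lo)
          then show ?thesis using True key by simp
        next
          case False
          then have "step_function (n k) (lo k) (c k) u = 0" by (auto simp: step_lo step_p0)
          then show ?thesis using step_q[OF False] by simp
        qed
      qed
      also have "\<dots> = ennreal 2 * sqnorm_on {0..t} (\<lambda>u. f u - step_function (n k) (p k) (c k) u)
         + ennreal 2 * sqnorm_on {0..s} (\<lambda>u. f u - step_function (m k) (q k) (d k) u)"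
        by (simp add: nn_integral_add nn_integral_cmult)
      finally show "sqnorm M (\<lambda>\<omega>. ?L k \<omega> - ?Q k \<omega>) \<le> \<dots>" .
    qed
    show "(\<lambda>k. sqnorm M (\<lambda>\<omega>. J \<omega> - I \<omega> - ?H k \<omega>)) \<longlonglongrightarrow> 0"
    proof (rule tendsto_0_ennreal_le)
      let ?g = "\<lambda>k. ennreal 3 * (sqnorm M (\<lambda>\<omega>. J \<omega> - ?P k \<omega>)
        + sqnorm M (\<lambda>\<omega>. ?L k \<omega> - ?Q k \<omega>) + sqnorm M (\<lambda>\<omega>. I \<omega> - ?Q k \<omega>))"
      have "?g \<longlonglongrightarrow> ennreal 3 * (0 + 0 + 0)"
        by (intro tendsto_add tendsto_mult_ennreal tendsto_const J2 I2 LQ) auto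
      then show "?g \<longlonglongrightarrow> 0" by simp
      fix k
      have "ennreal ((J \<omega> - I \<omega> - ?H k \<omega>)\<^sup>2) \<le> ennreal 3 * (ennreal ((J \<omega> - ?P k \<omega>)\<^sup>2)
          + ennreal ((?L k \<omega> - ?Q k \<omega>)\<^sup>2) + ennreal ((I \<omega> - ?Q k \<omega>)\<^sup>2))" for \<omega>
      proof -
        have eq: "J \<omega> - I \<omega> - ?H k \<omega> = (J \<omega> - ?P k \<omega>) + (?L k \<omega> - ?Q k \<omega>) - (I \<omega> - ?Q k \<omega>)"
          by (simp add: split)
        have "(J \<omega> - I \<omega> - ?H k \<omega>)\<^sup>2
            \<le> 3 * ((J \<omega> - ?P k \<omega>)\<^sup>2 + (?L k \<omega> - ?Q k \<omega>)\<^sup>2 + (I \<omega> - ?Q k \<omega>)\<^sup>2)"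
          unfolding eq by (rule square_sum3_le)
        from ennreal_leI[OF this] show ?thesis by (simp add: ennreal_mult)
      qed
      then have "sqnorm M (\<lambda>\<omega>. J \<omega> - I \<omega> - ?H k \<omega>) \<le> (\<integral>\<^sup>+\<omega>. ennreal 3 * (ennreal ((J \<omega> - ?P k \<omega>)\<^sup>2)
          + ennreal ((?L k \<omega> - ?Q k \<omega>)\<^sup>2) + ennreal ((I \<omega> - ?Q k \<omega>)\<^sup>2)) \<partial>M)"
        by (intro nn_integral_mono)
      also have "\<dots> = ?g k" by (simp add: nn_integral_add nn_integral_cmult)
      finally show "sqnorm M (\<lambda>\<omega>. J \<omega> - I \<omega> - ?H k \<omega>) \<le> ?g k" .
    qed
  qed
qed

end

section \<open>The law of an increment of the Wiener integral, given the past\<close>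

lemma (in prob_space) char_distr_tendsto_of_L2:
  assumes [measurable]: "\<And>k. Z k \<in> borel_measurable M" "D \<in> borel_measurable M"
    and lim: "(\<lambda>k. sqnorm M (\<lambda>\<omega>. D \<omega> - Z k \<omega>)) \<longlonglongrightarrow> 0"
  shows "(\<lambda>k. char (distr M borel (Z k)) t) \<longlonglongrightarrow> char (distr M borel D) t"
proof (rule LIMSEQ_I)
  fix r :: real assume r: "0 < r"
  \<comment> \<open>The estimate ends with 2 |t| \<epsilon>, which this choice keeps below
    \<open>r\<close>; the summand 1 covers t = 0.\<close>
  define \<epsilon> where "\<epsilon> = r / (2 * (1 + \<bar>t\<bar>))"
  have \<epsilon>: "0 < \<epsilon>" using r by (simp add: \<epsilon>_def)
  have te: "\<bar>t\<bar> * \<epsilon> < r / 2" using r by (simp add: \<epsilon>_def field_simps)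
  have ev: "eventually (\<lambda>k. sqnorm M (\<lambda>\<omega>. D \<omega> - Z k \<omega>) < ennreal (\<epsilon>\<^sup>2)) sequentially"
    using lim by (rule order_tendstoD) (use \<epsilon> in simp)
  have "norm (char (distr M borel (Z k)) t - char (distr M borel D) t) < r"
    if small: "sqnorm M (\<lambda>\<omega>. D \<omega> - Z k \<omega>) < ennreal (\<epsilon>\<^sup>2)" for k
  proof -
    have int [simp]: "integrable M (\<lambda>\<omega>. (D \<omega> - Z k \<omega>)\<^sup>2)"
      using small by (intro integrableI_bounded) (auto intro: less_trans)
    have sq: "(\<integral>\<omega>. (D \<omega> - Z k \<omega>)\<^sup>2 \<partial>M) < \<epsilon>\<^sup>2"
    proof -
      have "ennreal (\<integral>\<omega>. (D \<omega> - Z k \<omega>)\<^sup>2 \<partial>M) < ennreal (\<epsilon>\<^sup>2)"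
        using small by (subst nn_integral_eq_integral[symmetric]) auto
      then show ?thesis by (subst (asm) ennreal_less_iff) auto
    qed
    have int1: "integrable M (\<lambda>\<omega>. \<bar>t\<bar> * (\<epsilon> + (D \<omega> - Z k \<omega>)\<^sup>2 / \<epsilon>))"
      by (intro integrable_mult_right Bochner_Integration.integrable_add integrable_divide int) simp
    have bd: "norm (iexp (t * Z k \<omega>) - iexp (t * D \<omega>)) \<le> \<bar>t\<bar> * (\<epsilon> + (D \<omega> - Z k \<omega>)\<^sup>2 / \<epsilon>)" for \<omega>
    proof -
      let ?x = "t * (Z k \<omega> - D \<omega>)"
      have "iexp (t * Z k \<omega>) - iexp (t * D \<omega>) = iexp (t * D \<omega>) * (iexp ?x - 1)"
        unfolding right_diff_distrib exp_add[symmetric] distrib_left[symmetric] of_real_add[symmetric]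
        by simp
      then have "norm (iexp (t * Z k \<omega>) - iexp (t * D \<omega>)) = norm (iexp ?x - 1)"
        by (simp add: norm_mult)
      also have "\<dots> \<le> \<bar>?x\<bar>"
        using iexp_approx1[of ?x 0] by simp
      also have "\<dots> = \<bar>t\<bar> * \<bar>D \<omega> - Z k \<omega>\<bar>" by (simp add: abs_mult abs_minus_commute)
      \<comment> \<open>The linear bound is traded for one by the square, whose integral is what the
        hypothesis controls.\<close>
      also have "\<bar>D \<omega> - Z k \<omega>\<bar> \<le> \<epsilon> + (D \<omega> - Z k \<omega>)\<^sup>2 / \<epsilon>"
      proof (cases "\<bar>D \<omega> - Z k \<omega>\<bar> \<le> \<epsilon>")
        case True
        then show ?thesis using \<epsilon> by (simp add: add_increasing2)
      next
        case False
        then have "\<bar>D \<omega> - Z k \<omega>\<bar> * \<epsilon> \<le> \<bar>D \<omega> - Z k \<omega>\<bar> * \<bar>D \<omega> - Z k \<omega>\<bar>" using \<epsilon> by (intro mult_left_mono) auto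
        then have "\<bar>D \<omega> - Z k \<omega>\<bar> \<le> (D \<omega> - Z k \<omega>)\<^sup>2 / \<epsilon>" using \<epsilon> by (simp add: field_simps power2_eq_square)
        then show ?thesis using \<epsilon> by simp
      qed
      finally show ?thesis by (simp add: mult_left_mono)
    qed
    have "char (distr M borel (Z k)) t - char (distr M borel D) t
        = (\<integral>\<omega>. iexp (t * Z k \<omega>) - iexp (t * D \<omega>) \<partial>M)"
      unfolding char_def
      by (simp add: integral_distr Bochner_Integration.integral_diff integrable_iexp)
    also have "norm \<dots> \<le> (\<integral>\<omega>. \<bar>t\<bar> * (\<epsilon> + (D \<omega> - Z k \<omega>)\<^sup>2 / \<epsilon>) \<partial>M)"
      by (rule order_trans[OF integral_norm_bound], rule integral_mono[OF _ int1 bd])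
        (auto intro!: integrable_norm Bochner_Integration.integrable_diff integrable_iexp)
    also have "\<dots> = \<bar>t\<bar> * (\<epsilon> + (\<integral>\<omega>. (D \<omega> - Z k \<omega>)\<^sup>2 \<partial>M) / \<epsilon>)"
      by (simp add: prob_space)
    also have "\<dots> \<le> \<bar>t\<bar> * (\<epsilon> + \<epsilon>\<^sup>2 / \<epsilon>)"
      using sq \<epsilon> by (intro mult_left_mono add_left_mono divide_right_mono) auto
    also have "\<dots> < r" using te \<epsilon> by (simp add: power2_eq_square algebra_simps)
    finally show ?thesis .
  qed
  then show "\<exists>k0. \<forall>k\<ge>k0. norm (char (distr M borel (Z k)) t - char (distr M borel D) t) < r"
    using ev unfolding eventually_sequentially by blast
qed

context standard_brownian_motion
begin

text \<open>One formula gives both facts: normality, with \<open>A\<close> the whole space, and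
  independence of the past, with \<open>A\<close> arbitrary.\<close>

lemma wiener_increment_law:
  assumes s: "0 \<le> s" "s \<le> t" "t \<le> 1"
    and p: "\<And>k::nat. mono_on {..n k} (p k)" "\<And>k. p k ` {..n k} \<subseteq> {s..t}"
    and f [measurable]: "f \<in> borel_measurable borel" and D [measurable]: "D \<in> borel_measurable M"
    and limf: "(\<lambda>k. sqnorm_on {s<..t} (\<lambda>u. f u - step_function (n k) (p k) (c k) u)) \<longlonglongrightarrow> 0"
    and limD: "(\<lambda>k. sqnorm M (\<lambda>\<omega>. D \<omega> - step_integral W (n k) (p k) (c k) \<omega>)) \<longlonglongrightarrow> 0"
    and v: "sqnorm_on {s<..t} (\<lambda>u. f u) = ennreal v" "0 < v"
    and A: "A \<in> sets (natural_filtration M W s)" and B [measurable]: "B \<in> sets borel"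
  shows "emeasure M (A \<inter> (D -` B \<inter> space M))
       = emeasure M A * emeasure (density lborel (normal_density 0 (sqrt v))) B"
proof (cases "emeasure M A = 0")
  case True
  then have "emeasure M (A \<inter> (D -` B \<inter> space M)) = 0"
    by (rule emeasure_eq_0[OF subsetD[OF natural_filtration_subset A]]) auto
  then show ?thesis using True by simp
next
  case False
  have A' [measurable]: "A \<in> events" by (rule subsetD[OF natural_filtration_subset A])
  have PA: "0 < prob A" using False by (simp add: emeasure_eq_measure zero_less_measure_iff)
  \<comment> \<open>Under the conditional law given \<open>A\<close> the step integrals keep their law, and characteristic
    functions pass to the \<open>L\<^sup>2\<close> limit \<open>D\<close>.\<close>
  define Q where "Q = uniform_measure M A"
  interpret Q: prob_space Q
    unfolding Q_def by (rule prob_space_uniform_measure) (use False in auto)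
  have sets_Q [measurable_cong, simp]: "sets Q = sets M" by (simp add: Q_def)
  have space_Q [simp]: "space Q = space M" by (simp add: Q_def)
  have p01: "p k ` {..n k} \<subseteq> {0..1}" for k using subset_trans[OF p(2), of "{0..1}" k] s by simp
  have ps1: "p k ` {..n k} \<subseteq> {s..1}" for k using subset_trans[OF p(2), of "{s..1}" k] s by simp
  let ?I = "\<lambda>k. step_integral W (n k) (p k) (c k)"
  note I [measurable] = step_integral_measurable[OF p01]
  have distr_I: "distr Q borel (?I k) = distr M borel (?I k)" for k
  proof (rule measure_eqI)
    fix C assume "C \<in> sets (distr Q borel (?I k))"
    then have C [measurable]: "C \<in> sets borel" by simp
    have "prob (A \<inter> (?I k -` C \<inter> space M)) = prob A * prob (?I k -` C \<inter> space M)"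
      by (rule prob_filtration_Int_step_integral[OF _ _ p(1) ps1 A]) (use s in auto)
    then have "emeasure Q (?I k -` C \<inter> space M) = emeasure M (?I k -` C \<inter> space M)"
      unfolding Q_def using PA
      by (simp add: emeasure_eq_measure divide_ennreal)
    then show "emeasure (distr Q borel (?I k)) C = emeasure (distr M borel (?I k)) C"
      by (simp add: emeasure_distr)
  qed simp
  have limQ: "(\<lambda>k. sqnorm Q (\<lambda>\<omega>. D \<omega> - ?I k \<omega>)) \<longlonglongrightarrow> 0"
  proof (rule tendsto_0_ennreal_le)
    have "(\<lambda>k. sqnorm M (\<lambda>\<omega>. D \<omega> - ?I k \<omega>) * ennreal (1 / prob A)) \<longlonglongrightarrow> 0 * ennreal (1 / prob A)"
      by (intro tendsto_mult_ennreal limD tendsto_const) auto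
    then show "(\<lambda>k. sqnorm M (\<lambda>\<omega>. D \<omega> - ?I k \<omega>) * ennreal (1 / prob A)) \<longlonglongrightarrow> 0" by simp
    fix k
    have "sqnorm Q (\<lambda>\<omega>. D \<omega> - ?I k \<omega>)
        = (\<integral>\<^sup>+\<omega>. ennreal ((D \<omega> - ?I k \<omega>)\<^sup>2) * indicator A \<omega> \<partial>M) / emeasure M A"
      unfolding Q_def by (rule nn_integral_uniform_measure) auto
    also have "\<dots> \<le> sqnorm M (\<lambda>\<omega>. D \<omega> - ?I k \<omega>) / emeasure M A"
      by (intro divide_right_mono_ennreal nn_integral_mono) (auto simp: indicator_def)
    also have "\<dots> = sqnorm M (\<lambda>\<omega>. D \<omega> - ?I k \<omega>) * ennreal (1 / prob A)"
      using PA by (simp add: emeasure_eq_measure divide_ennreal_def inverse_ennreal inverse_eq_divide)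
    finally show "sqnorm Q (\<lambda>\<omega>. D \<omega> - ?I k \<omega>)
       \<le> sqnorm M (\<lambda>\<omega>. D \<omega> - ?I k \<omega>) * ennreal (1 / prob A)" .
  qed
  have lim_var: "(\<lambda>k. step_variance (n k) (p k) (c k)) \<longlonglongrightarrow> v"
  proof (rule tendsto_nn_integral_square[where M = lborel and g = "\<lambda>u. f u * indicator {s<..t} u"
        and f = "\<lambda>k u. step_function (n k) (p k) (c k) u"])
    show "sqnorm lborel (\<lambda>u. f u * indicator {s<..t} u) = ennreal v"
      unfolding v(1)[symmetric] by (intro nn_integral_cong) (auto simp: indicator_def)
    have out: "step_function (n k) (p k) (c k) u = 0" if "u \<notin> {s<..t}" for k u
      unfolding step_function_def
    proof (rule sum.neutral, rule ballI)
      fix i assume i: "i \<in> {..<n k}"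
      have "p k i \<in> {s..t}" "p k (Suc i) \<in> {s..t}" using p(2)[of k] i by (auto simp: image_subset_iff)
      then show "c k i * indicator {p k i<..p k (Suc i)} u = 0"
        using that by (auto simp: indicator_def)
    qed
    have eq: "ennreal ((f u * indicator {s<..t} u - step_function (n k) (p k) (c k) u)\<^sup>2)
        = ennreal ((f u - step_function (n k) (p k) (c k) u)\<^sup>2) * indicator {s<..t} u" for k u
      using out[of u k] by (cases "u \<in> {s<..t}") auto
    show "(\<lambda>k. sqnorm lborel (\<lambda>u. f u * indicator {s<..t} u - step_function (n k) (p k) (c k) u))
        \<longlonglongrightarrow> 0"
      unfolding eq by (rule limf)
    show "0 \<le> step_variance (n k) (p k) (c k)" for k
      unfolding step_variance_def
      by (intro sum_nonneg mult_nonneg_nonneg) (auto intro!: mono_onD[OF p(1)])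
  qed (use v nn_integral_step_function_square[OF p(1)] in auto)
  let ?N = "density lborel (normal_density 0 (sqrt v))"
  have "char (distr Q borel D) = char ?N"
  proof
    fix r
    have "(\<lambda>k. char (distr Q borel (?I k)) r) \<longlonglongrightarrow> char (distr Q borel D) r"
      by (rule Q.char_distr_tendsto_of_L2[OF _ _ limQ]) auto
    moreover have "(\<lambda>k. char (distr Q borel (?I k)) r) \<longlonglongrightarrow> complex_of_real (exp (- r\<^sup>2 * v / 2))"
      unfolding distr_I char_step_integral[OF p(1) p01] by (intro tendsto_intros lim_var) simp
    ultimately have "char (distr Q borel D) r = complex_of_real (exp (- r\<^sup>2 * v / 2))"
      by (rule LIMSEQ_unique)
    then show "char (distr Q borel D) r = char ?N r"
      using v(2) by (simp add: char_normal_density power_mult_distrib)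
  qed
  moreover have "real_distribution (distr Q borel D)" by simp
  moreover have "real_distribution ?N"
    using prob_space_normal_density[of "sqrt v" 0] v(2)
    by (simp add: real_distribution_def real_distribution_axioms_def)
  ultimately have "distr Q borel D = ?N" by (intro Levy_uniqueness)
  then have "emeasure ?N B = emeasure Q (D -` B \<inter> space M)"
    by (metis B D emeasure_distr measurable_cong_sets sets_Q space_Q)
  then have "emeasure ?N B = emeasure M (A \<inter> (D -` B \<inter> space M)) / emeasure M A"
    unfolding Q_def by simp
  then show ?thesis
    using PA by (simp add: emeasure_eq_measure divide_ennreal ennreal_mult[symmetric])
qed

text \<open>The past and \<open>D\<close> have a product law, so by Fubini \<open>D\<close> can be
  integrated out with \<open>Y\<close> held fixed.\<close>

lemma nn_integral_filtration_increment:
  assumes s: "0 \<le> s"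
    and law: "\<And>A B. A \<in> sets (natural_filtration M W s) \<Longrightarrow> B \<in> sets borel \<Longrightarrow>
       emeasure M (A \<inter> (D -` B \<inter> space M))
       = emeasure M A * emeasure (density lborel (normal_density 0 \<sigma>)) B"
    and \<sigma>: "0 < \<sigma>" and D [measurable]: "D \<in> borel_measurable M"
    and Y: "Y \<in> borel_measurable (natural_filtration M W s)"
    and A: "A \<in> sets (natural_filtration M W s)"
    and h [measurable]: "h \<in> borel_measurable borel"
  shows "(\<integral>\<^sup>+\<omega>. h (Y \<omega> + D \<omega>) * indicator A \<omega> \<partial>M)
       = (\<integral>\<^sup>+\<omega>. gauss_mean \<sigma> (\<lambda>d. h (Y \<omega> + d)) * indicator A \<omega> \<partial>M)"
proof -
  let ?N = "density lborel (normal_density 0 \<sigma>)"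
  let ?F = "natural_filtration M W s"
  \<comment> \<open>The image of \<open>M\<close> under the identity is \<open>M\<close> restricted
    to the past of \<open>s\<close>; the product law holds for events of this smaller
    sigma-algebra.\<close>
  let ?R = "distr M ?F (\<lambda>\<omega>. \<omega>)"
  interpret N: prob_space ?N by (rule prob_space_normal_density[OF \<sigma>])
  have id [measurable]: "(\<lambda>\<omega>. \<omega>) \<in> measurable M ?F"
    using natural_filtration_subset[of s] sets.sets_into_space[of _ M]
    by (auto intro!: measurableI simp: Int_absorb2 subset_iff)
  interpret R: prob_space ?R by (rule prob_space_distr) simp
  note [measurable] = A
  have Y' [measurable]: "Y \<in> borel_measurable ?R" using Y by simp
  have sets_R: "sets ?R = sets ?F" by simp
  have eq: "?R \<Otimes>\<^sub>M ?N = distr M (?F \<Otimes>\<^sub>M borel) (\<lambda>\<omega>. (\<omega>, D \<omega>))"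
  proof (rule pair_measure_eqI)
    show "sigma_finite_measure ?R" "sigma_finite_measure ?N"
      by (simp_all add: R.sigma_finite_measure_axioms N.sigma_finite_measure_axioms)
    show "sets (?R \<Otimes>\<^sub>M ?N) = sets (distr M (?F \<Otimes>\<^sub>M borel) (\<lambda>\<omega>. (\<omega>, D \<omega>)))"
      by (simp cong: sets_pair_measure_cong)
    fix a b assume "a \<in> sets ?R" "b \<in> sets ?N"
    then have a: "a \<in> sets ?F" and b: "b \<in> sets borel" by auto
    have aM: "a \<in> sets M" by (rule subsetD[OF natural_filtration_subset a])
    have "(\<lambda>\<omega>. (\<omega>, D \<omega>)) -` (a \<times> b) \<inter> space M = a \<inter> (D -` b \<inter> space M)"
      using sets.sets_into_space[OF aM] by auto
    moreover have "(\<lambda>\<omega>. \<omega>) -` a \<inter> space M = a" using sets.sets_into_space[OF aM] by auto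
    ultimately show "emeasure ?R a * emeasure ?N b = emeasure (distr M (?F \<Otimes>\<^sub>M borel) (\<lambda>\<omega>. (\<omega>, D \<omega>))) (a \<times> b)"
      using a b law[OF a b] by (simp add: emeasure_distr)
  qed
  have meas: "(\<lambda>z. h (Y (fst z) + snd z) * indicator A (fst z)) \<in> borel_measurable (?F \<Otimes>\<^sub>M borel)"
    using Y by measurable
  have meas': "(\<lambda>z. h (Y (fst z) + snd z) * indicator A (fst z)) \<in> borel_measurable (?R \<Otimes>\<^sub>M ?N)"
    using meas by (simp cong: measurable_cong_sets sets_pair_measure_cong)
  have "(\<integral>\<^sup>+\<omega>. h (Y \<omega> + D \<omega>) * indicator A \<omega> \<partial>M)
      = (\<integral>\<^sup>+z. h (Y (fst z) + snd z) * indicator A (fst z) \<partial>distr M (?F \<Otimes>\<^sub>M borel) (\<lambda>\<omega>. (\<omega>, D \<omega>)))"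
    by (subst nn_integral_distr) (use meas in auto)
  also have "\<dots> = (\<integral>\<^sup>+\<omega>. \<integral>\<^sup>+d. h (Y \<omega> + d) * indicator A \<omega> \<partial>?N \<partial>?R)"
    unfolding eq[symmetric] by (subst N.nn_integral_fst[OF meas', symmetric]) simp
  also have "\<dots> = (\<integral>\<^sup>+\<omega>. gauss_mean \<sigma> (\<lambda>d. h (Y \<omega> + d)) * indicator A \<omega> \<partial>?R)"
    by (intro nn_integral_cong) (simp add: nn_integral_multc nn_integral_density)
  also have "\<dots> = (\<integral>\<^sup>+\<omega>. gauss_mean \<sigma> (\<lambda>d. h (Y \<omega> + d)) * indicator A \<omega> \<partial>M)"
    using Y by (subst nn_integral_distr) auto
  finally show ?thesis .
qed

end

section \<open>Optional stopping\<close>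

text \<open>\<open>clock \<alpha> t\<close> is \<open>\<integral>\<^sub>0\<^sup>t (1 - s)\<^sup>-\<^sup>2\<^sup>\<alpha> ds\<close>, the variance of the Gaussian martingale
  \<open>(1 - t)\<^sup>-\<^sup>\<alpha> X t\<close>.\<close>

definition clock :: "real \<Rightarrow> real \<Rightarrow> real" where
  "clock \<alpha> t = (if \<alpha> = 1/2 then - ln (1 - t) else (1 - (1 - t) powr (1 - 2 * \<alpha>)) / (1 - 2 * \<alpha>))"

lemma DERIV_clock:
  assumes "t < 1"
  shows "(clock \<alpha> has_real_derivative (1 - t) powr (- 2 * \<alpha>)) (at t)"
proof (cases "\<alpha> = 1/2")
  case True
  have "((\<lambda>t. - ln (1 - t)) has_real_derivative 1 / (1 - t)) (at t)"
    using assms by (auto intro!: derivative_eq_intros)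
  moreover have "(1 - t) powr (- 2 * \<alpha>) = 1 / (1 - t)"
    using assms by (simp add: True powr_minus inverse_eq_divide)
  ultimately show ?thesis by (simp add: clock_def[abs_def] True)
next
  case False
  then have nz: "1 - 2 * \<alpha> \<noteq> 0" by simp
  have "((\<lambda>t. 1 - t) has_real_derivative - 1) (at t)"
    by (auto intro!: derivative_eq_intros)
  from DERIV_fun_powr[OF this, of "1 - 2 * \<alpha>"] assms
  have "((\<lambda>t. (1 - t) powr (1 - 2 * \<alpha>)) has_real_derivative
      (1 - 2 * \<alpha>) * (1 - t) powr (- 2 * \<alpha>) * - 1) (at t)"
    by simp
  from DERIV_cdivide[OF DERIV_diff[OF DERIV_const[of 1] this], of "1 - 2 * \<alpha>"]
  have "((\<lambda>t. (1 - (1 - t) powr (1 - 2 * \<alpha>)) / (1 - 2 * \<alpha>)) has_real_derivative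
      (1 - t) powr (- 2 * \<alpha>)) (at t)"
    using nz by simp
  then show ?thesis using False by (simp add: clock_def[abs_def])
qed

lemma clock_strict_mono:
  assumes "s < t" "t < 1"
  shows "clock \<alpha> s < clock \<alpha> t"
proof (rule DERIV_pos_imp_increasing[OF assms(1)])
  show "\<exists>y. DERIV (clock \<alpha>) x :> y \<and> 0 < y" if "s \<le> x" "x \<le> t" for x
    using DERIV_clock[of x \<alpha>] that assms by (intro exI[of _ "(1 - x) powr (- 2 * \<alpha>)"]) auto
qed

lemma nn_integral_clock:
  assumes "s < t" "t < 1"
  shows "sqnorm_on {s<..t} (\<lambda>u. (1 - u) powr - \<alpha>) = ennreal (clock \<alpha> t - clock \<alpha> s)"
proof -
  have "sqnorm_on {s<..t} (\<lambda>u. (1 - u) powr - \<alpha>)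
      = (\<integral>\<^sup>+u\<in>{s..t}. ennreal ((1 - u) powr (- 2 * \<alpha>)) \<partial>lborel)"
  proof (rule nn_integral_cong_AE)
    \<comment> \<open>The fundamental theorem is applied on a closed interval; the added endpoint is
      a null set.\<close>
    have "AE u in lborel. u \<noteq> s" by (rule AE_lborel_singleton)
    then show "AE u in lborel. ennreal (((1 - u) powr - \<alpha>)\<^sup>2) * indicator {s<..t} u
        = ennreal ((1 - u) powr (- 2 * \<alpha>)) * indicator {s..t} u"
    proof eventually_elim
      case (elim u)
      have "((1 - u) powr - \<alpha>)\<^sup>2 = (1 - u) powr (- 2 * \<alpha>)"
        by (simp add: power2_eq_square powr_add[symmetric])
      then show ?case using elim by (auto simp: indicator_def)
    qed
  qed
  also have "\<dots> = ennreal (clock \<alpha> t - clock \<alpha> s)"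
  proof (rule nn_integral_FTC_Icc)
    show "DERIV (clock \<alpha>) u :> (1 - u) powr (- 2 * \<alpha>)" if "u \<in> {s..t}" for u
      using that assms by (intro DERIV_clock) auto
  qed (use assms in auto)
  finally show ?thesis .
qed

lemma has_wiener_integral_cong:
  assumes "has_wiener_integral M W t f I" "g \<in> borel_measurable borel"
    and "\<And>s. s \<in> {0..t} \<Longrightarrow> f s = g s"
  shows "has_wiener_integral M W t g I"
proof -
  have "sqnorm_on {0..t} (\<lambda>s. f s - h s) = sqnorm_on {0..t} (\<lambda>s. g s - h s)"
    for h by (intro nn_integral_cong) (auto simp: indicator_def assms(3))
  then show ?thesis using assms(1,2) unfolding has_wiener_integral_def by simp
qed

text \<open>The backward heat equation in integrated form: the second argument is the value of
  \<open>N\<close>, and the clock gives the variance of its increment from \<open>s\<close> to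
  \<open>t\<close>.\<close>

definition heat_martingale :: "real \<Rightarrow> (real \<Rightarrow> real \<Rightarrow> real) \<Rightarrow> bool" where
  "heat_martingale \<alpha> H \<longleftrightarrow>
     (\<forall>t n. 0 \<le> H t n) \<and> continuous_on ({0..<1} \<times> UNIV) (\<lambda>(t, n). H t n) \<and>
     (\<forall>s t n. 0 \<le> s \<longrightarrow> s < t \<longrightarrow> t < 1 \<longrightarrow>
        gauss_mean (sqrt (clock \<alpha> t - clock \<alpha> s)) (\<lambda>d. ennreal (H t (n + d)))
        = ennreal (H s n))"

text \<open>The centred normal law is symmetric. The reflected function later dominates
  \<open>- X\<close> and so controls the negative part.\<close>

lemma heat_martingale_reflect:
  assumes "heat_martingale \<alpha> H"
  shows "heat_martingale \<alpha> (\<lambda>t n. H t (- n))"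
proof -
  note H = assms[unfolded heat_martingale_def]
  have cont: "continuous_on ({0..<1} \<times> UNIV) (\<lambda>(t, n). H t (- n))"
  proof -
    have "continuous_on ({0..<1} \<times> UNIV) ((\<lambda>(t, n). H t n) \<circ> (\<lambda>(t, n). (t, - n)))"
    proof (rule continuous_on_compose)
      show "continuous_on ({0..<1} \<times> UNIV) (\<lambda>(t :: real, n :: real). (t, - n))"
        by (auto simp: case_prod_beta intro!: continuous_intros)
      show "continuous_on ((\<lambda>(t :: real, n :: real). (t, - n)) ` ({0..<1} \<times> UNIV)) (\<lambda>(t, n). H t n)"
        by (rule continuous_on_subset[of "{0..<1} \<times> UNIV"]) (use H in auto)
    qed
    then show ?thesis by (simp add: o_def case_prod_beta)
  qed
  have "gauss_mean (sqrt (clock \<alpha> t - clock \<alpha> s)) (\<lambda>d. ennreal (H t (- (n + d))))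
        = ennreal (H s (- n))" if st: "0 \<le> s" "s < t" "t < 1" for s t n
  proof -
    have Ht: "continuous_on UNIV (H t)"
    proof -
      have "continuous_on UNIV ((\<lambda>(t, n). H t n) \<circ> (\<lambda>n. (t, n)))"
        by (rule continuous_on_compose, intro continuous_intros,
            rule continuous_on_subset[of "{0..<1} \<times> UNIV"]) (use H st in auto)
      then show ?thesis by (simp add: o_def)
    qed
    then have [measurable]: "H t \<in> borel_measurable borel" by (rule borel_measurable_continuous_onI)
    let ?\<sigma> = "sqrt (clock \<alpha> t - clock \<alpha> s)"
    have "gauss_mean ?\<sigma> (\<lambda>d. ennreal (H t (- n + d)))
      = (\<integral>\<^sup>+d. ennreal (normal_density 0 ?\<sigma> (0 + (-1) * d)) * ennreal (H t (- n + (0 + (-1) * d))) \<partial>lborel)"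
      by (subst nn_integral_real_affine[where c = "-1" and t = 0]) auto
    also have "\<dots> = gauss_mean ?\<sigma> (\<lambda>d. ennreal (H t (- (n + d))))"
      by (simp add: normal_density_def)
    finally show ?thesis
      using H[THEN conjunct2, THEN conjunct2, rule_format, OF st, of "- n"] by simp
  qed
  then show ?thesis
    unfolding heat_martingale_def using H cont by auto
qed

section \<open>Approximation of stopping times by times with finitely many values\<close>

context standard_brownian_motion
begin

lemma admissible_times_measurable:
  assumes "stopping_time (natural_filtration M W) \<rho>"
  shows "\<rho> \<in> borel_measurable M"
  by (rule measurable_stopping_time[OF assms natural_filtration_subset]) simp

text \<open>\<open>\<rho>\<close> is rounded up to the grid of mesh \<open>T / Suc n\<close>.
  Rounding up preserves the stopping property, and \<open>T\<close> is a grid point, so the bound is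
  preserved too.\<close>

lemma stopping_time_approx:
  assumes st: "stopping_time (natural_filtration M W) \<rho>"
    and bd: "\<And>\<omega>. \<omega> \<in> space M \<Longrightarrow> 0 \<le> \<rho> \<omega> \<and> \<rho> \<omega> \<le> T" and T: "0 < T"
  obtains \<sigma> K where "\<And>n::nat. finite (K n)" "\<And>n. K n \<subseteq> {0..T}"
    "\<And>n \<omega>. \<omega> \<in> space M \<Longrightarrow> \<sigma> n \<omega> \<in> K n"
    "\<And>n k. k \<in> K n \<Longrightarrow> {\<omega> \<in> space M. \<sigma> n \<omega> = k} \<in> sets (natural_filtration M W k)"
    "\<And>\<omega>. \<omega> \<in> space M \<Longrightarrow> (\<lambda>n. \<sigma> n \<omega>) \<longlonglongrightarrow> \<rho> \<omega>"
proof
  define h where "h n = T / real (Suc n)" for n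
  have h: "0 < h n" for n using T by (simp add: h_def)
  let ?\<sigma> = "\<lambda>n \<omega>. h n * real_of_int \<lceil>\<rho> \<omega> / h n\<rceil>"
  let ?K = "\<lambda>n. (\<lambda>i. h n * real_of_int i) ` {0..int (Suc n)}"
  show "finite (?K n)" for n by simp
  show "?K n \<subseteq> {0..T}" for n
  proof
    fix x assume "x \<in> ?K n"
    then obtain i where i: "0 \<le> i" "i \<le> int (Suc n)" "x = h n * real_of_int i" by auto
    have "real_of_int i \<le> real (Suc n)" using i(2) by linarith
    then have "h n * real_of_int i \<le> h n * real (Suc n)" using h[of n] by (intro mult_left_mono) auto
    moreover have "0 \<le> h n * real_of_int i" using i(1) h[of n] by simp
    ultimately show "x \<in> {0..T}" using i(3) by (simp add: h_def)
  qed
  show "?\<sigma> n \<omega> \<in> ?K n" if "\<omega> \<in> space M" for n \<omega>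
  proof (rule image_eqI[OF refl])
    have "0 \<le> \<rho> \<omega> / h n" "\<rho> \<omega> / h n \<le> T / h n"
      using bd[OF that] h[of n] by (auto intro: divide_right_mono)
    moreover have "T / h n = real (Suc n)" using T by (simp add: h_def)
    ultimately have "0 \<le> \<rho> \<omega> / h n" "\<rho> \<omega> / h n \<le> real (Suc n)" by auto
    then have "0 \<le> \<lceil>\<rho> \<omega> / h n\<rceil>" "\<lceil>\<rho> \<omega> / h n\<rceil> \<le> int (Suc n)"
      by (auto simp: ceiling_le_iff)
    then show "\<lceil>\<rho> \<omega> / h n\<rceil> \<in> {0..int (Suc n)}" by simp
  qed
  show "{\<omega> \<in> space M. ?\<sigma> n \<omega> = k} \<in> sets (natural_filtration M W k)" if "k \<in> ?K n" for n k
  proof -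
    from that obtain i where i: "k = h n * real_of_int i" by auto
    have iff: "(?\<sigma> n \<omega> = k) = (h n * (real_of_int i - 1) < \<rho> \<omega> \<and> \<rho> \<omega> \<le> k)" for \<omega>
    proof -
      have "(?\<sigma> n \<omega> = k) = (\<lceil>\<rho> \<omega> / h n\<rceil> = i)" using h[of n] by (simp add: i)
      also have "\<dots> = (real_of_int i - 1 < \<rho> \<omega> / h n \<and> \<rho> \<omega> / h n \<le> real_of_int i)"
        by (rule ceiling_eq_iff)
      also have "\<dots> = (h n * (real_of_int i - 1) < \<rho> \<omega> \<and> \<rho> \<omega> \<le> k)"
        using h[of n] by (simp add: i field_simps)
      finally show ?thesis .
    qed
    have eq: "{\<omega> \<in> space M. ?\<sigma> n \<omega> = k}
        = {\<omega> \<in> space M. \<rho> \<omega> \<le> k} - {\<omega> \<in> space M. \<rho> \<omega> \<le> h n * (real_of_int i - 1)}"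
      unfolding iff by auto
    have le: "{\<omega> \<in> space M. \<rho> \<omega> \<le> r} \<in> sets (natural_filtration M W r)" for r
      using stopping_timeD[OF st, of r] by (simp add: Measurable.pred_def)
    have "h n * (real_of_int i - 1) \<le> k" using h[of n] by (simp add: i)
    from sets_natural_filtration_mono[OF this] le[of "h n * (real_of_int i - 1)"]
    have "{\<omega> \<in> space M. \<rho> \<omega> \<le> h n * (real_of_int i - 1)} \<in> sets (natural_filtration M W k)"
      by (rule subsetD)
    then show ?thesis unfolding eq using le by (intro sets.Diff)
  qed
  show "(\<lambda>n. ?\<sigma> n \<omega>) \<longlonglongrightarrow> \<rho> \<omega>" if "\<omega> \<in> space M" for \<omega>
  proof (rule tendsto_sandwich[OF always_eventually always_eventually])
    show "\<forall>n. \<rho> \<omega> \<le> ?\<sigma> n \<omega>"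
    proof
      fix n
      have "h n * (\<rho> \<omega> / h n) \<le> ?\<sigma> n \<omega>"
        using h[of n] by (intro mult_left_mono le_of_int_ceiling) auto
      then show "\<rho> \<omega> \<le> ?\<sigma> n \<omega>" using h[of n] by simp
    qed
    show "\<forall>n. ?\<sigma> n \<omega> \<le> \<rho> \<omega> + T * (1 / real (Suc n))"
    proof
      fix n
      have "?\<sigma> n \<omega> \<le> h n * (\<rho> \<omega> / h n + 1)"
        using h[of n] by (intro mult_left_mono of_int_ceiling_le_add_one) auto
      also have "\<dots> = \<rho> \<omega> + h n" using h[of n] by (simp add: distrib_left)
      also have "\<dots> = \<rho> \<omega> + T * (1 / real (Suc n))" by (simp add: h_def)
      finally show "?\<sigma> n \<omega> \<le> \<rho> \<omega> + T * (1 / real (Suc n))" .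
    qed
    have "(\<lambda>n. \<rho> \<omega> + T * (1 / real (Suc n))) \<longlonglongrightarrow> \<rho> \<omega> + T * 0"
      by (intro tendsto_intros lim_1_over_n[THEN LIMSEQ_Suc])
    then show "(\<lambda>n. \<rho> \<omega> + T * (1 / real (Suc n))) \<longlonglongrightarrow> \<rho> \<omega>" by simp
  qed simp
qed

lemma discrete_time_measurable:
  fixes U :: "real \<Rightarrow> 'a \<Rightarrow> real"
  assumes K: "finite K" "\<And>\<omega>. \<omega> \<in> space M \<Longrightarrow> \<sigma> \<omega> \<in> K"
    and eq: "\<And>k. k \<in> K \<Longrightarrow> {\<omega> \<in> space M. \<sigma> \<omega> = k} \<in> sets M"
    and U: "\<And>k. k \<in> K \<Longrightarrow> U k \<in> borel_measurable M"
  shows "(\<lambda>\<omega>. U (\<sigma> \<omega>) \<omega>) \<in> borel_measurable M"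
proof -
  have "(\<lambda>\<omega>. \<Sum>k\<in>K. indicator {\<omega> \<in> space M. \<sigma> \<omega> = k} \<omega> * U k \<omega>) \<in> borel_measurable M"
  proof (rule borel_measurable_sum)
    fix k assume k: "k \<in> K"
    show "(\<lambda>\<omega>. indicator {\<omega> \<in> space M. \<sigma> \<omega> = k} \<omega> * U k \<omega>) \<in> borel_measurable M"
      by (rule borel_measurable_times[OF borel_measurable_indicator[OF eq[OF k]] U[OF k]])
  qed
  moreover have "(\<Sum>k\<in>K. indicator {\<omega> \<in> space M. \<sigma> \<omega> = k} \<omega> * U k \<omega>) = U (\<sigma> \<omega>) \<omega>"
    if w: "\<omega> \<in> space M" for \<omega>
  proof -
    have "(\<Sum>k\<in>K. indicator {\<omega> \<in> space M. \<sigma> \<omega> = k} \<omega> * U k \<omega>)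
        = (\<Sum>k\<in>K. if k = \<sigma> \<omega> then U k \<omega> else 0)"
      by (rule sum.cong[OF refl]) (use w in \<open>auto simp: indicator_def\<close>)
    then show ?thesis by (simp add: K(1) K(2)[OF w])
  qed
  ultimately show ?thesis by (subst (asm) measurable_cong) auto
qed

lemma stopped_process_measurable:
  fixes U :: "real \<Rightarrow> 'a \<Rightarrow> real"
  assumes st: "stopping_time (natural_filtration M W) \<rho>"
    and bd: "\<And>\<omega>. \<omega> \<in> space M \<Longrightarrow> 0 \<le> \<rho> \<omega> \<and> \<rho> \<omega> \<le> T" and T: "0 < T" "T < 1"
    and meas: "\<And>t. 0 \<le> t \<Longrightarrow> t < 1 \<Longrightarrow> U t \<in> borel_measurable M"
    and cont: "\<And>\<omega>. \<omega> \<in> space M \<Longrightarrow> continuous_on {0..<1} (\<lambda>t. U t \<omega>)"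
  shows "(\<lambda>\<omega>. U (\<rho> \<omega>) \<omega>) \<in> borel_measurable M"
proof -
  obtain \<sigma> K where K: "\<And>n::nat. finite (K n)" "\<And>n. K n \<subseteq> {0..T}"
    "\<And>n \<omega>. \<omega> \<in> space M \<Longrightarrow> \<sigma> n \<omega> \<in> K n"
    and eq: "\<And>n k. k \<in> K n \<Longrightarrow> {\<omega> \<in> space M. \<sigma> n \<omega> = k} \<in> sets (natural_filtration M W k)"
    and lim: "\<And>\<omega>. \<omega> \<in> space M \<Longrightarrow> (\<lambda>n. \<sigma> n \<omega>) \<longlonglongrightarrow> \<rho> \<omega>"
    by (rule stopping_time_approx[OF st bd T(1)]) (assumption | rule that)+
  show ?thesis
  proof (rule borel_measurable_LIMSEQ_real)
    show "(\<lambda>\<omega>. U (\<sigma> n \<omega>) \<omega>) \<in> borel_measurable M" for n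
    proof (rule discrete_time_measurable[OF K(1) K(3)])
      show "{\<omega> \<in> space M. \<sigma> n \<omega> = k} \<in> sets M" if "k \<in> K n" for k
        by (rule subsetD[OF natural_filtration_subset eq[OF that]])
      show "U k \<in> borel_measurable M" if "k \<in> K n" for k
        using K(2)[of n] that T by (intro meas) auto
    qed
    show "(\<lambda>n. U (\<sigma> n \<omega>) \<omega>) \<longlonglongrightarrow> U (\<rho> \<omega>) \<omega>" if "\<omega> \<in> space M" for \<omega>
    proof (rule continuous_on_tendsto_compose[OF cont[OF that] lim[OF that]])
      show "\<rho> \<omega> \<in> {0..<1}" using bd[OF that] T by auto
      show "\<forall>\<^sub>F n in sequentially. \<sigma> n \<omega> \<in> {0..<1}"
      proof (intro always_eventually allI)
      show "\<sigma> n \<omega> \<in> {0..<1}" for n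
        using subsetD[OF K(2) K(3)[OF that], of n] T by simp
    qed
    qed
  qed
qed

end

section \<open>The Gaussian martingale of the bridge\<close>

context alpha_brownian_bridge
begin

text \<open>Division by (1 - t)^\<alpha> leaves an integrand that does not depend on
  \<open>t\<close>, so an increment of \<open>N\<close> over [s, t] is a Wiener integral over that
  interval alone.\<close>

definition N :: "real \<Rightarrow> 'a \<Rightarrow> real" where
  "N t \<omega> = X t \<omega> / (1 - t) powr \<alpha>"

lemma X_measurable:
  assumes "0 \<le> t" "t < 1"
  shows "X t \<in> borel_measurable M"
  using X_integral[OF assms] unfolding has_wiener_integral_def by blast

lemma N_adapted:
  assumes "0 \<le> t" "t < 1"
  shows "N t \<in> borel_measurable (natural_filtration M W t)"
  unfolding N_def[abs_def] using X_adapted[OF assms] by measurable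

lemma N_measurable:
  assumes "0 \<le> t" "t < 1"
  shows "N t \<in> borel_measurable M"
  unfolding N_def[abs_def] using X_measurable[OF assms] by measurable

lemma N_wiener_integral:
  assumes "0 \<le> t" "t < 1"
  shows "has_wiener_integral M W t (\<lambda>u. (1 - u) powr - \<alpha>) (N t)"
proof -
  have "has_wiener_integral M W t (\<lambda>s. (1 - t) powr - \<alpha> * ((1 - t) / (1 - s)) powr \<alpha>)
      (\<lambda>\<omega>. (1 - t) powr - \<alpha> * X t \<omega>)"
    by (rule has_wiener_integral_cmult[OF X_integral]) (use assms in auto)
  also have "(\<lambda>\<omega>. (1 - t) powr - \<alpha> * X t \<omega>) = N t"
    by (simp add: N_def fun_eq_iff powr_minus divide_simps)
  finally show ?thesis
  proof (rule has_wiener_integral_cong)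
    show "(1 - t) powr - \<alpha> * ((1 - t) / (1 - s)) powr \<alpha> = (1 - s) powr - \<alpha>" if "s \<in> {0..t}" for s
      using that assms by (simp add: powr_divide powr_minus divide_simps)
  qed measurable
qed

lemma nn_integral_N_step:
  assumes st: "0 \<le> s" "s < t" "t < 1" and A: "A \<in> sets (natural_filtration M W s)"
    and h [measurable]: "h \<in> borel_measurable borel"
  shows "(\<integral>\<^sup>+\<omega>. h (N t \<omega>) * indicator A \<omega> \<partial>M)
     = (\<integral>\<^sup>+\<omega>. gauss_mean (sqrt (clock \<alpha> t - clock \<alpha> s)) (\<lambda>d. h (N s \<omega> + d))
          * indicator A \<omega> \<partial>M)"
proof -
  have [measurable]: "N t \<in> borel_measurable M" "N s \<in> borel_measurable M"
    using st by (auto intro: N_measurable)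
  obtain n p c where p: "\<And>k::nat. mono_on {..n k} (p k)" "\<And>k. p k ` {..n k} \<subseteq> {s..t}"
    and limf: "(\<lambda>k. sqnorm_on {s<..t} (\<lambda>u. (1 - u) powr - \<alpha> - step_function (n k) (p k) (c k) u)) \<longlonglongrightarrow> 0"
    and limD: "(\<lambda>k. sqnorm M (\<lambda>\<omega>. N t \<omega> - N s \<omega> - step_integral W (n k) (p k) (c k) \<omega>)) \<longlonglongrightarrow> 0"
    by (rule wiener_integral_increment[OF N_wiener_integral[of s] N_wiener_integral[of t]])
      (use st in auto)
  have pos: "0 < clock \<alpha> t - clock \<alpha> s" using clock_strict_mono[of s t \<alpha>] st by simp
  have law: "emeasure M (B \<inter> ((\<lambda>\<omega>. N t \<omega> - N s \<omega>) -` C \<inter> space M))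
       = emeasure M B * emeasure (density lborel (normal_density 0 (sqrt (clock \<alpha> t - clock \<alpha> s)))) C"
    if "B \<in> sets (natural_filtration M W s)" "C \<in> sets borel" for B C
    by (rule wiener_increment_law[OF _ _ _ p _ _ limf limD])
      (use st pos that nn_integral_clock[of s t \<alpha>] in auto)
  have "(\<integral>\<^sup>+\<omega>. h (N s \<omega> + (N t \<omega> - N s \<omega>)) * indicator A \<omega> \<partial>M)
     = (\<integral>\<^sup>+\<omega>. gauss_mean (sqrt (clock \<alpha> t - clock \<alpha> s)) (\<lambda>d. h (N s \<omega> + d))
          * indicator A \<omega> \<partial>M)"
    by (rule nn_integral_filtration_increment[OF _ law]) (use st pos A in \<open>auto intro: N_adapted\<close>)
  then show ?thesis by simp
qed

text \<open>A partition of [0, 0] is constant, so all approximating step integrals vanish. The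
  result is an almost sure one because the Wiener integral determines \<open>X 0\<close> up to a
  null set only.\<close>

lemma AE_N_zero: "AE \<omega> in M. N 0 \<omega> = 0"
proof -
  have [measurable]: "X 0 \<in> borel_measurable M" by (rule X_measurable) auto
  have "has_wiener_integral M W 0 (\<lambda>s. ((1 - 0) / (1 - s)) powr \<alpha>) (X 0)"
    by (rule X_integral) auto
  then obtain n p c where p: "\<And>k::nat. mono_on {..n k} (p k) \<and> p k ` {..n k} \<subseteq> {0..(0::real)}"
    and lim: "(\<lambda>k. sqnorm M (\<lambda>\<omega>. X 0 \<omega> - step_integral W (n k) (p k) (c k) \<omega>)) \<longlonglongrightarrow> 0"
    unfolding has_wiener_integral_def by auto
  have "step_integral W (n k) (p k) (c k) \<omega> = 0" for k \<omega>
    unfolding step_integral_def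
  proof (rule sum.neutral, rule ballI)
    fix i assume "i \<in> {..<n k}"
    then have "i \<in> {..n k}" "Suc i \<in> {..n k}" by auto
    then have "p k i \<in> {0..0}" "p k (Suc i) \<in> {0..0}"
      using p[of k] by blast+
    then show "c k i * (W (p k (Suc i)) \<omega> - W (p k i) \<omega>) = 0" by simp
  qed
  then have "sqnorm M (\<lambda>\<omega>. X 0 \<omega>) = 0"
    using lim by (simp add: LIMSEQ_const_iff)
  then have "AE \<omega> in M. ennreal ((X 0 \<omega>)\<^sup>2) = 0"
    by (subst (asm) nn_integral_0_iff_AE) auto
  then show ?thesis by eventually_elim (auto simp: N_def)
qed

lemma N_continuous:
  assumes "\<omega> \<in> space M"
  shows "continuous_on {0..<1} (\<lambda>t. N t \<omega>)"
  unfolding N_def by (intro continuous_intros X_continuous[OF assms]) auto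

end

section \<open>Optional stopping for the nonnegative martingale built from H\<close>

locale bridge_martingale = alpha_brownian_bridge +
  fixes H :: "real \<Rightarrow> real \<Rightarrow> real"
  assumes H: "heat_martingale \<alpha> H"
begin

definition Y :: "real \<Rightarrow> 'a \<Rightarrow> real" where
  "Y t \<omega> = H t (N t \<omega>)"

lemma H_nonneg [simp]: "0 \<le> H t n"
  using H by (simp add: heat_martingale_def)

lemma Y_nonneg [simp]: "0 \<le> Y t \<omega>"
  by (simp add: Y_def)

lemma H_measurable [measurable]:
  assumes "0 \<le> t" "t < 1"
  shows "H t \<in> borel_measurable borel"
proof -
  have "continuous_on UNIV ((\<lambda>(t, n). H t n) \<circ> (\<lambda>n. (t, n)))"
    by (rule continuous_on_compose, intro continuous_intros,
        rule continuous_on_subset[of "{0..<1} \<times> UNIV"]) (use H assms in \<open>auto simp: heat_martingale_def\<close>)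
  then show ?thesis by (auto simp: o_def intro: borel_measurable_continuous_onI)
qed

lemma Y_adapted:
  assumes "0 \<le> t" "t < 1"
  shows "Y t \<in> borel_measurable (natural_filtration M W t)"
  unfolding Y_def[abs_def] by (rule measurable_compose[OF N_adapted H_measurable]) (use assms in auto)

lemma Y_measurable:
  assumes "0 \<le> t" "t < 1"
  shows "Y t \<in> borel_measurable M"
  unfolding Y_def[abs_def] by (rule measurable_compose[OF N_measurable H_measurable]) (use assms in auto)

lemma Y_continuous:
  assumes "\<omega> \<in> space M"
  shows "continuous_on {0..<1} (\<lambda>t. Y t \<omega>)"
proof -
  have "continuous_on {0..<1} ((\<lambda>(t, n). H t n) \<circ> (\<lambda>t. (t, N t \<omega>)))"
    by (rule continuous_on_compose, intro continuous_intros N_continuous assms,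
        rule continuous_on_subset[of "{0..<1} \<times> UNIV"]) (use H in \<open>auto simp: heat_martingale_def\<close>)
  then show ?thesis by (simp add: o_def Y_def)
qed

lemma Y_martingale:
  assumes st: "0 \<le> s" "s \<le> t" "t < 1" and A: "A \<in> sets (natural_filtration M W s)"
  shows "(\<integral>\<^sup>+\<omega>. ennreal (Y t \<omega>) * indicator A \<omega> \<partial>M) = (\<integral>\<^sup>+\<omega>. ennreal (Y s \<omega>) * indicator A \<omega> \<partial>M)"
proof (cases "s = t")
  case False
  then have lt: "s < t" using st by simp
  have [measurable]: "H t \<in> borel_measurable borel" using st by (intro H_measurable) auto
  have "(\<integral>\<^sup>+\<omega>. ennreal (H t (N t \<omega>)) * indicator A \<omega> \<partial>M)
    = (\<integral>\<^sup>+\<omega>. gauss_mean (sqrt (clock \<alpha> t - clock \<alpha> s)) (\<lambda>d. ennreal (H t (N s \<omega> + d)))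
          * indicator A \<omega> \<partial>M)"
    by (rule nn_integral_N_step[OF st(1) lt st(3) A]) measurable
  also have "\<dots> = (\<integral>\<^sup>+\<omega>. ennreal (H s (N s \<omega>)) * indicator A \<omega> \<partial>M)"
    using H st lt by (simp add: heat_martingale_def)
  finally show ?thesis by (simp add: Y_def)
qed simp

lemma nn_integral_Y:
  assumes "0 \<le> t" "t < 1"
  shows "(\<integral>\<^sup>+\<omega>. ennreal (Y t \<omega>) \<partial>M) = ennreal (H 0 0)"
proof -
  have "(\<integral>\<^sup>+\<omega>. ennreal (Y t \<omega>) \<partial>M) = (\<integral>\<^sup>+\<omega>. ennreal (Y t \<omega>) * indicator (space M) \<omega> \<partial>M)"
    by (intro nn_integral_cong) simp
  also have "\<dots> = (\<integral>\<^sup>+\<omega>. ennreal (Y 0 \<omega>) * indicator (space M) \<omega> \<partial>M)"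
    using sets.top[of "natural_filtration M W 0"] assms by (intro Y_martingale) auto
  also have "\<dots> = (\<integral>\<^sup>+\<omega>. ennreal (H 0 0) \<partial>M)"
    using AE_N_zero by (intro nn_integral_cong_AE) (auto simp: Y_def)
  also have "\<dots> = ennreal (H 0 0)" by (simp add: emeasure_space_1)
  finally show ?thesis .
qed

text \<open>On each piece where \<open>\<sigma>\<close> equals \<open>k\<close> the martingale
  property from \<open>k\<close> to \<open>T\<close> applies. The event \<open>C\<close> of the past
  of \<open>\<sigma>\<close> lets the identity be used on the part where the stopped value is
  large.\<close>

lemma discrete_optional_stopping:
  assumes K: "finite K" "K \<subseteq> {0..T}" "\<And>\<omega>. \<omega> \<in> space M \<Longrightarrow> \<sigma> \<omega> \<in> K" and T: "T < 1"
    and C: "\<And>k. k \<in> K \<Longrightarrow> {\<omega> \<in> C. \<sigma> \<omega> = k} \<in> sets (natural_filtration M W k)" "C \<subseteq> space M"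
  shows "(\<integral>\<^sup>+\<omega>. ennreal (Y (\<sigma> \<omega>) \<omega>) * indicator C \<omega> \<partial>M) = (\<integral>\<^sup>+\<omega>. ennreal (Y T \<omega>) * indicator C \<omega> \<partial>M)"
proof -
  let ?C = "\<lambda>k. {\<omega> \<in> C. \<sigma> \<omega> = k}"
  have split: "(\<Sum>k\<in>K. f k * indicator (?C k) \<omega>) = f (\<sigma> \<omega>) * indicator C \<omega>"
    if "\<omega> \<in> space M" for f :: "real \<Rightarrow> ennreal" and \<omega>
  proof -
    have "(\<Sum>k\<in>K. f k * indicator (?C k) \<omega>) = (\<Sum>k\<in>K. if k = \<sigma> \<omega> then f (\<sigma> \<omega>) * indicator C \<omega> else 0)"
      by (intro sum.cong) (auto simp: indicator_def)
    then show ?thesis using K(1) K(3)[OF that] by simp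
  qed
  have C_meas: "?C k \<in> sets M" if "k \<in> K" for k
    by (rule subsetD[OF natural_filtration_subset C(1)[OF that]])
  have Yk: "Y k \<in> borel_measurable M" if "k \<in> K" for k using K(2) that T by (intro Y_measurable) auto
  have term_meas: "(\<lambda>\<omega>. ennreal (f \<omega>) * indicator (?C k) \<omega>) \<in> borel_measurable M"
    if "f \<in> borel_measurable M" "k \<in> K" for f k
  proof -
    note [measurable] = that(1) C_meas[OF that(2)]
    show ?thesis by measurable
  qed
  show ?thesis
  proof (cases "K = {}")
    case True
    then have "space M = {}" using K(3) by auto
    then show ?thesis using not_empty by simp
  next
    case False
    then have T0: "0 \<le> T" using K(2) by fastforce
    have YT: "Y T \<in> borel_measurable M" using T T0 by (rule Y_measurable[rotated])
    have "(\<integral>\<^sup>+\<omega>. ennreal (Y (\<sigma> \<omega>) \<omega>) * indicator C \<omega> \<partial>M)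
        = (\<integral>\<^sup>+\<omega>. (\<Sum>k\<in>K. ennreal (Y k \<omega>) * indicator (?C k) \<omega>) \<partial>M)"
      by (rule nn_integral_cong, rule split[symmetric])
    also have "\<dots> = (\<Sum>k\<in>K. \<integral>\<^sup>+\<omega>. ennreal (Y k \<omega>) * indicator (?C k) \<omega> \<partial>M)"
      by (rule nn_integral_sum, rule term_meas[OF Yk])
    also have "\<dots> = (\<Sum>k\<in>K. \<integral>\<^sup>+\<omega>. ennreal (Y T \<omega>) * indicator (?C k) \<omega> \<partial>M)"
      using K(2) T by (intro sum.cong refl Y_martingale[symmetric] C) auto
    also have "\<dots> = (\<integral>\<^sup>+\<omega>. (\<Sum>k\<in>K. ennreal (Y T \<omega>) * indicator (?C k) \<omega>) \<partial>M)"
      by (rule nn_integral_sum[symmetric], rule term_meas[OF YT])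
    also have "\<dots> = (\<integral>\<^sup>+\<omega>. ennreal (Y T \<omega>) * indicator C \<omega> \<partial>M)"
      by (rule nn_integral_cong, rule split)
    finally show ?thesis .
  qed
qed

text \<open>Fatou's lemma along the approximating times yields the inequality. For equality, a bound
  on the value at \<open>\<rho>\<close> excludes a loss of mass in the limit.\<close>

lemma optional_stopping:
  assumes st: "stopping_time (natural_filtration M W) \<rho>"
    and bd: "\<And>\<omega>. \<omega> \<in> space M \<Longrightarrow> 0 \<le> \<rho> \<omega> \<and> \<rho> \<omega> \<le> T" and T: "0 < T" "T < 1"
  shows optional_stopping_le: "(\<integral>\<^sup>+\<omega>. ennreal (Y (\<rho> \<omega>) \<omega>) \<partial>M) \<le> ennreal (H 0 0)"
    and optional_stopping_eq:
      "(AE \<omega> in M. Y (\<rho> \<omega>) \<omega> \<le> b) \<Longrightarrow> (\<integral>\<^sup>+\<omega>. ennreal (Y (\<rho> \<omega>) \<omega>) \<partial>M) = ennreal (H 0 0)"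
proof -
  obtain \<sigma> K where K: "\<And>n::nat. finite (K n)" "\<And>n. K n \<subseteq> {0..T}"
    "\<And>n \<omega>. \<omega> \<in> space M \<Longrightarrow> \<sigma> n \<omega> \<in> K n"
    and eq: "\<And>n k. k \<in> K n \<Longrightarrow> {\<omega> \<in> space M. \<sigma> n \<omega> = k} \<in> sets (natural_filtration M W k)"
    and lim: "\<And>\<omega>. \<omega> \<in> space M \<Longrightarrow> (\<lambda>n. \<sigma> n \<omega>) \<longlonglongrightarrow> \<rho> \<omega>"
    by (rule stopping_time_approx[OF st bd T(1)]) (assumption | rule that)+
  define Z where "Z n \<omega> = Y (\<sigma> n \<omega>) \<omega>" for n \<omega>
  have Z_meas [measurable]: "Z n \<in> borel_measurable M" for n
    unfolding Z_def[abs_def]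
  proof (rule discrete_time_measurable[OF K(1) K(3)])
    show "{\<omega> \<in> space M. \<sigma> n \<omega> = k} \<in> sets M" if "k \<in> K n" for k
      by (rule subsetD[OF natural_filtration_subset eq[OF that]])
    show "Y k \<in> borel_measurable M" if "k \<in> K n" for k
      using K(2)[of n] that T by (intro Y_measurable) auto
  qed
  have Y_lim: "(\<lambda>n. Z n \<omega>) \<longlonglongrightarrow> Y (\<rho> \<omega>) \<omega>" if "\<omega> \<in> space M" for \<omega>
    unfolding Z_def
  proof (rule continuous_on_tendsto_compose[OF Y_continuous[OF that] lim[OF that]])
    show "\<rho> \<omega> \<in> {0..<1}" using bd[OF that] T by auto
    show "\<forall>\<^sub>F n in sequentially. \<sigma> n \<omega> \<in> {0..<1}"
    proof (intro always_eventually allI)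
      show "\<sigma> n \<omega> \<in> {0..<1}" for n
        using subsetD[OF K(2) K(3)[OF that], of n] T by simp
    qed
  qed
  have YT [measurable]: "Y T \<in> borel_measurable M" using T by (intro Y_measurable) auto
  have Z_int: "(\<integral>\<^sup>+\<omega>. ennreal (Z n \<omega>) \<partial>M) = ennreal (H 0 0)" for n
  proof -
    have "(\<integral>\<^sup>+\<omega>. ennreal (Z n \<omega>) \<partial>M) = (\<integral>\<^sup>+\<omega>. ennreal (Z n \<omega>) * indicator (space M) \<omega> \<partial>M)"
      by (intro nn_integral_cong) simp
    also have "\<dots> = (\<integral>\<^sup>+\<omega>. ennreal (Y T \<omega>) * indicator (space M) \<omega> \<partial>M)"
      unfolding Z_def by (rule discrete_optional_stopping[OF K(1,2,3) T(2) eq]) auto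
    also have "\<dots> = (\<integral>\<^sup>+\<omega>. ennreal (Y T \<omega>) \<partial>M)" by (intro nn_integral_cong) simp
    also have "\<dots> = ennreal (H 0 0)" using T by (intro nn_integral_Y) auto
    finally show ?thesis .
  qed
  have "(\<integral>\<^sup>+\<omega>. ennreal (Y (\<rho> \<omega>) \<omega>) \<partial>M) = (\<integral>\<^sup>+\<omega>. liminf (\<lambda>n. ennreal (Z n \<omega>)) \<partial>M)"
    by (intro nn_integral_cong lim_imp_Liminf[symmetric] tendsto_ennrealI Y_lim) auto
  also have "\<dots> \<le> liminf (\<lambda>n. \<integral>\<^sup>+\<omega>. ennreal (Z n \<omega>) \<partial>M)"
    by (rule nn_integral_liminf) measurable
  also have "\<dots> = ennreal (H 0 0)" by (simp add: Z_int Liminf_const)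
  finally show "(\<integral>\<^sup>+\<omega>. ennreal (Y (\<rho> \<omega>) \<omega>) \<partial>M) \<le> ennreal (H 0 0)" .
  assume b: "AE \<omega> in M. Y (\<rho> \<omega>) \<omega> \<le> b"
  have [measurable]: "(\<lambda>\<omega>. Y (\<rho> \<omega>) \<omega>) \<in> borel_measurable M"
    by (rule borel_measurable_LIMSEQ_real[OF Y_lim]) measurable
  \<comment> \<open>The \<open>Z n\<close> are not bounded, but on \<open>G n\<close>, an event of the past of \<open>\<sigma> n\<close>, they have the same
    integral as \<open>Y T\<close>, and \<open>G n\<close> vanishes in the limit.\<close>
  define G where "G n = {\<omega> \<in> space M. Z n \<omega> > b + 1}" for n
  have G_meas [measurable]: "G n \<in> sets M" for n unfolding G_def by measurable
  \<comment> \<open>The margin 1 in \<open>G\<close> makes the inequality strict, so convergence of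
    \<open>Z n \<omega>\<close> takes \<open>\<omega>\<close> out of \<open>G n\<close>
    eventually.\<close>
  have G_ev: "eventually (\<lambda>n. \<omega> \<notin> G n) sequentially" if "\<omega> \<in> space M" "Y (\<rho> \<omega>) \<omega> \<le> b" for \<omega>
  proof -
    have "Y (\<rho> \<omega>) \<omega> < b + 1" using that(2) by simp
    from order_tendstoD(2)[OF Y_lim[OF that(1)] this] show ?thesis
      by eventually_elim (simp add: G_def)
  qed
  have "(\<lambda>n. (\<integral>\<^sup>+\<omega>. ennreal (Z n \<omega>) * indicator (space M - G n) \<omega> \<partial>M)
      + (\<integral>\<^sup>+\<omega>. ennreal (Y T \<omega>) * indicator (G n) \<omega> \<partial>M)) \<longlonglongrightarrow> (\<integral>\<^sup>+\<omega>. ennreal (Y (\<rho> \<omega>) \<omega>) \<partial>M) + (\<integral>\<^sup>+\<omega>. 0 \<partial>M)"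
  proof (intro tendsto_add)
    show "(\<lambda>n. \<integral>\<^sup>+\<omega>. ennreal (Z n \<omega>) * indicator (space M - G n) \<omega> \<partial>M) \<longlonglongrightarrow> (\<integral>\<^sup>+\<omega>. ennreal (Y (\<rho> \<omega>) \<omega>) \<partial>M)"
    proof (rule nn_integral_dominated_convergence[where w = "\<lambda>_. ennreal (b + 1)"])
      show "AE \<omega> in M. ennreal (Z n \<omega>) * indicator (space M - G n) \<omega> \<le> ennreal (b + 1)" for n
        by (rule AE_I2) (auto simp: G_def indicator_def intro!: ennreal_leI)
      show "(\<integral>\<^sup>+\<omega>. ennreal (b + 1) \<partial>M) < \<infinity>" by (simp add: emeasure_space_1)
      show "AE \<omega> in M. (\<lambda>n. ennreal (Z n \<omega>) * indicator (space M - G n) \<omega>) \<longlonglongrightarrow> ennreal (Y (\<rho> \<omega>) \<omega>)"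
        using b AE_space
      proof eventually_elim
        case (elim \<omega>)
        note w = elim(2) and ev = G_ev[OF elim(2,1)]
        have "(\<lambda>n. ennreal (Z n \<omega>)) \<longlonglongrightarrow> ennreal (Y (\<rho> \<omega>) \<omega>)"
          by (intro tendsto_ennrealI Y_lim w)
        then show ?case
          by (rule Lim_transform_eventually) (use ev w in \<open>auto elim!: eventually_mono\<close>)
      qed
    qed measurable
    show "(\<lambda>n. \<integral>\<^sup>+\<omega>. ennreal (Y T \<omega>) * indicator (G n) \<omega> \<partial>M) \<longlonglongrightarrow> (\<integral>\<^sup>+\<omega>. 0 \<partial>M)"
    proof (rule nn_integral_dominated_convergence[where w = "\<lambda>\<omega>. ennreal (Y T \<omega>)"])
      show "AE \<omega> in M. ennreal (Y T \<omega>) * indicator (G n) \<omega> \<le> ennreal (Y T \<omega>)" for n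
        by (rule AE_I2) (auto simp: indicator_def)
      show "(\<integral>\<^sup>+\<omega>. ennreal (Y T \<omega>) \<partial>M) < \<infinity>" using T by (subst nn_integral_Y) auto
      show "AE \<omega> in M. (\<lambda>n. ennreal (Y T \<omega>) * indicator (G n) \<omega>) \<longlonglongrightarrow> 0"
        using b AE_space
      proof eventually_elim
        case (elim \<omega>)
        show ?case
        proof (rule tendsto_eventually)
          show "\<forall>\<^sub>F n in sequentially. ennreal (Y T \<omega>) * indicator (G n) \<omega> = 0"
            using G_ev[OF elim(2,1)] by eventually_elim simp
        qed
      qed
    qed measurable
  qed
  moreover have "(\<integral>\<^sup>+\<omega>. ennreal (Z n \<omega>) * indicator (space M - G n) \<omega> \<partial>M)
      + (\<integral>\<^sup>+\<omega>. ennreal (Y T \<omega>) * indicator (G n) \<omega> \<partial>M) = ennreal (H 0 0)" for n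
  proof -
    have "(\<integral>\<^sup>+\<omega>. ennreal (Z n \<omega>) * indicator (G n) \<omega> \<partial>M) = (\<integral>\<^sup>+\<omega>. ennreal (Y T \<omega>) * indicator (G n) \<omega> \<partial>M)"
      unfolding Z_def
    proof (rule discrete_optional_stopping[OF K(1,2,3) T(2)])
      fix k assume k: "k \<in> K n"
      have [measurable]: "Y k \<in> borel_measurable (natural_filtration M W k)"
        using K(2)[of n] k T by (intro Y_adapted) auto
      have "{\<omega> \<in> space M. Y k \<omega> > b + 1} \<in> sets (natural_filtration M W k)"
        using borel_measurable_less[of "\<lambda>_. b + 1" "natural_filtration M W k" "Y k"] by simp
      then have "{\<omega> \<in> space M. \<sigma> n \<omega> = k} \<inter> {\<omega> \<in> space M. Y k \<omega> > b + 1} \<in> sets (natural_filtration M W k)"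
        by (intro sets.Int eq k)
      also have "{\<omega> \<in> space M. \<sigma> n \<omega> = k} \<inter> {\<omega> \<in> space M. Y k \<omega> > b + 1} = {\<omega> \<in> G n. \<sigma> n \<omega> = k}"
        by (auto simp: G_def Z_def)
      finally show "{\<omega> \<in> G n. \<sigma> n \<omega> = k} \<in> sets (natural_filtration M W k)" .
    qed (auto simp: G_def)
    then have "(\<integral>\<^sup>+\<omega>. ennreal (Z n \<omega>) * indicator (space M - G n) \<omega> \<partial>M)
      + (\<integral>\<^sup>+\<omega>. ennreal (Y T \<omega>) * indicator (G n) \<omega> \<partial>M)
      = (\<integral>\<^sup>+\<omega>. ennreal (Z n \<omega>) * indicator (space M - G n) \<omega> + ennreal (Z n \<omega>) * indicator (G n) \<omega> \<partial>M)"
      by (subst nn_integral_add) auto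
    also have "\<dots> = (\<integral>\<^sup>+\<omega>. ennreal (Z n \<omega>) \<partial>M)"
      by (intro nn_integral_cong) (auto simp: indicator_def)
    finally show ?thesis by (simp add: Z_int)
  qed
  ultimately have "(\<lambda>n::nat. ennreal (H 0 0)) \<longlonglongrightarrow> (\<integral>\<^sup>+\<omega>. ennreal (Y (\<rho> \<omega>) \<omega>) \<partial>M)"
    by simp
  then show "(\<integral>\<^sup>+\<omega>. ennreal (Y (\<rho> \<omega>) \<omega>) \<partial>M) = ennreal (H 0 0)"
    by (simp add: LIMSEQ_const_iff)
qed

end

section \<open>The functions F, B and C\<close>

lemma hypergeom_M_summable:
  assumes "0 < \<beta>"
  shows "summable (\<lambda>n. pochhammer \<gamma> n * z ^ n / (pochhammer \<beta> n * fact n :: real))"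
proof -
  define a where "a n = pochhammer \<gamma> n * z ^ n / (pochhammer \<beta> n * fact n)" for n
  \<comment> \<open>\<open>L\<close> bounds |\<gamma> + n| |z| / (\<beta> + n), so the ratio of
    consecutive terms is at most L / (n + 1), which is below 1/2 once n \<ge> 2 L.\<close>
  define L where "L = (\<bar>\<gamma>\<bar> / \<beta> + 1) * \<bar>z\<bar>"
  obtain n0 where n0: "2 * L \<le> real n0" using real_arch_simple by blast
  have "norm (a (Suc n)) \<le> 1/2 * norm (a n)" if n: "n \<ge> n0" for n
  proof -
    have pos: "0 < pochhammer \<beta> n" using assms by (intro pochhammer_pos)
    have rec: "a (Suc n) = (\<gamma> + real n) * z / ((\<beta> + real n) * (real n + 1)) * a n"
      using pos assms unfolding a_def by (simp add: pochhammer_Suc field_simps)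
    have "\<bar>\<gamma> + real n\<bar> \<le> \<bar>\<gamma>\<bar> + real n" by linarith
    also have "\<dots> \<le> (\<bar>\<gamma>\<bar> / \<beta> + 1) * (\<beta> + real n)"
      using assms by (simp add: field_simps)
    finally have "\<bar>\<gamma> + real n\<bar> * \<bar>z\<bar> \<le> (\<bar>\<gamma>\<bar> / \<beta> + 1) * (\<beta> + real n) * \<bar>z\<bar>"
      by (intro mult_right_mono) auto
    also have "\<dots> = (\<beta> + real n) * L" by (simp add: L_def)
    also have "\<dots> \<le> (\<beta> + real n) * ((real n + 1) / 2)"
      using n n0 assms by (intro mult_left_mono) auto
    finally have "\<bar>(\<gamma> + real n) * z / ((\<beta> + real n) * (real n + 1))\<bar> \<le> 1/2"
      using assms by (simp add: abs_mult divide_le_eq)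
    from mult_right_mono[OF this, of "\<bar>a n\<bar>"] show ?thesis
      unfolding rec by (simp add: abs_mult)
  qed
  then have "summable a" by (intro summable_ratio_test[of "1/2" n0]) auto
  then show ?thesis by (simp add: a_def[abs_def])
qed

lemma hypergeom_M_sums:
  assumes "0 < \<beta>"
  shows "(\<lambda>n. pochhammer \<gamma> n * z ^ n / (pochhammer \<beta> n * fact n)) sums hypergeom_M \<gamma> \<beta> z"
  unfolding hypergeom_M_def by (rule summable_sums[OF hypergeom_M_summable[OF assms]])

lemma pochhammer_minus_of_nat:
  assumes "k \<le> n"
  shows "pochhammer (- real n) k = (-1) ^ k * fact n / fact (n - k)"
  using assms
proof (induction k)
  case (Suc k)
  then have "n - k = Suc (n - Suc k)" by simp
  then have f: "fact (n - k) = (real n - real k) * (fact (n - Suc k) :: real)"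
    using Suc.prems by (simp add: of_nat_diff)
  have nk: "real n - real k \<noteq> 0" using Suc.prems by simp
  have "pochhammer (- real n) (Suc k)
      = - ((-1) ^ k * fact n * (real n - real k) / ((real n - real k) * fact (n - Suc k)))"
  proof -
    have "pochhammer (- real n) (Suc k) = - (pochhammer (- real n) k * (real n - real k))"
      by (simp add: pochhammer_Suc algebra_simps)
    then show ?thesis using Suc by (simp add: f)
  qed
  also have "\<dots> = (-1) ^ Suc k * fact n / fact (n - Suc k)"
    using nk by simp
  finally show ?case .
qed simp

text \<open>In the Cauchy product, 1 / fact (n - k) is expressed by
  \<open>pochhammer (- real n) k\<close>, and the coefficient becomes a Chu-Vandermonde sum. The
  change of sign serves \<alpha> < 1/2, where \<open>z_arg\<close> is negative or zero.\<close>

lemma kummer_transformation: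
  assumes \<beta>: "0 < \<beta>"
  shows "exp (- z) * hypergeom_M \<gamma> \<beta> z = hypergeom_M (\<beta> - \<gamma>) \<beta> (- z)"
proof -
  define a where "a n = (- z) ^ n / fact n" for n
  define b where "b n = pochhammer \<gamma> n * z ^ n / (pochhammer \<beta> n * fact n)" for n
  have a: "a sums exp (- z)"
    using exp_converges[of "- z"] by (simp add: a_def[abs_def] field_simps)
  have na: "summable (\<lambda>n. norm (a n))"
    using summable_norm_exp[of "- z"] by (simp add: a_def[abs_def] field_simps)
  have b: "b sums hypergeom_M \<gamma> \<beta> z"
    unfolding b_def[abs_def] by (rule hypergeom_M_sums[OF \<beta>])
  have nb: "summable (\<lambda>n. norm (b n))"
  proof (rule summable_comparison_test)
    \<comment> \<open>Absolute convergence: the series with parameter |\<gamma>| + 1 and argument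
      |z| is a majorant with nonnegative terms.\<close>
    have "norm (norm (b n)) \<le> pochhammer (\<bar>\<gamma>\<bar> + 1) n * \<bar>z\<bar> ^ n / (pochhammer \<beta> n * fact n)" for n
    proof -
      have "\<bar>pochhammer \<gamma> n\<bar> \<le> pochhammer (\<bar>\<gamma>\<bar> + 1) n"
      proof (induction n)
        case (Suc n)
        have "\<bar>pochhammer \<gamma> n\<bar> * \<bar>\<gamma> + real n\<bar> \<le> pochhammer (\<bar>\<gamma>\<bar> + 1) n * (\<bar>\<gamma>\<bar> + 1 + real n)"
          by (intro mult_mono Suc pochhammer_nonneg) auto
        then show ?case by (simp add: pochhammer_Suc abs_mult)
      qed simp
      moreover have "0 < pochhammer \<beta> n" using \<beta> by (intro pochhammer_pos)
      ultimately show ?thesis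
        by (simp add: b_def abs_mult power_abs divide_right_mono mult_right_mono)
    qed
    then show "\<exists>N. \<forall>n\<ge>N. norm (norm (b n)) \<le> pochhammer (\<bar>\<gamma>\<bar> + 1) n * \<bar>z\<bar> ^ n / (pochhammer \<beta> n * fact n)"
      by blast
  qed (rule hypergeom_M_summable[OF \<beta>])
  have "(\<lambda>n. \<Sum>i\<le>n. b i * a (n - i)) sums (suminf b * suminf a)"
    by (rule Cauchy_product_sums[OF nb na])
  then have "(\<lambda>n. \<Sum>i\<le>n. b i * a (n - i)) sums (exp (- z) * hypergeom_M \<gamma> \<beta> z)"
    using sums_unique[OF a] sums_unique[OF b] by (simp add: mult.commute)
  moreover have "(\<Sum>i\<le>n. b i * a (n - i)) = pochhammer (\<beta> - \<gamma>) n * (- z) ^ n / (pochhammer \<beta> n * fact n)" for n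
  proof -
    have trm: "b k * a (n - k) = (- z) ^ n / fact n *
        (pochhammer \<gamma> k * pochhammer (- real n) k / (fact k * pochhammer \<beta> k))" if "k \<le> n" for k
    proof -
      have "(- z) ^ n = (- z) ^ k * (- z) ^ (n - k)" using that by (simp flip: power_add)
      also have "(- z) ^ k = (-1) ^ k * z ^ k" by (rule power_minus)
      finally have zn: "(- z) ^ n = (-1) ^ k * z ^ k * (- z) ^ (n - k)" .
      have one: "(-1) ^ k * ((-1) ^ k :: real) = 1" by (simp flip: power_mult_distrib)
      have "(- z) ^ n * (-1) ^ k = z ^ k * (- z) ^ (n - k) * ((-1) ^ k * (-1) ^ k)"
        unfolding zn by (simp only: ac_simps)
      then have "(- z) ^ n * (-1) ^ k = z ^ k * (- z) ^ (n - k)" unfolding one by simp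
      then show ?thesis
        unfolding pochhammer_minus_of_nat[OF that] a_def b_def by (simp add: field_simps)
    qed
    have "(\<Sum>i\<le>n. b i * a (n - i)) = (\<Sum>k\<in>{0..n}. (- z) ^ n / fact n *
        (pochhammer \<gamma> k * pochhammer (- real n) k / (fact k * pochhammer \<beta> k)))"
      by (rule sum.cong) (auto simp: trm)
    also have "\<dots> = (- z) ^ n / fact n * (pochhammer (\<beta> - \<gamma>) n / pochhammer \<beta> n)"
      unfolding sum_distrib_left[symmetric]
      using Vandermonde_pochhammer[of n \<beta> \<gamma>] \<beta> by simp
    finally show ?thesis by (simp add: mult.commute)
  qed
  ultimately have "(\<lambda>n. pochhammer (\<beta> - \<gamma>) n * (- z) ^ n / (pochhammer \<beta> n * fact n))
      sums (exp (- z) * hypergeom_M \<gamma> \<beta> z)" by simp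
  with hypergeom_M_sums[OF \<beta>, of "\<beta> - \<gamma>" "- z"] show ?thesis by (rule sums_unique2[rotated])
qed

section \<open>The tangent of a convex function through the origin\<close>

lemma tangent_through_origin:
  fixes F F' F'' :: "real \<Rightarrow> real"
  assumes d1: "\<And>y. (F has_real_derivative F' y) (at y)"
    and d2: "\<And>y. (F' has_real_derivative F'' y) (at y)"
    and pos: "\<And>y. 0 < F y" "\<And>y. 0 < F' y" "\<And>y. 0 < F'' y"
    and y0: "1 < y0" "F 1 * y0 \<le> F y0"
  shows tangent_point_ex1: "\<exists>!B. 0 < B \<and> B = F B / F' B"
    and tangent_below: "B = F B / F' B \<Longrightarrow> 0 < B \<Longrightarrow> y \<le> B / F B * F y"
    and tangent_mono: "mono F"
proof -
  have convex: "convex_on UNIV F"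
    by (rule f''_ge0_imp_convex[OF convex_UNIV]) (use d1 d2 pos(3) in \<open>auto intro: less_imp_le\<close>)
  have above: "F' c * (x - c) \<le> F x - F c" for x c
    by (rule convex_on_imp_above_tangent[OF convex]) (use d1 in \<open>auto intro: has_field_derivative_at_within\<close>)
  \<comment> \<open>\<open>- h y\<close> is the value at 0 of the tangent at \<open>y\<close>, so
    the wanted points are the zeros of \<open>h\<close>. It increases for y > 0 because F'' is
    positive.\<close>
  define h where "h y = y * F' y - F y" for y
  have dh: "(h has_real_derivative y * F'' y) (at y)" for y
    unfolding h_def by (auto intro!: derivative_eq_intros d1 d2)
  have h_mono: "h x < h y" if "0 < x" "x < y" for x y
  proof (rule DERIV_pos_imp_increasing[OF that(2)])
    show "\<exists>z. DERIV h w :> z \<and> 0 < z" if "x \<le> w" "w \<le> y" for w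
      using dh[of w] pos(3)[of w] that \<open>0 < x\<close> by (intro exI[of _ "w * F'' w"]) auto
  qed
  have h_iff: "B = F B / F' B \<longleftrightarrow> h B = 0" for B
    using pos(2)[of B] by (auto simp: h_def field_simps)
  have h0: "h 0 < 0" using pos(1)[of 0] by (simp add: h_def)
  \<comment> \<open>Convexity gives \<open>h y0\<close> \<ge> \<open>F' y0 - F 1\<close>, and the
    hypothesis on \<open>y0\<close> says that the chord from 1 to \<open>y0\<close> has slope at
    least \<open>F 1\<close>.\<close>
  have hy0: "0 \<le> h y0"
  proof -
    have "F y0 - F 1 \<le> F' y0 * (y0 - 1)" using above[of y0 1] by (simp add: algebra_simps)
    moreover from this have "F 1 * (y0 - 1) \<le> F' y0 * (y0 - 1)" using y0 by (simp add: algebra_simps)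
    then have "F 1 \<le> F' y0" using y0 by simp
    ultimately show ?thesis by (simp add: h_def algebra_simps)
  qed
  have cont: "continuous_on {0..y0} h"
    by (rule DERIV_continuous_on) (use dh in \<open>auto intro: has_field_derivative_at_within\<close>)
  obtain B where B: "0 \<le> B" "B \<le> y0" "h B = 0"
    using IVT'[of h 0 0 y0, OF _ hy0 _ cont] h0 y0 by auto
  have Bpos: "0 < B" using B h0 by (cases "B = 0") auto
  show "\<exists>!B. 0 < B \<and> B = F B / F' B"
  proof (rule ex1I[of _ B])
    show "0 < B \<and> B = F B / F' B" using Bpos B(3) h_iff[of B] by simp
    show "B' = B" if "0 < B' \<and> B' = F B' / F' B'" for B'
      using that h_iff[of B'] B(3) Bpos h_mono[of B B'] h_mono[of B' B] by (cases B B' rule: linorder_cases) auto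
  qed
  show "y \<le> B / F B * F y" if "B = F B / F' B" "0 < B" for B y
  proof -
    have FB: "F B = B * F' B" using that h_iff[of B] by (simp add: h_def)
    have "F' B * y \<le> F y" using above[of B y] FB by (simp add: algebra_simps)
    then have "y \<le> F y / F' B" using pos(2)[of B] by (simp add: field_simps)
    then show ?thesis using FB that(2) by simp
  qed
  show "mono F"
    by (rule monoI, rule DERIV_nonneg_imp_nondecreasing) (use d1 pos(2) in \<open>auto intro: less_imp_le\<close>)
qed

section \<open>The Gaussian Mellin transform: series, recurrence and integral\<close>

text \<open>For p > 0 this is the moment \<integral> u^(p + n - 1) exp (- u^2/2) du over u > 0,
  divided by n!; the moment becomes a Gamma integral by t = u^2/2.\<close>

definition gm_coeff :: "real \<Rightarrow> nat \<Rightarrow> real" where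
  "gm_coeff p n = 2 powr ((p + real n) / 2 - 1) * Gamma ((p + real n) / 2) / fact n"

text \<open>For \<open>p > 0\<close> this is \<open>\<integral>\<^sub>0\<^sup>\<infinity> u\<^sup>p\<^sup>-\<^sup>1 exp (u x - u\<^sup>2/2) du\<close>, a Gaussian Mellin transform.\<close>

definition gauss_mellin :: "real \<Rightarrow> real \<Rightarrow> real" where
  "gauss_mellin p x = (\<Sum>n. gm_coeff p n * x ^ n)"

lemma gm_coeff_pos: "0 < p \<Longrightarrow> 0 < gm_coeff p n"
  unfolding gm_coeff_def by (intro divide_pos_pos mult_pos_pos Gamma_real_pos) auto

text \<open>Differentiation raises \<open>p\<close> by 1, as it does under the integral
  sign.\<close>

lemma gm_coeff_Suc: "real (Suc n) * gm_coeff p (Suc n) = gm_coeff (p + 1) n"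
  by (simp add: gm_coeff_def fact_Suc field_simps del: of_nat_Suc) (simp add: algebra_simps)

lemma gm_coeff_add_2:
  assumes "0 < p"
  shows "gm_coeff (p + 2) n = (p + real n) * gm_coeff p n"
proof -
  have eq: "(p + 2 + real n) / 2 = (p + real n) / 2 + 1" by (simp add: field_simps)
  have "Gamma ((p + real n) / 2 + 1) = (p + real n) / 2 * Gamma ((p + real n) / 2)"
    using assms by (intro Gamma_plus1) (auto simp: nonpos_Ints_def)
  moreover have "(2::real) powr ((p + real n) / 2) = 2 powr ((p + real n) / 2 - 1) * 2"
    by (simp add: powr_diff)
  ultimately show ?thesis
    unfolding gm_coeff_def eq by simp
qed

lemma gm_coeff_Suc_Suc:
  assumes "0 < p"
  shows "gm_coeff p (Suc (Suc n)) = gm_coeff p n * (p + real n) / ((real n + 1) * (real n + 2))"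
proof -
  have "gm_coeff p (Suc (Suc n)) = gm_coeff (p + 2) n / ((real n + 1) * (real n + 2))"
  proof -
    have "gm_coeff (p + 2) n = (real n + 1) * gm_coeff (p + 1) (Suc n)"
      using gm_coeff_Suc[of n "p + 1"] by (simp add: add.commute)
    also have "gm_coeff (p + 1) (Suc n) = (real n + 2) * gm_coeff p (Suc (Suc n))"
      using gm_coeff_Suc[of "Suc n" p] by (simp add: add.commute)
    finally show ?thesis by (simp add: add_eq_0_iff)
  qed
  then show ?thesis by (simp add: gm_coeff_add_2[OF assms] ac_simps)
qed

text \<open>Steps of length 2 in the exponent are steps of length 1 in the Gamma argument. The even
  and the odd part of the power series thus become the two hypergeometric series that occur in
  F.\<close>

lemma gm_coeff_even:
  assumes "0 < p"
  shows "gm_coeff p (2 * m) * x ^ (2 * m)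
    = gm_coeff p 0 * (pochhammer (p / 2) m * (x\<^sup>2 / 2) ^ m / (pochhammer (1/2) m * fact m))"
proof (induction m)
  case (Suc m)
  have pos: "0 < pochhammer (1/2 :: real) m" by (intro pochhammer_pos) simp
  have "gm_coeff p (2 * Suc m) * x ^ (2 * Suc m)
      = (gm_coeff p (2 * m) * x ^ (2 * m)) * (x\<^sup>2 * (p + 2 * real m) / ((2 * real m + 1) * (2 * real m + 2)))"
    by (simp add: gm_coeff_Suc_Suc[OF assms] power2_eq_square)
  also have "\<dots> = gm_coeff p 0 * (pochhammer (p / 2) (Suc m) * (x\<^sup>2 / 2) ^ Suc m / (pochhammer (1/2) (Suc m) * fact (Suc m)))"
    unfolding Suc using pos by (simp add: pochhammer_Suc divide_simps) (simp add: algebra_simps)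
  finally show ?case .
qed simp

lemma gm_coeff_odd:
  assumes "0 < p"
  shows "gm_coeff p (2 * m + 1) * x ^ (2 * m + 1)
    = gm_coeff p 1 * x * (pochhammer ((p + 1) / 2) m * (x\<^sup>2 / 2) ^ m / (pochhammer (3/2) m * fact m))"
proof (induction m)
  case (Suc m)
  have pos: "0 < pochhammer (3/2 :: real) m" by (intro pochhammer_pos) simp
  have "gm_coeff p (2 * Suc m + 1) * x ^ (2 * Suc m + 1)
      = (gm_coeff p (2 * m + 1) * x ^ (2 * m + 1)) * (x\<^sup>2 * (p + 2 * real m + 1) / ((2 * real m + 2) * (2 * real m + 3)))"
    by (simp add: gm_coeff_Suc_Suc[OF assms] power2_eq_square ac_simps)
  also have "\<dots> = gm_coeff p 1 * x * (pochhammer ((p + 1) / 2) (Suc m) * (x\<^sup>2 / 2) ^ Suc m / (pochhammer (3/2) (Suc m) * fact (Suc m)))"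
    unfolding Suc using pos by (simp add: pochhammer_Suc divide_simps) (simp add: algebra_simps)
  finally show ?case .
qed simp

lemma gauss_mellin_sums_hypergeom:
  assumes "0 < p"
  shows "(\<lambda>n. gm_coeff p n * x ^ n) sums
    (gm_coeff p 1 * x * hypergeom_M ((p + 1) / 2) (3/2) (x\<^sup>2 / 2)
      + gm_coeff p 0 * hypergeom_M (p / 2) (1/2) (x\<^sup>2 / 2))"
proof -
  have even: "(\<lambda>m. gm_coeff p (2 * m) * x ^ (2 * m)) sums (gm_coeff p 0 * hypergeom_M (p / 2) (1/2) (x\<^sup>2 / 2))"
    unfolding gm_coeff_even[OF assms] by (intro sums_mult hypergeom_M_sums) simp
  have odd: "(\<lambda>m. gm_coeff p (2 * m + 1) * x ^ (2 * m + 1)) sums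
      (gm_coeff p 1 * x * hypergeom_M ((p + 1) / 2) (3/2) (x\<^sup>2 / 2))"
    unfolding gm_coeff_odd[OF assms] by (intro sums_mult hypergeom_M_sums) simp
  have "(\<lambda>n. if even n then gm_coeff p (2 * (n div 2)) * x ^ (2 * (n div 2))
        else gm_coeff p (2 * ((n - 1) div 2) + 1) * x ^ (2 * ((n - 1) div 2) + 1)) sums
    (gm_coeff p 1 * x * hypergeom_M ((p + 1) / 2) (3/2) (x\<^sup>2 / 2)
      + gm_coeff p 0 * hypergeom_M (p / 2) (1/2) (x\<^sup>2 / 2))"
    by (rule sums_if[OF odd even])
  moreover have "(\<lambda>n. if even n then gm_coeff p (2 * (n div 2)) * x ^ (2 * (n div 2))
        else gm_coeff p (2 * ((n - 1) div 2) + 1) * x ^ (2 * ((n - 1) div 2) + 1))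
      = (\<lambda>n. gm_coeff p n * x ^ n)"
    by (auto simp: fun_eq_iff elim!: evenE oddE)
  ultimately show ?thesis by simp
qed

lemma gauss_mellin_hypergeom:
  assumes "0 < p"
  shows "gauss_mellin p x = gm_coeff p 1 * x * hypergeom_M ((p + 1) / 2) (3/2) (x\<^sup>2 / 2)
      + gm_coeff p 0 * hypergeom_M (p / 2) (1/2) (x\<^sup>2 / 2)"
  unfolding gauss_mellin_def using sums_unique[OF gauss_mellin_sums_hypergeom[OF assms]] by simp

lemma gauss_mellin_sums:
  assumes "0 < p"
  shows "(\<lambda>n. gm_coeff p n * x ^ n) sums gauss_mellin p x"
  unfolding gauss_mellin_def
  by (rule summable_sums[OF sums_summable[OF gauss_mellin_sums_hypergeom[OF assms]]])

lemma DERIV_gauss_mellin: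
  assumes "0 < p"
  shows "(gauss_mellin p has_real_derivative gauss_mellin (p + 1) x) (at x)"
proof -
  have "((\<lambda>x. \<Sum>n. gm_coeff p n * x ^ n) has_field_derivative (\<Sum>n. diffs (gm_coeff p) n * x ^ n)) (at x)"
    by (rule termdiffs_strong_converges_everywhere) (rule sums_summable[OF gauss_mellin_sums[OF assms]])
  moreover have "diffs (gm_coeff p) = gm_coeff (p + 1)"
    by (simp only: diffs_def gm_coeff_Suc)
  ultimately show ?thesis by (simp add: gauss_mellin_def[abs_def])
qed

text \<open>For the integral this is integration by parts against exp (- u^2/2); here it is read off
  from the coefficients. It yields the derivative of \<open>gauss_power\<close>.\<close>

lemma gauss_mellin_rec:
  assumes "0 < p"
  shows "gauss_mellin (p + 2) x = x * gauss_mellin (p + 1) x + p * gauss_mellin p x"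
proof -
  have "(\<lambda>n. real (Suc n) * gm_coeff p (Suc n) * x ^ Suc n) sums (x * gauss_mellin (p + 1) x)"
    unfolding gm_coeff_Suc
    using sums_mult[OF gauss_mellin_sums[of "p + 1" x], of x] assms by (simp add: ac_simps)
  from sums_Suc[OF this]
  have "(\<lambda>n. real n * gm_coeff p n * x ^ n) sums (x * gauss_mellin (p + 1) x)" by simp
  from sums_add[OF this sums_mult[OF gauss_mellin_sums[OF assms, of x], of p]]
  have "(\<lambda>n. gm_coeff (p + 2) n * x ^ n) sums (x * gauss_mellin (p + 1) x + p * gauss_mellin p x)"
    by (simp add: gm_coeff_add_2[OF assms] algebra_simps)
  with gauss_mellin_sums[of "p + 2" x] assms show ?thesis by (auto intro: sums_unique2)
qed

lemma has_bochner_integral_gauss_moment: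
  assumes p: "0 < p"
  shows "has_bochner_integral lborel (\<lambda>u. indicator {0<..} u * (u powr (p - 1) * exp (- u\<^sup>2 / 2))) (gm_coeff p 0)"
proof -
  let ?f = "\<lambda>t::real. t powr (p / 2 - 1) / exp t"
  have img: "(\<lambda>u::real. u\<^sup>2 / 2) ` {0<..} = {0<..}"
  proof (intro equalityI subsetI)
    fix t :: real assume "t \<in> {0<..}"
    then show "t \<in> (\<lambda>u. u\<^sup>2 / 2) ` {0<..}" by (intro image_eqI[of _ _ "sqrt (2 * t)"]) auto
  qed auto
  have G: "(?f has_integral Gamma (p / 2)) {0<..}"
  proof (rule has_integral_spike_set_eq[THEN iffD1, OF _ _ Gamma_integral_real])
    show "0 < p / 2" using p by simp
    show "negligible {x \<in> {0::real..} - {0<..}. ?f x \<noteq> 0}"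
      by (rule negligible_subset[of "{0}"]) auto
    show "negligible {x \<in> {0<..} - {0::real..}. ?f x \<noteq> 0}"
      by (rule negligible_subset[of "{}"]) auto
  qed
  then have "?f absolutely_integrable_on {0<..}"
    by (intro nonnegative_absolutely_integrable_1) auto
  moreover have "integral {0<..} ?f = Gamma (p / 2)" using G by (rule integral_unique)
  ultimately have f: "?f absolutely_integrable_on (\<lambda>u. u\<^sup>2 / 2) ` {0<..} \<and>
      integral ((\<lambda>u. u\<^sup>2 / 2) ` {0<..}) ?f = Gamma (p / 2)"
    unfolding img by simp
  have "(\<lambda>u. \<bar>u\<bar> * ?f (u\<^sup>2 / 2)) absolutely_integrable_on {0<..}
      \<and> integral {0<..} (\<lambda>u. \<bar>u\<bar> * ?f (u\<^sup>2 / 2)) = Gamma (p / 2)"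
  proof (rule has_absolute_integral_change_of_variables_1'[THEN iffD2, OF _ _ _ f])
    show "{0<..} \<in> sets (lebesgue :: real measure)" by simp
    show "((\<lambda>u. u\<^sup>2 / 2) has_real_derivative u) (at u within {0<..})" for u :: real
      by (auto intro!: derivative_eq_intros)
    show "inj_on (\<lambda>u::real. u\<^sup>2 / 2) {0<..}"
      by (rule inj_onI) (simp add: power2_eq_iff_nonneg)
  qed
  then have "(\<lambda>u. \<bar>u\<bar> * ?f (u\<^sup>2 / 2)) integrable_on {0<..}"
    "integral {0<..} (\<lambda>u. \<bar>u\<bar> * ?f (u\<^sup>2 / 2)) = Gamma (p / 2)"
    using set_lebesgue_integral_eq_integral(1) by blast+
  then have I: "((\<lambda>u. \<bar>u\<bar> * ?f (u\<^sup>2 / 2)) has_integral Gamma (p / 2)) {0<..}"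
    using integrable_integral by fastforce
  have eq: "\<bar>u\<bar> * ?f (u\<^sup>2 / 2) = 2 powr (1 - p / 2) * (u powr (p - 1) * exp (- u\<^sup>2 / 2))" if "u \<in> {0<..}" for u :: real
  proof -
    have u: "0 < u" using that by simp
    have "(u\<^sup>2 / 2) powr (p / 2 - 1) = u powr (p - 2) * 2 powr (1 - p / 2)"
    proof -
      have "(u\<^sup>2) powr (p / 2 - 1) = u powr (2 * (p / 2 - 1))"
        using u by (simp add: powr_powr flip: powr_numeral)
      moreover have "2 powr (1 - p / 2) = (1::real) / 2 powr (p / 2 - 1)"
        using powr_minus_divide[of "2::real" "p / 2 - 1"] by simp
      ultimately show ?thesis using u by (simp add: powr_divide algebra_simps)
    qed
    moreover have "u * u powr (p - 2) = u powr (p - 1)"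
      using u powr_add[of u 1 "p - 2"] by simp
    ultimately show ?thesis using u by (simp add: exp_minus divide_simps)
  qed
  have "((\<lambda>u. 2 powr (p / 2 - 1) * (2 powr (1 - p / 2) * (u powr (p - 1) * exp (- u\<^sup>2 / 2)))) has_integral
      2 powr (p / 2 - 1) * Gamma (p / 2)) {0<..}"
    by (rule has_integral_mult_right) (rule has_integral_eq[OF eq I])
  moreover have "2 powr (p / 2 - 1) * (2 powr (1 - p / 2) * y) = (y::real)" for y
    by (simp add: mult.assoc[symmetric] powr_add[symmetric])
  ultimately have "((\<lambda>u. u powr (p - 1) * exp (- u\<^sup>2 / 2)) has_integral gm_coeff p 0) {0<..}"
    by (simp add: gm_coeff_def)
  then have "integral\<^sup>N lborel (\<lambda>u. ennreal (u powr (p - 1) * exp (- u\<^sup>2 / 2)) * indicator {0<..} u) = ennreal (gm_coeff p 0)"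
    by (intro nn_integral_has_integral_lebesgue') auto
  moreover have "ennreal (u powr (p - 1) * exp (- u\<^sup>2 / 2)) * indicator {0<..} u
      = ennreal (indicator {0<..} u * (u powr (p - 1) * exp (- u\<^sup>2 / 2)))" for u :: real
    by (simp add: indicator_def)
  ultimately show ?thesis
    using gm_coeff_pos[OF p, of 0] by (intro has_bochner_integral_nn_integral) auto
qed

text \<open>exp (u x) is expanded and integrated term by term. The absolute values of the terms are
  the terms for |x|, so the series at |x| supplies the summability.\<close>

lemma has_bochner_integral_gauss_mellin:
  assumes p: "0 < p"
  shows "has_bochner_integral lborel
    (\<lambda>u. indicator {0<..} u * (u powr (p - 1) * exp (u * x - u\<^sup>2 / 2))) (gauss_mellin p x)"
proof -
  define f where "f x n u = indicator {0<..} u * (u powr (p - 1) * exp (- u\<^sup>2 / 2)) * ((u * x) ^ n / fact n)"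
    for x :: real and n and u :: real
  have moment: "has_bochner_integral lborel (f x n) (gm_coeff p n * x ^ n)" for n x
  proof -
    have "has_bochner_integral lborel
        (\<lambda>u. x ^ n / fact n * (indicator {0<..} u * (u powr (p + real n - 1) * exp (- u\<^sup>2 / 2))))
        (x ^ n / fact n * gm_coeff (p + real n) 0)"
      using p by (intro has_bochner_integral_mult_right has_bochner_integral_gauss_moment) auto
    moreover have "x ^ n / fact n * gm_coeff (p + real n) 0 = gm_coeff p n * x ^ n"
      by (simp add: gm_coeff_def)
    moreover have "x ^ n / fact n * (indicator {0<..} u * (u powr (p + real n - 1) * exp (- u\<^sup>2 / 2))) = f x n u" for u
    proof (cases "0 < u")
      case True
      have "u powr (p + real n - 1) = u powr (p - 1) * u ^ n"
        using True by (simp add: powr_realpow[symmetric] powr_add[symmetric] algebra_simps)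
      then show ?thesis by (simp add: f_def power_mult_distrib)
    qed (simp add: f_def)
    ultimately show ?thesis by simp
  qed
  have norm_f: "(\<lambda>u. norm (f x n u)) = f \<bar>x\<bar> n" for n
    by (auto simp: f_def fun_eq_iff abs_mult power_abs indicator_def)
  have exp_sums: "(\<lambda>n. f y n u) sums (indicator {0<..} u * (u powr (p - 1) * exp (u * y - u\<^sup>2 / 2)))" for y u
  proof -
    have "(\<lambda>n. (u * y) ^ n / fact n) sums exp (u * y)"
      using exp_converges[of "u * y"] by (simp add: field_simps)
    from sums_mult[OF this, of "indicator {0<..} u * (u powr (p - 1) * exp (- u\<^sup>2 / 2))"]
    moreover have "exp (u * y - u\<^sup>2 / 2) = exp (- u\<^sup>2 / 2) * exp (u * y)"
      by (simp flip: exp_add)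
    ultimately show ?thesis unfolding f_def by (simp only: mult.assoc)
  qed
  have int: "integrable lborel (f x n)" for n by (rule integrable.intros[OF moment])
  have AE: "AE u in lborel. summable (\<lambda>n. norm (f x n u))"
    using sums_summable[OF exp_sums[of "\<bar>x\<bar>"]] norm_f by (auto simp: fun_eq_iff)
  have sum: "summable (\<lambda>n. \<integral>u. norm (f x n u) \<partial>lborel)"
    unfolding norm_f using moment[of "\<bar>x\<bar>"] sums_summable[OF gauss_mellin_sums[OF p, of "\<bar>x\<bar>"]]
    by (simp add: has_bochner_integral_iff)
  have eq: "(\<lambda>u. \<Sum>n. f x n u) = (\<lambda>u. indicator {0<..} u * (u powr (p - 1) * exp (u * x - u\<^sup>2 / 2)))"
    using sums_unique[OF exp_sums[of x]] by (simp add: fun_eq_iff)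
  have "(\<integral>u. (\<Sum>n. f x n u) \<partial>lborel) = (\<Sum>n. \<integral>u. f x n u \<partial>lborel)"
    by (rule integral_suminf[OF int AE sum])
  also have "\<dots> = gauss_mellin p x"
    using moment[of x] by (simp add: has_bochner_integral_iff gauss_mellin_def)
  finally show ?thesis
    using integrable_suminf[OF int AE sum] unfolding eq by (simp add: has_bochner_integral_iff)
qed

lemma nn_integral_gauss_mellin:
  assumes "0 < p"
  shows "(\<integral>\<^sup>+u. indicator {0<..} u * ennreal (u powr (p - 1) * exp (u * x - u\<^sup>2 / 2)) \<partial>lborel)
    = ennreal (gauss_mellin p x)"
proof -
  have "(\<integral>\<^sup>+u. ennreal (indicator {0<..} u * (u powr (p - 1) * exp (u * x - u\<^sup>2 / 2))) \<partial>lborel)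
      = ennreal (gauss_mellin p x)"
    using nn_integral_eq_integral[of lborel "\<lambda>u. indicator {0<..} u * (u powr (p - 1) * exp (u * x - u\<^sup>2 / 2))"]
      has_bochner_integral_gauss_mellin[OF assms, of x]
    by (simp add: has_bochner_integral_iff)
  moreover have "ennreal (indicator {0<..} u * y) = indicator {0<..} u * ennreal y" for u y :: real
    by (simp add: indicator_def)
  ultimately show ?thesis by simp
qed

lemma gauss_mellin_pos:
  assumes "0 < p"
  shows "0 < gauss_mellin p x"
proof -
  let ?g = "\<lambda>u. indicator {0<..} u * ennreal (u powr (p - 1) * exp (u * x - u\<^sup>2 / 2))"
  have "(\<integral>\<^sup>+u. ?g u \<partial>lborel) \<noteq> 0"
  proof
    assume "(\<integral>\<^sup>+u. ?g u \<partial>lborel) = 0"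
    then have "AE u in lborel. ?g u = 0" by (subst (asm) nn_integral_0_iff_AE) auto
    then have "AE u in lborel. u \<notin> {0<..(1::real)}"
      by eventually_elim (auto simp: indicator_def)
    then have "emeasure lborel {0<..(1::real)} = 0"
      by (rule AE_iff_measurable[THEN iffD1, rotated -1]) auto
    moreover have "emeasure lborel {0<..(1::real)} = 1" by (subst emeasure_lborel_Ioc) auto
    ultimately show False by simp
  qed
  then show ?thesis unfolding nn_integral_gauss_mellin[OF assms] by (simp add: ennreal_eq_0_iff not_le)
qed

section \<open>Functions invariant under Gaussian averaging\<close>

text \<open>For \<open>q \<ge> 0\<close> this is \<open>\<integral>\<^sub>0\<^sup>\<infinity> u\<^sup>q exp (- (u - x)\<^sup>2/2) du\<close>, i.e. up to \<open>sqrt (2 \<pi>)\<close>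
  the expectation of \<open>max 0 (x + Z)\<^sup>q\<close> for a standard normal \<open>Z\<close>.\<close>

definition gauss_power :: "real \<Rightarrow> real \<Rightarrow> real" where
  "gauss_power q x = exp (- x\<^sup>2 / 2) * gauss_mellin (q + 1) x"

lemma gauss_power_pos: "-1 < q \<Longrightarrow> 0 < gauss_power q x"
  unfolding gauss_power_def by (intro mult_pos_pos gauss_mellin_pos) auto

lemma DERIV_gauss_power:
  assumes "0 < q"
  shows "(gauss_power q has_real_derivative q * gauss_power (q - 1) x) (at x)"
proof -
  have "(gauss_power q has_real_derivative
      exp (- x\<^sup>2 / 2) * gauss_mellin (q + 2) x + (- x * exp (- x\<^sup>2 / 2)) * gauss_mellin (q + 1) x) (at x)"
    unfolding gauss_power_def[abs_def] using DERIV_gauss_mellin[of "q + 1" x] assms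
    by (auto intro!: derivative_eq_intros simp: add.assoc)
  also have "exp (- x\<^sup>2 / 2) * gauss_mellin (q + 2) x + (- x * exp (- x\<^sup>2 / 2)) * gauss_mellin (q + 1) x
      = q * gauss_power (q - 1) x"
    using gauss_mellin_rec[OF assms, of x] by (simp add: gauss_power_def algebra_simps)
  finally show ?thesis .
qed

lemma nn_integral_gauss_power:
  assumes "-1 < q"
  shows "(\<integral>\<^sup>+u. indicator {0<..} u * ennreal (u powr q * exp (- (u - x)\<^sup>2 / 2)) \<partial>lborel)
    = ennreal (gauss_power q x)"
proof -
  have "indicator {0<..} u * ennreal (u powr q * exp (- (u - x)\<^sup>2 / 2))
      = ennreal (exp (- x\<^sup>2 / 2)) * (indicator {0<..} u * ennreal (u powr ((q + 1) - 1) * exp (u * x - u\<^sup>2 / 2)))" for u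
  proof -
    have "exp (- (u - x)\<^sup>2 / 2) = exp (- x\<^sup>2 / 2) * exp (u * x - u\<^sup>2 / 2)"
      by (simp add: power2_eq_square algebra_simps add_divide_distrib diff_divide_distrib flip: exp_add)
    then show ?thesis by (simp add: indicator_def ennreal_mult ac_simps)
  qed
  then have "(\<integral>\<^sup>+u. indicator {0<..} u * ennreal (u powr q * exp (- (u - x)\<^sup>2 / 2)) \<partial>lborel)
      = ennreal (exp (- x\<^sup>2 / 2)) * ennreal (gauss_mellin (q + 1) x)"
    using nn_integral_gauss_mellin[of "q + 1" x] assms by (simp add: nn_integral_cmult)
  then show ?thesis by (simp add: gauss_power_def ennreal_mult')
qed

text \<open>Only u in [x, x + 1] is kept, where u^q \<ge> x^q and the exponential is at least exp (-
  1/2). This is the source of superlinear growth for \<alpha> < 1/2.\<close>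

lemma gauss_power_ge:
  assumes "0 < q" "0 < x"
  shows "exp (- 1 / 2) * x powr q \<le> gauss_power q x"
proof -
  have "ennreal (exp (- 1 / 2) * x powr q) = (\<integral>\<^sup>+u. ennreal (exp (- 1 / 2) * x powr q) * indicator {x..x + 1} u \<partial>lborel)"
    by (simp add: nn_integral_cmult_indicator)
  also have "\<dots> \<le> (\<integral>\<^sup>+u. indicator {0<..} u * ennreal (u powr q * exp (- (u - x)\<^sup>2 / 2)) \<partial>lborel)"
  proof (rule nn_integral_mono)
    fix u
    show "ennreal (exp (- 1 / 2) * x powr q) * indicator {x..x + 1} u
        \<le> indicator {0<..} u * ennreal (u powr q * exp (- (u - x)\<^sup>2 / 2))"
    proof (cases "u \<in> {x..x + 1}")
      case True
      have "(u - x)\<^sup>2 \<le> 1" using True by (intro power_le_one) auto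
      then have "exp (- 1 / 2) * x powr q \<le> exp (- (u - x)\<^sup>2 / 2) * u powr q"
        using True assms by (intro mult_mono powr_mono2) auto
      then show ?thesis using True assms by (auto intro!: ennreal_leI simp: mult.commute)
    qed simp
  qed
  also have "\<dots> = ennreal (gauss_power q x)" using assms by (intro nn_integral_gauss_power) auto
  finally show ?thesis using gauss_power_pos[of q x] assms by simp
qed

lemma nn_integral_normal_density:
  assumes "0 < \<sigma>"
  shows "(\<integral>\<^sup>+d. ennreal (normal_density \<mu> \<sigma> d) \<partial>lborel) = 1"
  using prob_space.emeasure_space_1[OF prob_space_normal_density[OF assms, of \<mu>]]
  by (simp add: emeasure_density)

lemma nn_integral_normal_density_exp:
  assumes "0 < \<sigma>"
  shows "gauss_mean \<sigma> (\<lambda>d. ennreal (exp (r * d))) = ennreal (exp (r\<^sup>2 * \<sigma>\<^sup>2 / 2))"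
proof -
  \<comment> \<open>Completing the square moves the centre of the density to r \<sigma>^2.\<close>
  have "normal_density 0 \<sigma> d * exp (r * d) = exp (r\<^sup>2 * \<sigma>\<^sup>2 / 2) * normal_density (r * \<sigma>\<^sup>2) \<sigma> d" for d
  proof -
    have "- d\<^sup>2 / (2 * \<sigma>\<^sup>2) + r * d = r\<^sup>2 * \<sigma>\<^sup>2 / 2 + - (d - r * \<sigma>\<^sup>2)\<^sup>2 / (2 * \<sigma>\<^sup>2)"
      using assms by (simp add: power2_eq_square field_simps)
    then have "exp (- d\<^sup>2 / (2 * \<sigma>\<^sup>2)) * exp (r * d) = exp (r\<^sup>2 * \<sigma>\<^sup>2 / 2) * exp (- (d - r * \<sigma>\<^sup>2)\<^sup>2 / (2 * \<sigma>\<^sup>2))"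
      by (simp only: exp_add[symmetric])
    then show ?thesis by (simp add: normal_density_def)
  qed
  then have "ennreal (normal_density 0 \<sigma> d) * ennreal (exp (r * d))
      = ennreal (exp (r\<^sup>2 * \<sigma>\<^sup>2 / 2)) * ennreal (normal_density (r * \<sigma>\<^sup>2) \<sigma> d)" for d
    by (simp flip: ennreal_mult')
  then show ?thesis
    by (simp add: nn_integral_cmult nn_integral_normal_density[OF assms])
qed

text \<open>Substituting \<open>sqrt w * u\<close> for \<open>u\<close> exhibits a mixture of exp (u
  n - u^2 w / 2), the exponential martingales with \<open>w\<close> as their time.\<close>

lemma gauss_mellin_scaled:
  assumes p: "0 < p" and w: "0 < w"
  shows "ennreal (w powr (- p / 2) * gauss_mellin p (n / sqrt w))
    = (\<integral>\<^sup>+u. indicator {0<..} u * ennreal (u powr (p - 1) * exp (u * n - u\<^sup>2 * w / 2)) \<partial>lborel)"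
proof -
  have s: "0 < sqrt w" using w by simp
  have "(\<integral>\<^sup>+u. indicator {0<..} u * ennreal (u powr (p - 1) * exp (u * (n / sqrt w) - u\<^sup>2 / 2)) \<partial>lborel)
    = ennreal (sqrt w) * (\<integral>\<^sup>+u. indicator {0<..} (0 + sqrt w * u) *
        ennreal ((0 + sqrt w * u) powr (p - 1) * exp ((0 + sqrt w * u) * (n / sqrt w) - (0 + sqrt w * u)\<^sup>2 / 2)) \<partial>lborel)"
    using s by (subst nn_integral_real_affine[where c = "sqrt w" and t = 0]) auto
  also have "\<dots> = (\<integral>\<^sup>+u. ennreal (w powr (p / 2)) *
      (indicator {0<..} u * ennreal (u powr (p - 1) * exp (u * n - u\<^sup>2 * w / 2))) \<partial>lborel)"
  proof (subst nn_integral_cmult[symmetric], measurable, rule nn_integral_cong)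
    fix u
    show "ennreal (sqrt w) * (indicator {0<..} (0 + sqrt w * u) *
        ennreal ((0 + sqrt w * u) powr (p - 1) * exp ((0 + sqrt w * u) * (n / sqrt w) - (0 + sqrt w * u)\<^sup>2 / 2)))
      = ennreal (w powr (p / 2)) * (indicator {0<..} u * ennreal (u powr (p - 1) * exp (u * n - u\<^sup>2 * w / 2)))"
    proof (cases "0 < u")
      case True
      have "sqrt w * (sqrt w * u) powr (p - 1) = w powr (p / 2) * u powr (p - 1)"
      proof -
        have "sqrt w * sqrt w powr (p - 1) = sqrt w powr p"
          using s powr_add[of "sqrt w" 1 "p - 1"] by simp
        also have "\<dots> = w powr (p / 2)"
          using w by (simp add: powr_half_sqrt[symmetric] powr_powr)
        finally show ?thesis using True w by (simp add: powr_mult)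
      qed
      moreover have "sqrt w * u * (n / sqrt w) - (sqrt w * u)\<^sup>2 / 2 = u * n - u\<^sup>2 * w / 2"
        using w by (simp add: power_mult_distrib)
      ultimately show ?thesis
        using True w by (simp add: zero_less_mult_iff mult.assoc flip: ennreal_mult')
    next
      case False
      then have "\<not> 0 < sqrt w * u" using s by (simp add: zero_less_mult_iff)
      then show ?thesis using False by simp
    qed
  qed
  also have "\<dots> = ennreal (w powr (p / 2)) *
      (\<integral>\<^sup>+u. indicator {0<..} u * ennreal (u powr (p - 1) * exp (u * n - u\<^sup>2 * w / 2)) \<partial>lborel)" (is "_ = _ * ?I")
    by (rule nn_integral_cmult) measurable
  finally have "ennreal (gauss_mellin p (n / sqrt w)) = ennreal (w powr (p / 2)) * ?I"
    by (simp only: nn_integral_gauss_mellin[OF p])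
  then have "ennreal (w powr (- p / 2)) * ennreal (gauss_mellin p (n / sqrt w))
      = (ennreal (w powr (- p / 2)) * ennreal (w powr (p / 2))) * ?I" by (simp add: mult.assoc)
  also have "ennreal (w powr (- p / 2)) * ennreal (w powr (p / 2)) = 1"
    using w by (simp add: powr_add[symmetric] flip: ennreal_mult')
  finally show ?thesis by (simp add: ennreal_mult')
qed

text \<open>Here \<open>w\<close> grows with time, so the later value carries w + \<delta>.
  Averaging exp (u d) produces exp (u^2 \<delta> / 2), which cancels exactly the additional
  \<delta>.\<close>

lemma gauss_mellin_heat:
  assumes p: "0 < p" and w: "0 < w" and \<delta>: "0 < \<delta>"
  shows "gauss_mean (sqrt \<delta>)
      (\<lambda>d. ennreal ((w + \<delta>) powr (- p / 2) * gauss_mellin p ((n + d) / sqrt (w + \<delta>))))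
    = ennreal (w powr (- p / 2) * gauss_mellin p (n / sqrt w))"
proof -
  let ?g = "\<lambda>d u. ennreal (normal_density 0 (sqrt \<delta>) d) *
      (indicator {0<..} u * ennreal (u powr (p - 1) * exp (u * (n + d) - u\<^sup>2 * (w + \<delta>) / 2)))"
  have "gauss_mean (sqrt \<delta>)
      (\<lambda>d. ennreal ((w + \<delta>) powr (- p / 2) * gauss_mellin p ((n + d) / sqrt (w + \<delta>))))
    = (\<integral>\<^sup>+d. \<integral>\<^sup>+u. ?g d u \<partial>lborel \<partial>lborel)"
    unfolding gauss_mellin_scaled[OF p add_pos_pos[OF w \<delta>]] by (simp add: nn_integral_cmult)
  also have "\<dots> = (\<integral>\<^sup>+u. \<integral>\<^sup>+d. ?g d u \<partial>lborel \<partial>lborel)"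
    by (rule lborel_pair.Fubini') measurable
  also have "\<dots> = (\<integral>\<^sup>+u. indicator {0<..} u * ennreal (u powr (p - 1) * exp (u * n - u\<^sup>2 * w / 2)) \<partial>lborel)"
  proof (rule nn_integral_cong)
    fix u
    have split: "exp (u * (n + d) - u\<^sup>2 * (w + \<delta>) / 2) = exp (u * n - u\<^sup>2 * (w + \<delta>) / 2) * exp (u * d)" for d
      by (simp add: algebra_simps flip: exp_add)
    have "?g d u = (indicator {0<..} u * ennreal (u powr (p - 1) * exp (u * n - u\<^sup>2 * (w + \<delta>) / 2))) *
        (ennreal (normal_density 0 (sqrt \<delta>) d) * ennreal (exp (u * d)))" for d
      unfolding split by (simp add: ennreal_mult' ac_simps)
    then have "(\<integral>\<^sup>+d. ?g d u \<partial>lborel)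
        = (indicator {0<..} u * ennreal (u powr (p - 1) * exp (u * n - u\<^sup>2 * (w + \<delta>) / 2))) * ennreal (exp (u\<^sup>2 * \<delta> / 2))"
      using nn_integral_normal_density_exp[of "sqrt \<delta>" u] \<delta> by (simp add: nn_integral_cmult)
    also have "\<dots> = indicator {0<..} u * ennreal (u powr (p - 1) * (exp (u * n - u\<^sup>2 * (w + \<delta>) / 2) * exp (u\<^sup>2 * \<delta> / 2)))"
      by (simp add: ennreal_mult' ac_simps)
    also have "exp (u * n - u\<^sup>2 * (w + \<delta>) / 2) * exp (u\<^sup>2 * \<delta> / 2) = exp (u * n - u\<^sup>2 * w / 2)"
      by (simp add: algebra_simps add_divide_distrib flip: exp_add)
    finally show "(\<integral>\<^sup>+d. ?g d u \<partial>lborel) = indicator {0<..} u * ennreal (u powr (p - 1) * exp (u * n - u\<^sup>2 * w / 2))" .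
  qed
  also have "\<dots> = ennreal (w powr (- p / 2) * gauss_mellin p (n / sqrt w))"
    by (rule gauss_mellin_scaled[OF p w, symmetric])
  finally show ?thesis .
qed

text \<open>The right side integrates u^q over u > 0 against the normal law with mean
  \<open>n\<close> and variance \<open>w\<close>; sqrt (2 \<pi>) normalises its density.\<close>

lemma gauss_power_scaled:
  assumes q: "-1 < q" and w: "0 < w"
  shows "ennreal (w powr (q / 2) * gauss_power q (n / sqrt w) / sqrt (2 * pi))
    = (\<integral>\<^sup>+u. indicator {0<..} u * ennreal (u powr q * normal_density 0 (sqrt w) (u - n)) \<partial>lborel)"
proof -
  have s: "0 < sqrt w" using w by simp
  have "(\<integral>\<^sup>+u. indicator {0<..} u * ennreal (u powr q * normal_density 0 (sqrt w) (u - n)) \<partial>lborel)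
    = ennreal (sqrt w) * (\<integral>\<^sup>+u. indicator {0<..} (0 + sqrt w * u) *
        ennreal ((0 + sqrt w * u) powr q * normal_density 0 (sqrt w) ((0 + sqrt w * u) - n)) \<partial>lborel)"
    using s by (subst nn_integral_real_affine[where c = "sqrt w" and t = 0]) auto
  also have "\<dots> = (\<integral>\<^sup>+u. ennreal (w powr (q / 2) / sqrt (2 * pi)) *
      (indicator {0<..} u * ennreal (u powr q * exp (- (u - n / sqrt w)\<^sup>2 / 2))) \<partial>lborel)"
  proof (subst nn_integral_cmult[symmetric], measurable, rule nn_integral_cong)
    fix u
    show "ennreal (sqrt w) * (indicator {0<..} (0 + sqrt w * u) *
        ennreal ((0 + sqrt w * u) powr q * normal_density 0 (sqrt w) ((0 + sqrt w * u) - n)))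
      = ennreal (w powr (q / 2) / sqrt (2 * pi)) *
      (indicator {0<..} u * ennreal (u powr q * exp (- (u - n / sqrt w)\<^sup>2 / 2)))"
    proof (cases "0 < u")
      case True
      have "sqrt w powr q = w powr (q / 2)"
        using w by (simp add: powr_half_sqrt[symmetric] powr_powr)
      then have a: "(sqrt w * u) powr q = w powr (q / 2) * u powr q"
        using True w by (simp add: powr_mult)
      have "(sqrt w * u - n)\<^sup>2 = w * (u - n / sqrt w)\<^sup>2"
      proof -
        have "sqrt w * u - n = sqrt w * (u - n / sqrt w)" using s by (simp add: right_diff_distrib)
        then show ?thesis using w by (simp add: power_mult_distrib)
      qed
      then have b: "sqrt w * normal_density 0 (sqrt w) (sqrt w * u - n) = exp (- (u - n / sqrt w)\<^sup>2 / 2) / sqrt (2 * pi)"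
        using w by (simp add: normal_density_def real_sqrt_mult)
      have "sqrt w * ((sqrt w * u) powr q * normal_density 0 (sqrt w) (sqrt w * u - n))
        = (sqrt w * u) powr q * (sqrt w * normal_density 0 (sqrt w) (sqrt w * u - n))" by simp
      also have "\<dots> = w powr (q / 2) / sqrt (2 * pi) * (u powr q * exp (- (u - n / sqrt w)\<^sup>2 / 2))"
        unfolding a b by simp
      finally show ?thesis
        using True w by (simp add: zero_less_mult_iff flip: ennreal_mult')
    next
      case False
      then have "\<not> 0 < sqrt w * u" using s by (simp add: zero_less_mult_iff)
      then show ?thesis using False by simp
    qed
  qed
  also have "\<dots> = ennreal (w powr (q / 2) / sqrt (2 * pi)) * ennreal (gauss_power q (n / sqrt w))"
    unfolding nn_integral_gauss_power[OF q, symmetric] by (rule nn_integral_cmult) measurable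
  finally show ?thesis by (simp flip: ennreal_mult')
qed

text \<open>Here \<open>w\<close> is a variance still to come and shrinks with time: seen \<delta>
  earlier it is w + \<delta>, by the convolution of normal densities.\<close>

lemma gauss_power_heat:
  assumes q: "-1 < q" and w: "0 < w" and \<delta>: "0 < \<delta>"
  shows "gauss_mean (sqrt \<delta>)
      (\<lambda>d. ennreal (w powr (q / 2) * gauss_power q ((n + d) / sqrt w) / sqrt (2 * pi)))
    = ennreal ((w + \<delta>) powr (q / 2) * gauss_power q (n / sqrt (w + \<delta>)) / sqrt (2 * pi))"
proof -
  let ?g = "\<lambda>d u. ennreal (normal_density 0 (sqrt \<delta>) d) *
      (indicator {0<..} u * ennreal (u powr q * normal_density 0 (sqrt w) (u - (n + d))))"
  have "gauss_mean (sqrt \<delta>)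
      (\<lambda>d. ennreal (w powr (q / 2) * gauss_power q ((n + d) / sqrt w) / sqrt (2 * pi)))
    = (\<integral>\<^sup>+d. \<integral>\<^sup>+u. ?g d u \<partial>lborel \<partial>lborel)"
    by (simp add: gauss_power_scaled[OF q w] nn_integral_cmult del: times_divide_eq_left)
  also have "\<dots> = (\<integral>\<^sup>+u. \<integral>\<^sup>+d. ?g d u \<partial>lborel \<partial>lborel)"
    by (rule lborel_pair.Fubini') measurable
  also have "\<dots> = (\<integral>\<^sup>+u. indicator {0<..} u * ennreal (u powr q * normal_density 0 (sqrt (w + \<delta>)) (u - n)) \<partial>lborel)"
  proof (rule nn_integral_cong)
    fix u
    have "?g d u = (indicator {0<..} u * ennreal (u powr q)) *
        ennreal (normal_density 0 (sqrt w) ((u - n) - d) * normal_density 0 (sqrt \<delta>) d)" for d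
      by (simp add: ennreal_mult' ac_simps diff_diff_eq)
    then have "(\<integral>\<^sup>+d. ?g d u \<partial>lborel) = (indicator {0<..} u * ennreal (u powr q)) *
        (\<integral>\<^sup>+d. ennreal (normal_density 0 (sqrt w) ((u - n) - d) * normal_density 0 (sqrt \<delta>) d) \<partial>lborel)"
      by (simp add: nn_integral_cmult)
    also have "(\<integral>\<^sup>+d. ennreal (normal_density 0 (sqrt w) ((u - n) - d) * normal_density 0 (sqrt \<delta>) d) \<partial>lborel)
        = ennreal (normal_density 0 (sqrt (w + \<delta>)) (u - n))"
      using fun_cong[OF conv_normal_density_zero_mean[of "sqrt w" "sqrt \<delta>"], of "u - n"] w \<delta> by simp
    finally show "(\<integral>\<^sup>+d. ?g d u \<partial>lborel)
        = indicator {0<..} u * ennreal (u powr q * normal_density 0 (sqrt (w + \<delta>)) (u - n))"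
      by (simp add: ennreal_mult' mult.assoc)
  qed
  also have "\<dots> = ennreal ((w + \<delta>) powr (q / 2) * gauss_power q (n / sqrt (w + \<delta>)) / sqrt (2 * pi))"
    using w \<delta> by (intro gauss_power_scaled[OF q, symmetric]) simp
  finally show ?thesis .
qed

section \<open>The function F as a Gaussian integral\<close>

lemma hypergeom_M_0 [simp]: "hypergeom_M \<gamma> \<beta> 0 = 1"
proof -
  have "hypergeom_M \<gamma> \<beta> 0 = (\<Sum>n. (pochhammer \<gamma> n / (pochhammer \<beta> n * fact n)) * 0 ^ n)"
    unfolding hypergeom_M_def by simp
  also have "\<dots> = 1" by (subst powser_zero) simp
  finally show ?thesis .
qed

lemma F_fun_0: "F_fun 0 \<alpha> = K_coeff \<alpha>"
  by (simp add: F_fun_def z_arg_def)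

text \<open>Divided by sqrt |2 \<alpha> - 1|, this is \<open>K_coeff\<close>: K is the weight that
  joins the two hypergeometric functions to a single Gaussian integral.\<close>

lemma gm_coeff_ratio:
  "gm_coeff p 0 / gm_coeff p 1 = Gamma (p / 2) / (sqrt 2 * Gamma ((p + 1) / 2))"
proof -
  have "(2::real) powr ((p + 1) / 2 - 1) = 2 powr (1/2) * 2 powr (p / 2 - 1)"
    by (simp add: add_divide_distrib flip: powr_add)
  then have "(2::real) powr ((p + 1) / 2 - 1) = sqrt 2 * 2 powr (p / 2 - 1)"
    by (simp add: powr_half_sqrt)
  then show ?thesis by (simp add: gm_coeff_def)
qed

text \<open>With p = 1/\<kappa> the parameters \<open>gamma_par \<alpha>\<close> and
  \<open>gamma_par \<alpha> - 1/2\<close> are (p + 1)/2 and p/2, those of the odd and the even part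
  of the Mellin series.\<close>

lemma F_fun_gauss_mellin:
  assumes "1/2 < \<alpha>"
  defines "\<kappa> \<equiv> 2 * \<alpha> - 1"
  shows "F_fun y \<alpha> = gauss_mellin (1 / \<kappa>) (sqrt \<kappa> * y) / (sqrt \<kappa> * gm_coeff (1 / \<kappa>) 1)"
proof -
  define p where "p = 1 / \<kappa>"
  have \<kappa>: "0 < \<kappa>" using assms by (simp add: \<kappa>_def)
  have p: "0 < p" using \<kappa> by (simp add: p_def)
  have g: "gamma_par \<alpha> = (p + 1) / 2" using \<kappa> by (simp add: gamma_par_def p_def \<kappa>_def field_simps)
  have z: "z_arg y \<alpha> = (sqrt \<kappa> * y)\<^sup>2 / 2"
    using \<kappa> by (simp add: z_arg_def power_mult_distrib \<kappa>_def)
  have pos: "0 < gm_coeff p 1" by (rule gm_coeff_pos[OF p])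
  have "K_coeff \<alpha> = Gamma (p / 2) / (sqrt (2 * \<kappa>) * Gamma ((p + 1) / 2))"
    using assms(1) by (simp add: K_coeff_def g \<kappa>_def) (simp add: add_divide_distrib)
  also have "\<dots> = gm_coeff p 0 / gm_coeff p 1 / sqrt \<kappa>"
    unfolding gm_coeff_ratio by (simp add: real_sqrt_mult)
  finally have K: "K_coeff \<alpha> = gm_coeff p 0 / gm_coeff p 1 / sqrt \<kappa>" .
  have g2: "(p + 1) / 2 - 1 / 2 = p / 2" by (simp add: add_divide_distrib)
  show ?thesis
    unfolding F_fun_def K g z g2 p_def[symmetric] gauss_mellin_hypergeom[OF p]
    using pos \<kappa> by (simp add: field_simps)
qed

text \<open>Kummer's transformation absorbs the factor exp (- x^2/2) of \<open>gauss_power\<close>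
  and reverses the sign of the argument, as F requires; the parameter becomes (1 - q)/2 =
  \<open>gamma_par \<alpha>\<close>.\<close>

lemma F_fun_gauss_power:
  assumes "0 < \<alpha>" "\<alpha> < 1/2"
  defines "\<kappa> \<equiv> 1 - 2 * \<alpha>"
  shows "F_fun y \<alpha> = gauss_power (1 / \<kappa>) (sqrt \<kappa> * y) / (sqrt \<kappa> * gm_coeff (1 / \<kappa> + 1) 1)"
proof -
  define q where "q = 1 / \<kappa>"
  define x where "x = sqrt \<kappa> * y"
  have \<kappa>: "0 < \<kappa>" using assms by (simp add: \<kappa>_def)
  have q: "0 < q" using \<kappa> by (simp add: q_def)
  have g: "gamma_par \<alpha> = (1 - q) / 2"
  proof -
    have "gamma_par \<alpha> = - (\<alpha> / \<kappa>)" unfolding gamma_par_def \<kappa>_def using minus_divide_right[of \<alpha> "1 - 2 * \<alpha>"] by simp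
    moreover have "(1 - q) / 2 = - (\<alpha> / \<kappa>)" using \<kappa> by (simp add: q_def \<kappa>_def field_simps)
    ultimately show ?thesis by simp
  qed
  have z: "z_arg y \<alpha> = - (x\<^sup>2 / 2)"
    using \<kappa> by (simp add: z_arg_def power_mult_distrib \<kappa>_def x_def field_simps)
  have pos: "0 < gm_coeff (q + 1) 1" using q by (intro gm_coeff_pos) simp
  have args: "1 - (1 - q) / 2 = (q + 1) / 2" "3 / 2 - (1 - q) / 2 = (q + 1 + 1) / 2"
    by (simp_all add: field_simps)
  have "K_coeff \<alpha> = Gamma ((q + 1) / 2) / (sqrt (2 * \<kappa>) * Gamma ((q + 1 + 1) / 2))"
    unfolding K_coeff_def g args using assms(2) by (simp add: \<kappa>_def)
  also have "\<dots> = gm_coeff (q + 1) 0 / gm_coeff (q + 1) 1 / sqrt \<kappa>"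
    unfolding gm_coeff_ratio by (simp add: real_sqrt_mult)
  finally have K: "K_coeff \<alpha> = gm_coeff (q + 1) 0 / gm_coeff (q + 1) 1 / sqrt \<kappa>" .
  have "exp (- (x\<^sup>2 / 2)) * hypergeom_M ((q + 1 + 1) / 2) (3/2) (x\<^sup>2 / 2) = hypergeom_M ((1 - q) / 2) (3/2) (- (x\<^sup>2 / 2))"
  proof -
    have e: "3/2 - (q + 1 + 1) / 2 = (1 - q) / 2" by (simp add: field_simps)
    show ?thesis using kummer_transformation[of "3/2" "x\<^sup>2 / 2" "(q + 1 + 1) / 2"] unfolding e by simp
  qed
  moreover have "exp (- (x\<^sup>2 / 2)) * hypergeom_M ((q + 1) / 2) (1/2) (x\<^sup>2 / 2) = hypergeom_M ((1 - q) / 2 - 1/2) (1/2) (- (x\<^sup>2 / 2))"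
  proof -
    have e: "1/2 - (q + 1) / 2 = (1 - q) / 2 - 1/2" by (simp add: field_simps)
    show ?thesis using kummer_transformation[of "1/2" "x\<^sup>2 / 2" "(q + 1) / 2"] unfolding e by simp
  qed
  moreover have "gauss_power q x = gm_coeff (q + 1) 1 * x * (exp (- (x\<^sup>2 / 2)) * hypergeom_M ((q + 1 + 1) / 2) (3/2) (x\<^sup>2 / 2))
      + gm_coeff (q + 1) 0 * (exp (- (x\<^sup>2 / 2)) * hypergeom_M ((q + 1) / 2) (1/2) (x\<^sup>2 / 2))"
    using q by (simp add: gauss_power_def gauss_mellin_hypergeom algebra_simps)
  ultimately have "gauss_power q x = gm_coeff (q + 1) 1 * x * hypergeom_M ((1 - q) / 2) (3/2) (- (x\<^sup>2 / 2))
      + gm_coeff (q + 1) 0 * hypergeom_M ((1 - q) / 2 - 1/2) (1/2) (- (x\<^sup>2 / 2))"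
    by simp
  then show ?thesis
    unfolding F_fun_def K g z q_def[symmetric] x_def[symmetric]
    using pos \<kappa> by (simp add: field_simps x_def)
qed

text \<open>The hypotheses of \<open>tangent_through_origin\<close>. Superlinear growth comes from
  the quadratic Taylor term if \<alpha> > 1/2, and from the power q = 1/(1 - 2 \<alpha>) if \<alpha>
  < 1/2. There \<alpha> > 0 means q > 1, which also makes the second derivative positive.\<close>

lemma F_fun_shape:
  assumes "0 < \<alpha>" "\<alpha> \<noteq> 1/2"
  obtains F' F'' y0 where
    "\<And>y. ((\<lambda>y. F_fun y \<alpha>) has_real_derivative F' y) (at y)" "\<And>y. (F' has_real_derivative F'' y) (at y)"
    "\<And>y. 0 < F_fun y \<alpha>" "\<And>y. 0 < F' y" "\<And>y. 0 < F'' y" "1 < y0" "F_fun 1 \<alpha> * y0 \<le> F_fun y0 \<alpha>"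
proof (cases "1/2 < \<alpha>")
  case True
  define \<kappa> where "\<kappa> = 2 * \<alpha> - 1"
  define p where "p = 1 / \<kappa>"
  define k where "k = sqrt \<kappa>"
  define c where "c = 1 / (k * gm_coeff p 1)"
  have \<kappa>: "0 < \<kappa>" using True by (simp add: \<kappa>_def)
  have p: "0 < p" using \<kappa> by (simp add: p_def)
  have k: "0 < k" using \<kappa> by (simp add: k_def)
  have c: "0 < c" using k gm_coeff_pos[OF p, of 1] by (simp add: c_def)
  have F: "F_fun y \<alpha> = c * gauss_mellin p (k * y)" for y
    using F_fun_gauss_mellin[OF True, of y] by (simp add: c_def k_def p_def \<kappa>_def)
  have D: "((\<lambda>y. gauss_mellin r (k * y)) has_real_derivative gauss_mellin (r + 1) (k * y) * k) (at y)" if "0 < r" for r y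
    by (rule DERIV_chain2[OF DERIV_gauss_mellin[OF that]]) (auto intro!: derivative_eq_intros)
  have lower: "c * gm_coeff p 2 * k\<^sup>2 * y\<^sup>2 \<le> F_fun y \<alpha>" if "0 \<le> y" for y
  proof -
    have "sum (\<lambda>n. gm_coeff p n * (k * y) ^ n) {2} \<le> (\<Sum>n. gm_coeff p n * (k * y) ^ n)"
      using sums_summable[OF gauss_mellin_sums[OF p]] gm_coeff_pos[OF p] k that
      by (intro sum_le_suminf) (auto intro!: mult_nonneg_nonneg less_imp_le[OF gm_coeff_pos[OF p]])
    then have "gm_coeff p 2 * (k * y)\<^sup>2 \<le> gauss_mellin p (k * y)" by (simp add: gauss_mellin_def)
    from mult_left_mono[OF this, of c] show ?thesis
      using c by (simp add: F power_mult_distrib ac_simps)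
  qed
  define b where "b = c * gm_coeff p 2 * k\<^sup>2"
  have b: "0 < b" unfolding b_def using c k gm_coeff_pos[OF p, of 2] by simp
  \<comment> \<open>As F is at least b y^2, it suffices that \<open>b * y0\<close> \<ge>
    \<open>F_fun 1 \<alpha>\<close>; the maximum with 2 secures y0 > 1.\<close>
  define y0 where "y0 = max 2 (F_fun 1 \<alpha> / b)"
  show thesis
  proof (rule that)
    show "((\<lambda>y. F_fun y \<alpha>) has_real_derivative c * (gauss_mellin (p + 1) (k * y) * k)) (at y)" for y
      unfolding F by (intro DERIV_cmult D p)
    show "((\<lambda>y. c * (gauss_mellin (p + 1) (k * y) * k)) has_real_derivative c * (gauss_mellin (p + 1 + 1) (k * y) * k * k)) (at y)" for y
      using p by (intro DERIV_cmult DERIV_cmult_right D) auto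
    show "0 < F_fun y \<alpha>" "0 < c * (gauss_mellin (p + 1) (k * y) * k)" "0 < c * (gauss_mellin (p + 1 + 1) (k * y) * k * k)" for y
      using c k p by (auto simp: F intro!: mult_pos_pos gauss_mellin_pos)
    show "1 < y0" by (simp add: y0_def)
    have "F_fun 1 \<alpha> / b \<le> y0" by (simp add: y0_def)
    then have "F_fun 1 \<alpha> \<le> b * y0" using b by (simp add: pos_divide_le_eq mult.commute)
    then have "F_fun 1 \<alpha> * y0 \<le> b * y0 * y0" by (rule mult_right_mono) (simp add: y0_def)
    also have "\<dots> \<le> F_fun y0 \<alpha>" using lower[of y0] by (simp add: b_def power2_eq_square y0_def ac_simps)
    finally show "F_fun 1 \<alpha> * y0 \<le> F_fun y0 \<alpha>" .
  qed
next
  case False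
  then have lt: "\<alpha> < 1/2" using assms by simp
  define \<kappa> where "\<kappa> = 1 - 2 * \<alpha>"
  define q where "q = 1 / \<kappa>"
  define k where "k = sqrt \<kappa>"
  define c where "c = 1 / (k * gm_coeff (q + 1) 1)"
  have \<kappa>: "0 < \<kappa>" "\<kappa> < 1" using lt assms by (auto simp: \<kappa>_def)
  have q: "1 < q" using \<kappa> by (simp add: q_def)
  have k: "0 < k" using \<kappa> by (simp add: k_def)
  have c: "0 < c" using k q gm_coeff_pos[of "q + 1" 1] by (simp add: c_def)
  have F: "F_fun y \<alpha> = c * gauss_power q (k * y)" for y
    using F_fun_gauss_power[OF assms(1) lt, of y] by (simp add: c_def k_def q_def \<kappa>_def)
  have D: "((\<lambda>y. gauss_power r (k * y)) has_real_derivative r * gauss_power (r - 1) (k * y) * k) (at y)" if "0 < r" for r y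
    by (rule DERIV_chain2[OF DERIV_gauss_power[OF that]]) (auto intro!: derivative_eq_intros)
  define b where "b = c * exp (- 1 / 2) * k powr q"
  have b: "0 < b" unfolding b_def using c k by simp
  have lower: "b * y powr q \<le> F_fun y \<alpha>" if "0 < y" for y
  proof -
    have "exp (- 1 / 2) * (k * y) powr q \<le> gauss_power q (k * y)"
      using q k that by (intro gauss_power_ge) auto
    from mult_left_mono[OF this, of c] show ?thesis
      using c k that by (simp add: F b_def powr_mult ac_simps)
  qed
  \<comment> \<open>As F is at least b y^q, it suffices that b y0^(q - 1) \<ge>
    \<open>F_fun 1 \<alpha>\<close>.\<close>
  define y0 where "y0 = max 2 ((F_fun 1 \<alpha> / b) powr (1 / (q - 1)))"
  have F1: "0 < F_fun 1 \<alpha>" using c q by (auto simp: F intro!: mult_pos_pos gauss_power_pos)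
  show thesis
  proof (rule that)
    show "((\<lambda>y. F_fun y \<alpha>) has_real_derivative c * (q * gauss_power (q - 1) (k * y) * k)) (at y)" for y
      unfolding F using q by (intro DERIV_cmult D) auto
    show "((\<lambda>y. c * (q * gauss_power (q - 1) (k * y) * k)) has_real_derivative
        c * (q * ((q - 1) * gauss_power (q - 1 - 1) (k * y) * k) * k)) (at y)" for y
      using q by (intro DERIV_cmult DERIV_cmult_right D) auto
    show "0 < F_fun y \<alpha>" "0 < c * (q * gauss_power (q - 1) (k * y) * k)"
      "0 < c * (q * ((q - 1) * gauss_power (q - 1 - 1) (k * y) * k) * k)" for y
      using c k q by (auto simp: F intro!: mult_pos_pos gauss_power_pos)
    show "1 < y0" by (simp add: y0_def)
    have "(F_fun 1 \<alpha> / b) powr (1 / (q - 1)) \<le> y0" by (simp add: y0_def)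
    then have "((F_fun 1 \<alpha> / b) powr (1 / (q - 1))) powr (q - 1) \<le> y0 powr (q - 1)"
      using q by (intro powr_mono2) auto
    then have "F_fun 1 \<alpha> / b \<le> y0 powr (q - 1)" using q b F1 by (simp add: powr_powr)
    then have "F_fun 1 \<alpha> \<le> b * y0 powr (q - 1)" using b by (simp add: pos_divide_le_eq mult.commute)
    then have "F_fun 1 \<alpha> * y0 \<le> b * y0 powr (q - 1) * y0" by (rule mult_right_mono) (simp add: y0_def)
    also have "\<dots> = b * y0 powr q" using powr_add[of y0 "q - 1" 1] by (simp add: y0_def)
    also have "\<dots> \<le> F_fun y0 \<alpha>" by (rule lower) (simp add: y0_def)
    finally show "F_fun 1 \<alpha> * y0 \<le> F_fun y0 \<alpha>" .
  qed
qed

lemma B_bound_C_coeff: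
  assumes "0 < \<alpha>" "\<alpha> \<noteq> 1/2"
  shows "0 < B_bound \<alpha>" "0 < C_coeff \<alpha>" "C_coeff \<alpha> * F_fun (B_bound \<alpha>) \<alpha> = B_bound \<alpha>"
    "y \<le> C_coeff \<alpha> * F_fun y \<alpha>" "mono (\<lambda>y. F_fun y \<alpha>)" "0 < F_fun y \<alpha>" "continuous_on UNIV (\<lambda>y. F_fun y \<alpha>)"
proof -
  obtain F' F'' y0 where F:
    "\<And>y. ((\<lambda>y. F_fun y \<alpha>) has_real_derivative F' y) (at y)" "\<And>y. (F' has_real_derivative F'' y) (at y)"
    "\<And>y. 0 < F_fun y \<alpha>" "\<And>y. 0 < F' y" "\<And>y. 0 < F'' y" "1 < y0" "F_fun 1 \<alpha> * y0 \<le> F_fun y0 \<alpha>"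
    by (rule F_fun_shape[OF assms]) blast
  note ex1 = tangent_point_ex1[OF F] and below = tangent_below[OF F]
  have "B_bound \<alpha> = (THE B. 0 < B \<and> B = F_fun B \<alpha> / F' B)"
    using assms DERIV_imp_deriv[OF F(1)] by (simp add: B_bound_def)
  with theI'[OF ex1] have B: "0 < B_bound \<alpha>" "B_bound \<alpha> = F_fun (B_bound \<alpha>) \<alpha> / F' (B_bound \<alpha>)"
    by auto
  have C: "C_coeff \<alpha> = B_bound \<alpha> / F_fun (B_bound \<alpha>) \<alpha>"
    unfolding C_coeff_def by (rule the_equality) (use F(3)[of "B_bound \<alpha>"] in \<open>auto simp: field_simps\<close>)
  show "0 < B_bound \<alpha>" by (rule B(1))
  show "0 < C_coeff \<alpha>" using B(1) F(3) by (simp add: C)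
  show "C_coeff \<alpha> * F_fun (B_bound \<alpha>) \<alpha> = B_bound \<alpha>" using F(3)[of "B_bound \<alpha>"] by (simp add: C)
  show "y \<le> C_coeff \<alpha> * F_fun y \<alpha>" unfolding C by (rule below[OF B(2,1)])
  show "mono (\<lambda>y. F_fun y \<alpha>)" by (rule tangent_mono[OF F])
  show "0 < F_fun y \<alpha>" by (rule F(3))
  show "continuous_on UNIV (\<lambda>y. F_fun y \<alpha>)"
    by (rule DERIV_continuous_on) (use F(1) in \<open>auto intro: has_field_derivative_at_within\<close>)
qed

text \<open>With \<open>n = (1 - t)\<^sup>-\<^sup>\<alpha> x\<close> this is \<open>sqrt (1 - t) f (x / sqrt (1 - t))\<close>; the maximum only ensures
  nonnegativity for \<open>t > 1\<close>.\<close>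

definition self_similar :: "real \<Rightarrow> (real \<Rightarrow> real) \<Rightarrow> real \<Rightarrow> real \<Rightarrow> real" where
  "self_similar \<alpha> f t n = sqrt (max 0 (1 - t)) * f ((1 - t) powr (\<alpha> - 1/2) * n)"

text \<open>Passes from the self-similar form to a family \<open>G\<close> written with the variance
  parameter of the Gaussian integrals; \<open>c\<close> absorbs the constants.\<close>

lemma heat_martingale_self_similar:
  assumes cont: "continuous_on UNIV f" and nonneg: "\<And>y. 0 \<le> f y" and c: "0 \<le> c"
    and meas: "\<And>t. G t \<in> borel_measurable borel"
    and eq: "\<And>t n. t < 1 \<Longrightarrow> sqrt (1 - t) * f ((1 - t) powr (\<alpha> - 1/2) * n) = c * G t n"
    and heat: "\<And>s t n. 0 \<le> s \<Longrightarrow> s < t \<Longrightarrow> t < 1 \<Longrightarrow>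
       gauss_mean (sqrt (clock \<alpha> t - clock \<alpha> s)) (\<lambda>d. ennreal (G t (n + d)))
        = ennreal (G s n)"
  shows "heat_martingale \<alpha> (self_similar \<alpha> f)"
proof -
  note [measurable] = meas
  have "continuous_on ({0..<1} \<times> UNIV) (\<lambda>z. sqrt (max 0 (1 - fst z)) * f ((1 - fst z) powr (\<alpha> - 1/2) * snd z))"
    by (intro continuous_intros continuous_on_compose2[OF cont]) auto
  moreover have "gauss_mean (sqrt (clock \<alpha> t - clock \<alpha> s))
      (\<lambda>d. ennreal (self_similar \<alpha> f t (n + d))) = ennreal (self_similar \<alpha> f s n)"
    if st: "0 \<le> s" "s < t" "t < 1" for s t n
  proof -
    have G: "self_similar \<alpha> f t n = c * G t n" if "t < 1" for t n
      using eq[OF that] that by (simp add: self_similar_def)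
    have "gauss_mean (sqrt (clock \<alpha> t - clock \<alpha> s)) (\<lambda>d. ennreal (self_similar \<alpha> f t (n + d)))
      = ennreal c * gauss_mean (sqrt (clock \<alpha> t - clock \<alpha> s)) (\<lambda>d. ennreal (G t (n + d)))"
      unfolding G[OF st(3)] using c by (simp add: ennreal_mult' mult.left_commute nn_integral_cmult)
    then show ?thesis using heat[OF st, of n] st c by (simp add: G ennreal_mult')
  qed
  ultimately show ?thesis
    by (auto simp: heat_martingale_def self_similar_def nonneg case_prod_beta)
qed

lemma continuous_on_gauss_mellin: "0 < p \<Longrightarrow> continuous_on UNIV (gauss_mellin p)"
  by (rule DERIV_continuous_on) (auto intro: has_field_derivative_at_within DERIV_gauss_mellin)

lemma heat_martingale_gauss_mellin:
  assumes "1/2 < \<alpha>" and r: "0 \<le> r"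
  defines "\<kappa> \<equiv> 2 * \<alpha> - 1"
  shows "heat_martingale \<alpha> (self_similar \<alpha> (\<lambda>y. r * gauss_mellin (1 / \<kappa>) (sqrt \<kappa> * y)))"
proof -
  define p where "p = 1 / \<kappa>"
  \<comment> \<open>The clock shifted by 1/\<kappa>. This shift makes \<open>w t\<close> a pure
    multiple of a power of 1 - t, as self-similarity requires.\<close>
  define w where "w t = (1 - t) powr (- \<kappa>) / \<kappa>" for t
  have \<kappa>: "0 < \<kappa>" using assms by (simp add: \<kappa>_def)
  have p: "0 < p" using \<kappa> by (simp add: p_def)
  have eq: "sqrt (1 - t) * (r * gauss_mellin p (sqrt \<kappa> * ((1 - t) powr (\<alpha> - 1/2) * n)))
      = (r * \<kappa> powr (- p / 2)) * (w t powr (- p / 2) * gauss_mellin p (n / sqrt (w t)))" if t: "t < 1" for t n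
  proof -
    have pk: "- \<kappa> * (- p / 2) = 1/2" using \<kappa> by (simp add: p_def)
    have "\<kappa> powr (- p / 2) * w t powr (- p / 2) = (1 - t) powr (1/2)"
      using t \<kappa> by (simp add: w_def powr_divide powr_powr pk[simplified])
    also have "\<dots> = sqrt (1 - t)" using t by (simp add: powr_half_sqrt)
    finally have 1: "\<kappa> powr (- p / 2) * w t powr (- p / 2) = sqrt (1 - t)" .
    have "sqrt ((1 - t) powr (- \<kappa>)) = (1 - t) powr (- \<kappa> / 2)"
      using t by (simp add: powr_half_sqrt[symmetric] powr_powr)
    moreover have "(1 - t) powr (\<alpha> - 1/2) = 1 / (1 - t) powr (- \<kappa> / 2)"
      using powr_minus_divide[of "1 - t" "- \<kappa> / 2"] by (simp add: \<kappa>_def diff_divide_distrib)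
    ultimately have 2: "n / sqrt (w t) = sqrt \<kappa> * ((1 - t) powr (\<alpha> - 1/2) * n)"
      by (simp add: w_def real_sqrt_divide)
    show ?thesis unfolding 2 1[symmetric] by simp
  qed
  have w_pos: "0 < w t" if "t < 1" for t using that \<kappa> by (simp add: w_def)
  have w_diff: "w s + (clock \<alpha> t - clock \<alpha> s) = w t" for s t
  proof -
    have e: "1 - 2 * \<alpha> = - \<kappa>" by (simp add: \<kappa>_def)
    have "clock \<alpha> u = w u - 1 / \<kappa>" for u
      using assms(1) unfolding clock_def e w_def by (simp add: diff_divide_distrib)
    then show ?thesis by simp
  qed
  have cont: "continuous_on UNIV (\<lambda>y. r * gauss_mellin p (sqrt \<kappa> * y))"
    by (intro continuous_on_compose2[OF continuous_on_gauss_mellin[OF p]] continuous_intros) auto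
  have [measurable]: "gauss_mellin p \<in> borel_measurable borel"
    by (rule borel_measurable_continuous_onI[OF continuous_on_gauss_mellin[OF p]])
  show ?thesis
    unfolding p_def[symmetric]
  proof (rule heat_martingale_self_similar[OF cont _ _ _ eq])
    show "0 \<le> r * gauss_mellin p (sqrt \<kappa> * y)" for y
      using r less_imp_le[OF gauss_mellin_pos[OF p]] by (rule mult_nonneg_nonneg)
    fix s t n :: real assume st: "0 \<le> s" "s < t" "t < 1"
    have "0 < clock \<alpha> t - clock \<alpha> s" using clock_strict_mono[OF st(2,3)] by simp
    from gauss_mellin_heat[OF p w_pos this, of s n] st
    show "gauss_mean (sqrt (clock \<alpha> t - clock \<alpha> s))
          (\<lambda>d. ennreal (w t powr (- p / 2) * gauss_mellin p ((n + d) / sqrt (w t))))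
        = ennreal (w s powr (- p / 2) * gauss_mellin p (n / sqrt (w s)))"
      unfolding w_diff by simp
  qed (use r in auto)
qed

lemma continuous_on_gauss_power: "0 < q \<Longrightarrow> continuous_on UNIV (gauss_power q)"
  by (rule DERIV_continuous_on) (auto intro: has_field_derivative_at_within DERIV_gauss_power)

lemma heat_martingale_gauss_power:
  assumes "\<alpha> < 1/2" and r: "0 \<le> r"
  defines "\<kappa> \<equiv> 1 - 2 * \<alpha>"
  shows "heat_martingale \<alpha> (self_similar \<alpha> (\<lambda>y. r * gauss_power (1 / \<kappa>) (sqrt \<kappa> * y)))"
proof -
  define q where "q = 1 / \<kappa>"
  \<comment> \<open>The total clock 1/\<kappa> minus the clock at \<open>t\<close>: the variance of
    \<open>N\<close> that remains until time 1.\<close>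
  define w where "w t = (1 - t) powr \<kappa> / \<kappa>" for t
  have \<kappa>: "0 < \<kappa>" using assms by (simp add: \<kappa>_def)
  have q: "0 < q" using \<kappa> by (simp add: q_def)
  have q': "-1 < q" using q by simp
  have eq: "sqrt (1 - t) * (r * gauss_power q (sqrt \<kappa> * ((1 - t) powr (\<alpha> - 1/2) * n)))
      = (r * sqrt (2 * pi) * \<kappa> powr (q / 2)) * (w t powr (q / 2) * gauss_power q (n / sqrt (w t)) / sqrt (2 * pi))" if t: "t < 1" for t n
  proof -
    have pk: "\<kappa> * (q / 2) = 1/2" using \<kappa> by (simp add: q_def)
    have "\<kappa> powr (q / 2) * w t powr (q / 2) = (1 - t) powr (1/2)"
      using t \<kappa> by (simp add: w_def powr_divide powr_powr pk[simplified])
    also have "\<dots> = sqrt (1 - t)" using t by (simp add: powr_half_sqrt)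
    finally have 1: "\<kappa> powr (q / 2) * w t powr (q / 2) = sqrt (1 - t)" .
    have "sqrt ((1 - t) powr \<kappa>) = (1 - t) powr (\<kappa> / 2)"
      using t by (simp add: powr_half_sqrt[symmetric] powr_powr)
    moreover have "(1 - t) powr (\<alpha> - 1/2) = 1 / (1 - t) powr (\<kappa> / 2)"
      using powr_minus_divide[of "1 - t" "\<kappa> / 2"] by (simp add: \<kappa>_def diff_divide_distrib)
    ultimately have 2: "n / sqrt (w t) = sqrt \<kappa> * ((1 - t) powr (\<alpha> - 1/2) * n)"
      by (simp add: w_def real_sqrt_divide)
    show ?thesis unfolding 2 1[symmetric] by simp
  qed
  have w_pos: "0 < w t" if "t < 1" for t using that \<kappa> by (simp add: w_def)
  have w_diff: "w t + (clock \<alpha> t - clock \<alpha> s) = w s" for s t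
  proof -
    have "clock \<alpha> u = 1 / \<kappa> - w u" for u
      using assms(1) unfolding clock_def \<kappa>_def[symmetric] w_def by (simp add: diff_divide_distrib)
    then show ?thesis by simp
  qed
  have cont: "continuous_on UNIV (\<lambda>y. r * gauss_power q (sqrt \<kappa> * y))"
    by (intro continuous_on_compose2[OF continuous_on_gauss_power[OF q]] continuous_intros) auto
  have [measurable]: "gauss_power q \<in> borel_measurable borel"
    by (rule borel_measurable_continuous_onI[OF continuous_on_gauss_power[OF q]])
  show ?thesis
    unfolding q_def[symmetric]
  proof (rule heat_martingale_self_similar[OF cont _ _ _ eq])
    show "0 \<le> r * gauss_power q (sqrt \<kappa> * y)" for y
      using r less_imp_le[OF gauss_power_pos[OF q']] by (rule mult_nonneg_nonneg)
    fix s t n :: real assume st: "0 \<le> s" "s < t" "t < 1"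
    have "0 < clock \<alpha> t - clock \<alpha> s" using clock_strict_mono[OF st(2,3)] by simp
    from gauss_power_heat[OF q' w_pos[OF st(3)] this, of n]
    show "gauss_mean (sqrt (clock \<alpha> t - clock \<alpha> s))
          (\<lambda>d. ennreal (w t powr (q / 2) * gauss_power q ((n + d) / sqrt (w t)) / sqrt (2 * pi)))
        = ennreal (w s powr (q / 2) * gauss_power q (n / sqrt (w s)) / sqrt (2 * pi))"
      unfolding w_diff .
  qed (use r in auto)
qed

lemma nn_integral_normal_density_exp_shift:
  assumes "0 < \<delta>" "0 \<le> c"
  shows "gauss_mean (sqrt \<delta>) (\<lambda>d. ennreal (c * exp (r * (n + d))))
    = ennreal (c * exp (r * n) * exp (r\<^sup>2 * \<delta> / 2))"
proof -
  have "ennreal (normal_density 0 (sqrt \<delta>) d) * ennreal (c * exp (r * (n + d)))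
      = ennreal (c * exp (r * n)) * (ennreal (normal_density 0 (sqrt \<delta>) d) * ennreal (exp (r * d)))" for d
    using assms by (simp add: distrib_left exp_add ennreal_mult' mult.left_commute mult.assoc)
  then show ?thesis
    using assms nn_integral_normal_density_exp[of "sqrt \<delta>" r]
    by (simp add: nn_integral_cmult ennreal_mult' mult.assoc)
qed

text \<open>For \<alpha> = 1/2 the argument of \<open>f\<close> in \<open>self_similar\<close> is
  \<open>N t\<close> itself, and the process is a geometric Brownian motion with clock - ln (1 - t).
  The shift by 1 makes the diagonal the tangent at the boundary point 1.\<close>

lemma heat_martingale_exp_half: "heat_martingale (1/2) (self_similar (1/2) (\<lambda>y. exp (y - 1)))"
proof (rule heat_martingale_self_similar[where c = "exp (- 1)" and G = "\<lambda>t n. sqrt (1 - t) * exp (1 * n)"])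
  show "continuous_on UNIV (\<lambda>y::real. exp (y - 1))" by (intro continuous_intros)
  show "sqrt (1 - t) * exp ((1 - t) powr (1/2 - 1/2) * n - 1) = exp (- 1) * (sqrt (1 - t) * exp (1 * n))"
    if "t < 1" for t n :: real
    using that by (simp add: mult.left_commute flip: exp_add)
  fix s t n :: real assume st: "0 \<le> s" "s < t" "t < 1"
  let ?\<delta> = "clock (1/2) t - clock (1/2) s"
  have \<delta>: "0 < ?\<delta>" using clock_strict_mono[OF st(2,3)] by simp
  have "?\<delta> / 2 = ln (sqrt ((1 - s) / (1 - t)))"
    using st by (simp add: clock_def ln_sqrt ln_div)
  then have e: "exp (?\<delta> / 2) = sqrt ((1 - s) / (1 - t))" using st by simp
  have "gauss_mean (sqrt ?\<delta>) (\<lambda>d. ennreal (sqrt (1 - t) * exp (1 * (n + d))))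
     = ennreal (sqrt (1 - t) * exp (1 * n) * exp (1\<^sup>2 * ?\<delta> / 2))"
    using st by (intro nn_integral_normal_density_exp_shift[OF \<delta>]) auto
  also have "sqrt (1 - t) * exp (1 * n) * exp (1\<^sup>2 * ?\<delta> / 2) = (sqrt (1 - t) * sqrt ((1 - s) / (1 - t))) * exp (1 * n)"
    using e by simp
  also have "sqrt (1 - t) * sqrt ((1 - s) / (1 - t)) = sqrt (1 - s)"
    using st by (simp flip: real_sqrt_mult)
  finally show "gauss_mean (sqrt ?\<delta>) (\<lambda>d. ennreal (sqrt (1 - t) * exp (1 * (n + d))))
      = ennreal (sqrt (1 - s) * exp (1 * n))" .
qed auto

text \<open>The exponential martingale of Brownian motion times exp (r^2/2). With this constant the
  factor of exp (r n) is at least 1 up to time 1.\<close>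

lemma heat_martingale_exp_0: "heat_martingale 0 (\<lambda>t n. exp (r\<^sup>2 * (1 - t) / 2) * exp (r * n))"
  unfolding heat_martingale_def
proof (intro conjI allI impI)
  show "continuous_on ({0..<1} \<times> UNIV) (\<lambda>(t, n). exp (r\<^sup>2 * (1 - t) / 2) * exp (r * n))"
    by (auto simp: case_prod_beta intro!: continuous_intros)
  fix s t n :: real assume st: "0 \<le> s" "s < t" "t < 1"
  have \<delta>: "clock 0 t - clock 0 s = t - s" using st by (simp add: clock_def)
  show "gauss_mean (sqrt (clock 0 t - clock 0 s))
        (\<lambda>d. ennreal (exp (r\<^sup>2 * (1 - t) / 2) * exp (r * (n + d)))) = ennreal (exp (r\<^sup>2 * (1 - s) / 2) * exp (r * n))"
    unfolding \<delta> using st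
    by (subst nn_integral_normal_density_exp_shift)
      (auto simp: algebra_simps add_divide_distrib diff_divide_distrib simp flip: exp_add)
qed auto

section \<open>The optimal stopping problem\<close>

context alpha_brownian_bridge
begin

text \<open>Times below 1 that tend to 1. The denominator m + 2 keeps already the first one
  positive, as \<open>optional_stopping\<close> demands.\<close>

definition trunc :: "nat \<Rightarrow> real" where
  "trunc m = 1 - 1 / real (m + 2)"

lemma trunc_bounds: "0 < trunc m" "trunc m < 1"
  by (auto simp: trunc_def divide_less_eq)

lemma trunc_tendsto: "trunc \<longlonglongrightarrow> 1"
proof -
  have "(\<lambda>m. 1 - 1 / real (m + 2)) \<longlonglongrightarrow> 1 - 0"
    by (intro tendsto_diff tendsto_const LIMSEQ_ignore_initial_segment[OF lim_1_over_n])
  then show ?thesis by (simp add: trunc_def[abs_def])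
qed

lemma min_trunc_eventually:
  assumes "t < 1"
  shows "\<forall>\<^sub>F m in sequentially. min t (trunc m) = t"
  using order_tendstoD(1)[OF trunc_tendsto assms] by eventually_elim simp

lemma min_trunc_tendsto:
  assumes "t \<le> 1"
  shows "(\<lambda>m. min t (trunc m)) \<longlonglongrightarrow> t"
  using tendsto_min[OF tendsto_const[of t] trunc_tendsto] assms by (simp add: min_def)

lemma admissibleD:
  assumes "\<tau> \<in> admissible_times M W"
  shows "stopping_time (natural_filtration M W) \<tau>" "\<And>\<omega>. \<omega> \<in> space M \<Longrightarrow> 0 \<le> \<tau> \<omega> \<and> \<tau> \<omega> \<le> 1"
  using assms by (auto simp: admissible_times_def)

lemma admissible_trunc:
  assumes "\<tau> \<in> admissible_times M W"
  shows "stopping_time (natural_filtration M W) (\<lambda>\<omega>. min (\<tau> \<omega>) (trunc m))"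
    "\<And>\<omega>. \<omega> \<in> space M \<Longrightarrow> 0 \<le> min (\<tau> \<omega>) (trunc m) \<and> min (\<tau> \<omega>) (trunc m) \<le> trunc m"
  using admissibleD[OF assms] trunc_bounds(1)[of m]
  by (auto intro!: stopping_time_min stopping_time_const less_imp_le)

lemma stopped_trunc_measurable:
  fixes U :: "real \<Rightarrow> 'a \<Rightarrow> real"
  assumes "\<tau> \<in> admissible_times M W"
    and "\<And>t. 0 \<le> t \<Longrightarrow> t < 1 \<Longrightarrow> U t \<in> borel_measurable M"
    and "\<And>\<omega>. \<omega> \<in> space M \<Longrightarrow> continuous_on {0..<1} (\<lambda>t. U t \<omega>)"
  shows "(\<lambda>\<omega>. U (min (\<tau> \<omega>) (trunc m)) \<omega>) \<in> borel_measurable M"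
  by (rule stopped_process_measurable[OF admissible_trunc[OF assms(1)] trunc_bounds assms(2,3)])

text \<open>Continuity of the paths is assumed on [0, 1) only, so the event where
  \<open>\<tau>\<close> equals 1 is treated separately with the prescribed value
  \<open>X 1\<close>.\<close>

lemma X_stopped_measurable:
  assumes \<tau>: "\<tau> \<in> admissible_times M W"
  shows "(\<lambda>\<omega>. X (\<tau> \<omega>) \<omega>) \<in> borel_measurable M"
proof (rule borel_measurable_LIMSEQ_real)
  have [measurable]: "\<tau> \<in> borel_measurable M"
    by (rule admissible_times_measurable[OF admissibleD(1)[OF \<tau>]])
  have X1: "X 1 \<in> borel_measurable M"
  proof (cases "\<alpha> = 0")
    case True
    then have "X 1 \<omega> = W 1 \<omega>" if "\<omega> \<in> space M" for \<omega> using X_one[OF that] by simp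
    then show ?thesis using W_measurable[of 1] by (subst measurable_cong[where g = "W 1"]) auto
  next
    case False
    then have "X 1 \<omega> = 0" if "\<omega> \<in> space M" for \<omega> using X_one[OF that] by simp
    then show ?thesis by (subst measurable_cong[where g = "\<lambda>_. 0"]) auto
  qed
  let ?V = "\<lambda>m \<omega>. if \<tau> \<omega> < 1 then X (min (\<tau> \<omega>) (trunc m)) \<omega> else X 1 \<omega>"
  show "?V m \<in> borel_measurable M" for m
    by (rule measurable_If[OF stopped_trunc_measurable[OF \<tau> X_measurable X_continuous] X1]) auto
  show "(\<lambda>m. ?V m \<omega>) \<longlonglongrightarrow> X (\<tau> \<omega>) \<omega>" if "\<omega> \<in> space M" for \<omega>
  proof (cases "\<tau> \<omega> < 1")
    case True
    show ?thesis
      by (rule tendsto_eventually) (use min_trunc_eventually[OF True] True in \<open>auto elim: eventually_mono\<close>)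
  next
    case False
    then have "\<tau> \<omega> = 1" using admissibleD(2)[OF \<tau> that] by simp
    then show ?thesis by simp
  qed
qed

lemma AE_X_zero: "AE \<omega> in M. X 0 \<omega> = 0"
  using AE_N_zero by eventually_elim (simp add: N_def)

lemma integrable_of_nn_integral:
  fixes Z :: "'a \<Rightarrow> real"
  assumes [measurable]: "Z \<in> borel_measurable M"
    and "(\<integral>\<^sup>+\<omega>. ennreal (Z \<omega>) \<partial>M) \<le> ennreal a" "(\<integral>\<^sup>+\<omega>. ennreal (- Z \<omega>) \<partial>M) \<le> ennreal b"
  shows "integrable M Z"
proof (rule integrableI_bounded)
  have "(\<integral>\<^sup>+\<omega>. ennreal (norm (Z \<omega>)) \<partial>M) = (\<integral>\<^sup>+\<omega>. ennreal (Z \<omega>) + ennreal (- Z \<omega>) \<partial>M)"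
    by (intro nn_integral_cong) (auto simp: abs_if ennreal_neg)
  also have "\<dots> \<le> ennreal a + ennreal b"
    using assms(2,3) by (subst nn_integral_add) (auto intro: add_mono)
  also have "\<dots> < \<infinity>" by simp
  finally show "(\<integral>\<^sup>+\<omega>. ennreal (norm (Z \<omega>)) \<partial>M) < \<infinity>" .
qed simp

lemma integral_le_of_nn_integral:
  fixes Z :: "'a \<Rightarrow> real"
  assumes "integrable M Z" "(\<integral>\<^sup>+\<omega>. ennreal (Z \<omega>) \<partial>M) \<le> ennreal a" "0 \<le> a"
  shows "(\<integral>\<omega>. Z \<omega> \<partial>M) \<le> a"
proof -
  have "(\<integral>\<omega>. Z \<omega> \<partial>M) \<le> (\<integral>\<omega>. max 0 (Z \<omega>) \<partial>M)"
    using assms(1) by (intro integral_mono) auto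
  also have "\<dots> \<le> a"
  proof -
    have "ennreal (\<integral>\<omega>. max 0 (Z \<omega>) \<partial>M) = (\<integral>\<^sup>+\<omega>. ennreal (max 0 (Z \<omega>)) \<partial>M)"
      using assms(1) by (intro nn_integral_eq_integral[symmetric]) auto
    also have "\<dots> = (\<integral>\<^sup>+\<omega>. ennreal (Z \<omega>) \<partial>M)"
      by (intro nn_integral_cong) (simp add: max_def ennreal_neg)
    also have "\<dots> \<le> ennreal a" by (rule assms(2))
    finally show ?thesis by (simp only: ennreal_le_iff[OF assms(3)])
  qed
  finally show ?thesis .
qed

end

section \<open>Domination of the stopped bridge by a martingale\<close>

context bridge_martingale
begin

lemma nn_integral_liminf_Y_le:
  assumes \<tau>: "\<tau> \<in> admissible_times M W"
  shows "(\<integral>\<^sup>+\<omega>. liminf (\<lambda>m. ennreal (Y (min (\<tau> \<omega>) (trunc m)) \<omega>)) \<partial>M) \<le> ennreal (H 0 0)"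
proof -
  have [measurable]: "(\<lambda>\<omega>. Y (min (\<tau> \<omega>) (trunc m)) \<omega>) \<in> borel_measurable M" for m
    by (rule stopped_trunc_measurable[OF \<tau> Y_measurable Y_continuous])
  have "(\<integral>\<^sup>+\<omega>. liminf (\<lambda>m. ennreal (Y (min (\<tau> \<omega>) (trunc m)) \<omega>)) \<partial>M)
      \<le> liminf (\<lambda>m. \<integral>\<^sup>+\<omega>. ennreal (Y (min (\<tau> \<omega>) (trunc m)) \<omega>) \<partial>M)"
    by (rule nn_integral_liminf) measurable
  also have "\<dots> \<le> liminf (\<lambda>m::nat. ennreal (H 0 0))"
    by (intro Liminf_mono always_eventually allI optional_stopping_le[OF admissible_trunc[OF \<tau>] trunc_bounds])
  also have "\<dots> = ennreal (H 0 0)" by (simp add: Liminf_const)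
  finally show ?thesis .
qed

text \<open>Where \<open>\<tau>\<close> equals 1 the lower limit in Fatou's lemma is merely known to
  be nonnegative; hence the requirement \<open>Z \<omega>\<close> \<le> 0 there.\<close>

lemma nn_integral_le_of_dominated:
  assumes \<tau>: "\<tau> \<in> admissible_times M W"
    and dom: "\<And>\<omega>. \<omega> \<in> space M \<Longrightarrow> \<tau> \<omega> < 1 \<Longrightarrow> Z \<omega> \<le> Y (\<tau> \<omega>) \<omega>"
      "\<And>\<omega>. \<omega> \<in> space M \<Longrightarrow> \<tau> \<omega> = 1 \<Longrightarrow> Z \<omega> \<le> 0"
  shows "(\<integral>\<^sup>+\<omega>. ennreal (Z \<omega>) \<partial>M) \<le> ennreal (H 0 0)"
proof (rule order_trans[OF nn_integral_mono nn_integral_liminf_Y_le[OF \<tau>]])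
  fix \<omega> assume w: "\<omega> \<in> space M"
  show "ennreal (Z \<omega>) \<le> liminf (\<lambda>m. ennreal (Y (min (\<tau> \<omega>) (trunc m)) \<omega>))"
  proof (cases "\<tau> \<omega> < 1")
    case True
    have "(\<lambda>m. ennreal (Y (min (\<tau> \<omega>) (trunc m)) \<omega>)) \<longlonglongrightarrow> ennreal (Y (\<tau> \<omega>) \<omega>)"
      by (rule tendsto_eventually) (use min_trunc_eventually[OF True] in \<open>auto elim: eventually_mono\<close>)
    from lim_imp_Liminf[OF _ this] dom(1)[OF w True] show ?thesis by (simp add: ennreal_leI)
  next
    case False
    then have "\<tau> \<omega> = 1" using admissibleD(2)[OF \<tau> w] by simp
    then show ?thesis using dom(2)[OF w] by (simp add: ennreal_neg)
  qed
qed

end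

context alpha_brownian_bridge
begin

lemma self_similar_N:
  assumes "t < 1"
  shows "self_similar \<alpha> f t (N t \<omega>) = sqrt (1 - t) * f (X t \<omega> / sqrt (1 - t))"
proof -
  have "(1 - t) powr (\<alpha> - 1/2) * N t \<omega> = X t \<omega> / sqrt (1 - t)"
    using assms by (simp add: N_def powr_diff powr_half_sqrt)
  then show ?thesis using assms by (simp add: self_similar_def)
qed

lemma self_similar_0: "self_similar \<alpha> f 0 0 = f 0"
  by (simp add: self_similar_def)

text \<open>The reflected martingale bounds the negative part of the stopped value. The stopped
  value is therefore integrable, and its expectation is not a default 0.\<close>

lemma self_similar_majorant:
  assumes f: "heat_martingale \<alpha> (self_similar \<alpha> f)" "\<And>y. 0 \<le> f y" "\<And>y. y \<le> f y" and \<alpha>: "\<alpha> \<noteq> 0"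
    and \<tau>: "\<tau> \<in> admissible_times M W"
  shows majorant_integrable: "integrable M (\<lambda>\<omega>. X (\<tau> \<omega>) \<omega>)"
    and majorant_bound: "stopped_expectation M X \<tau> \<le> f 0"
proof -
  interpret P: bridge_martingale M W \<alpha> X "self_similar \<alpha> f"
    by unfold_locales (rule f(1))
  interpret R: bridge_martingale M W \<alpha> X "\<lambda>t n. self_similar \<alpha> f t (- n)"
    by unfold_locales (rule heat_martingale_reflect[OF f(1)])
  have ge: "x \<le> sqrt (1 - t) * f (x / sqrt (1 - t))" if "t < 1" for x t
  proof -
    have "sqrt (1 - t) * (x / sqrt (1 - t)) \<le> sqrt (1 - t) * f (x / sqrt (1 - t))"
      using that by (intro mult_left_mono f(3)) auto
    then show ?thesis using that by simp
  qed
  have X1: "X 1 \<omega> = 0" if "\<omega> \<in> space M" for \<omega> using X_one[OF that] \<alpha> by simp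
  have pos: "(\<integral>\<^sup>+\<omega>. ennreal (X (\<tau> \<omega>) \<omega>) \<partial>M) \<le> ennreal (f 0)"
    unfolding self_similar_0[of f, symmetric]
    by (rule P.nn_integral_le_of_dominated[OF \<tau>]) (auto simp: P.Y_def self_similar_N X1 ge)
  have neg_N: "self_similar \<alpha> f t (- N t \<omega>) = sqrt (1 - t) * f (- X t \<omega> / sqrt (1 - t))" if "t < 1" for t \<omega>
  proof -
    have "(1 - t) powr (\<alpha> - 1/2) * N t \<omega> = X t \<omega> / sqrt (1 - t)"
      using that by (simp add: N_def powr_diff powr_half_sqrt)
    then have "(1 - t) powr (\<alpha> - 1/2) * - N t \<omega> = - X t \<omega> / sqrt (1 - t)" by simp
    then show ?thesis using that unfolding self_similar_def by simp
  qed
  have neg: "(\<integral>\<^sup>+\<omega>. ennreal (- X (\<tau> \<omega>) \<omega>) \<partial>M) \<le> ennreal (self_similar \<alpha> f 0 (- 0))"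
  proof (intro R.nn_integral_le_of_dominated[OF \<tau>])
    fix \<omega> assume "\<omega> \<in> space M" "\<tau> \<omega> < 1"
    then show "- X (\<tau> \<omega>) \<omega> \<le> R.Y (\<tau> \<omega>) \<omega>"
      unfolding R.Y_def neg_N[OF \<open>\<tau> \<omega> < 1\<close>] by (intro ge)
  qed (auto simp: X1)
  show int: "integrable M (\<lambda>\<omega>. X (\<tau> \<omega>) \<omega>)"
    by (rule integrable_of_nn_integral[OF X_stopped_measurable[OF \<tau>] pos neg])
  show "stopped_expectation M X \<tau> \<le> f 0"
    unfolding stopped_expectation_def by (rule integral_le_of_nn_integral[OF int pos f(2)])
qed

section \<open>The optimal stopping time\<close>

lemma tau_star_bounds:
  assumes "\<alpha> \<noteq> 0" "\<omega> \<in> space M"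
  shows "0 \<le> tau_star \<alpha> X \<omega>" "tau_star \<alpha> X \<omega> \<le> 1"
    and "\<And>t. 0 \<le> t \<Longrightarrow> t < tau_star \<alpha> X \<omega> \<Longrightarrow> X t \<omega> < B_bound \<alpha> * sqrt (1 - t)"
    and "tau_star \<alpha> X \<omega> < 1 \<Longrightarrow> B_bound \<alpha> * sqrt (1 - tau_star \<alpha> X \<omega>) \<le> X (tau_star \<alpha> X \<omega>) \<omega>"
    and "\<And>t. 0 \<le> t \<Longrightarrow> t < 1 \<Longrightarrow> B_bound \<alpha> * sqrt (1 - t) \<le> X t \<omega> \<Longrightarrow> tau_star \<alpha> X \<omega> \<le> t"
proof -
  let ?S = "{t. 0 \<le> t \<and> t \<le> 1 \<and> B_bound \<alpha> * sqrt (1 - t) \<le> X t \<omega>}"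
  let ?\<tau> = "tau_star \<alpha> X \<omega>"
  have X1: "X 1 \<omega> = 0" using X_one[OF assms(2)] assms(1) by simp
  have S1: "1 \<in> ?S" by (simp add: X1)
  have bdd: "bdd_below ?S" by (rule bdd_belowI[of _ 0]) simp
  have \<tau>: "?\<tau> = Inf ?S" by (simp add: tau_star_def)
  have lower: "?\<tau> \<le> t" if "t \<in> ?S" for t unfolding \<tau> by (rule cInf_lower[OF that bdd])
  show nonneg: "0 \<le> ?\<tau>" unfolding \<tau> by (rule cInf_greatest) (use S1 in auto)
  show le1: "?\<tau> \<le> 1" by (rule lower[OF S1])
  show "?\<tau> \<le> t" if "0 \<le> t" "t < 1" "B_bound \<alpha> * sqrt (1 - t) \<le> X t \<omega>" for t
    by (rule lower) (use that in simp)
  show "X t \<omega> < B_bound \<alpha> * sqrt (1 - t)" if "0 \<le> t" "t < ?\<tau>" for t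
  proof (rule ccontr)
    assume "\<not> ?thesis"
    then have "t \<in> ?S" using that le1 by simp
    from lower[OF this] show False using that by simp
  qed
  assume lt: "?\<tau> < 1"
  \<comment> \<open>The infimum is attained: strictly below the boundary, the path would stay below
    it on a neighbourhood, which contradicts points of the set arbitrarily close to the
    infimum.\<close>
  show "B_bound \<alpha> * sqrt (1 - ?\<tau>) \<le> X ?\<tau> \<omega>"
  proof (rule ccontr)
    assume "\<not> ?thesis"
    then have neg: "X ?\<tau> \<omega> - B_bound \<alpha> * sqrt (1 - ?\<tau>) < 0" by simp
    have "continuous_on {0..<1} (\<lambda>t. X t \<omega> - B_bound \<alpha> * sqrt (1 - t))"
      by (intro continuous_intros X_continuous assms)
    then have "((\<lambda>t. X t \<omega> - B_bound \<alpha> * sqrt (1 - t)) \<longlongrightarrow> X ?\<tau> \<omega> - B_bound \<alpha> * sqrt (1 - ?\<tau>)) (at ?\<tau> within {0..<1})"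
      using nonneg lt by (simp add: continuous_on_def)
    from order_tendstoD(2)[OF this neg]
    obtain d where d: "0 < d" "\<And>t. t \<in> {0..<1} \<Longrightarrow> t \<noteq> ?\<tau> \<Longrightarrow> dist t ?\<tau> < d \<Longrightarrow>
        X t \<omega> - B_bound \<alpha> * sqrt (1 - t) < 0"
      unfolding eventually_at by blast
    have "Inf ?S < min 1 (?\<tau> + d)" using lt d(1) by (simp add: \<tau>)
    then obtain t where t: "t \<in> ?S" "t < min 1 (?\<tau> + d)"
      using cInf_lessD[of ?S] S1 by blast
    have "?\<tau> \<le> t" by (rule lower[OF t(1)])
    moreover have "t \<noteq> ?\<tau>" using neg t(1) by auto
    ultimately show False using d(2)[of t] t by (auto simp: dist_real_def)
  qed
qed

text \<open>The event must be decided from countably many values at times up to \<open>t\<close>. A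
  continuous function attains its supremum on [0, t], so \<open>g\<close> reaches a value \<ge> 0
  there iff, for every n, it exceeds - 1/(n + 1) somewhere on a countable dense set.\<close>

lemma tau_star_admissible:
  assumes \<alpha>: "\<alpha> \<noteq> 0"
  shows "tau_star \<alpha> X \<in> admissible_times M W"
proof -
  let ?\<tau> = "tau_star \<alpha> X"
  define g where "g t \<omega> = X t \<omega> - B_bound \<alpha> * sqrt (1 - t)" for t \<omega>
  have "{\<omega> \<in> space M. ?\<tau> \<omega> \<le> t} \<in> sets (natural_filtration M W t)" for t
  proof -
    consider "t < 0" | "1 \<le> t" | "0 \<le> t" "t < 1" by linarith
    then show ?thesis
    proof cases
      case 1
      then have "{\<omega> \<in> space M. ?\<tau> \<omega> \<le> t} = {}" using tau_star_bounds(1)[OF \<alpha>] by fastforce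
      then show ?thesis by (simp only: sets.empty_sets)
    next
      case 2
      then have "{\<omega> \<in> space M. ?\<tau> \<omega> \<le> t} = space (natural_filtration M W t)"
        using tau_star_bounds(2)[OF \<alpha>] by fastforce
      then show ?thesis by (simp only: sets.top)
    next
      case 3
      obtain D where D: "countable D" "D \<subseteq> {0..t}" "{0..t} \<subseteq> closure D"
        by (rule separable[of "{0..t}"]) blast
      have g_cont: "continuous_on {0..t} (\<lambda>s. g s \<omega>)" if "\<omega> \<in> space M" for \<omega>
        unfolding g_def using 3
        by (intro continuous_intros continuous_on_subset[OF X_continuous[OF that]]) auto
      have "?\<tau> \<omega> \<le> t \<longleftrightarrow> (\<forall>n::nat. \<exists>s\<in>D. - 1 / real (Suc n) < g s \<omega>)" if w: "\<omega> \<in> space M" for \<omega>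
      proof
        assume le: "?\<tau> \<omega> \<le> t"
        show "\<forall>n::nat. \<exists>s\<in>D. - 1 / real (Suc n) < g s \<omega>"
        proof
          fix n :: nat
          have \<tau>: "?\<tau> \<omega> \<in> {0..t}" using le tau_star_bounds(1)[OF \<alpha> w] by simp
          have "0 \<le> g (?\<tau> \<omega>) \<omega>"
            using tau_star_bounds(4)[OF \<alpha> w] le 3 by (simp add: g_def)
          then have gt: "- 1 / real (Suc n) < g (?\<tau> \<omega>) \<omega>"
            by (rule less_le_trans[rotated]) (simp add: divide_less_0_iff)
          have "((\<lambda>s. g s \<omega>) \<longlongrightarrow> g (?\<tau> \<omega>) \<omega>) (at (?\<tau> \<omega>) within {0..t})"
            using g_cont[OF w] \<tau> by (simp add: continuous_on_def)
          from order_tendstoD(1)[OF this gt]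
          obtain d where d: "0 < d" "\<And>s. s \<in> {0..t} \<Longrightarrow> s \<noteq> ?\<tau> \<omega> \<Longrightarrow> dist s (?\<tau> \<omega>) < d \<Longrightarrow>
              - 1 / real (Suc n) < g s \<omega>"
            unfolding eventually_at by blast
          obtain s where s: "s \<in> D" "dist s (?\<tau> \<omega>) < d"
            using closure_approachable[THEN iffD1, OF subsetD[OF D(3) \<tau>]] d(1) by blast
          show "\<exists>s\<in>D. - 1 / real (Suc n) < g s \<omega>"
          proof (rule bexI[OF _ s(1)])
            have "s \<in> {0..t}" using s(1) D(2) by blast
            then show "- 1 / real (Suc n) < g s \<omega>"
              using d(2)[of s] s(2) gt by (cases "s = ?\<tau> \<omega>") auto
          qed
        qed
      next
        assume ex: "\<forall>n::nat. \<exists>s\<in>D. - 1 / real (Suc n) < g s \<omega>"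
        obtain s0 where s0: "s0 \<in> {0..t}" "\<And>s. s \<in> {0..t} \<Longrightarrow> g s \<omega> \<le> g s0 \<omega>"
          using continuous_attains_sup[OF compact_Icc _ g_cont[OF w]] 3(1) by auto
        have "0 \<le> g s0 \<omega>"
        proof (rule LIMSEQ_le_const2)
          show "(\<lambda>n. - (1 / real (Suc n))) \<longlonglongrightarrow> 0"
            using tendsto_minus[OF LIMSEQ_Suc[OF lim_1_over_n]] by simp
          have "- (1 / real (Suc n)) \<le> g s0 \<omega>" for n
          proof -
            obtain s where "s \<in> D" "- 1 / real (Suc n) < g s \<omega>" using ex by blast
            moreover have "g s \<omega> \<le> g s0 \<omega>" using s0(2) D(2) \<open>s \<in> D\<close> by blast
            ultimately show ?thesis by simp
          qed
          then show "\<exists>N. \<forall>n\<ge>N. - (1 / real (Suc n)) \<le> g s0 \<omega>" by blast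
        qed
        then show "?\<tau> \<omega> \<le> t"
          using tau_star_bounds(5)[OF \<alpha> w, of s0] s0(1) 3 by (auto simp: g_def)
      qed
      then have eq: "{\<omega> \<in> space M. ?\<tau> \<omega> \<le> t}
          = {\<omega> \<in> space (natural_filtration M W t). \<forall>n::nat. \<exists>s\<in>D. g s \<omega> \<in> {- 1 / real (Suc n)<..}}"
        by auto
      have "g s \<in> borel_measurable (natural_filtration M W t)" if "s \<in> D" for s
      proof -
        have s: "0 \<le> s" "s \<le> t" "s < 1" using that D(2) 3 by auto
        have "X s \<in> borel_measurable (natural_filtration M W t)"
          using X_adapted[OF s(1,3)] sets_natural_filtration_mono[OF s(2)]
          by (auto simp: measurable_def)
        then show ?thesis unfolding g_def[abs_def] by measurable
      qed
      then show ?thesis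
        unfolding eq
        by (intro sets.sets_Collect_countable_All sets.sets_Collect_countable_Ex' D(1) Collect_mem_sets) auto
    qed
  qed
  then show ?thesis
    using tau_star_bounds(1,2)[OF \<alpha>]
    by (auto simp: admissible_times_def stopping_time_def Measurable.pred_def)
qed

text \<open>Up to \<open>tau_star\<close> the path is almost surely not above the boundary, so
  monotonicity of \<open>f\<close> bounds the martingale by
  \<open>B_bound \<alpha> * sqrt (1 - t)\<close>. This is the bound that equality in optional
  stopping requires, and it forces the limit 0 = \<open>X 1\<close> where \<open>tau_star\<close>
  equals 1.\<close>

lemma tau_star_optimal:
  assumes f: "heat_martingale \<alpha> (self_similar \<alpha> f)" "\<And>y. 0 \<le> f y" "\<And>y. y \<le> f y" and \<alpha>: "\<alpha> \<noteq> 0"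
    and mono: "mono f" and B: "0 < B_bound \<alpha>" "f (B_bound \<alpha>) = B_bound \<alpha>"
  shows "stopped_expectation M X (tau_star \<alpha> X) = f 0"
proof -
  let ?\<tau> = "tau_star \<alpha> X" and ?B = "B_bound \<alpha>"
  interpret P: bridge_martingale M W \<alpha> X "self_similar \<alpha> f"
    by unfold_locales (rule f(1))
  note \<tau> = tau_star_admissible[OF \<alpha>]
  have X1: "X 1 \<omega> = 0" if "\<omega> \<in> space M" for \<omega> using X_one[OF that] \<alpha> by simp
  define V where "V m \<omega> = P.Y (min (?\<tau> \<omega>) (trunc m)) \<omega>" for m \<omega>
  have V_meas [measurable]: "V m \<in> borel_measurable M" for m
    unfolding V_def[abs_def] by (rule stopped_trunc_measurable[OF \<tau> P.Y_measurable P.Y_continuous])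
  note [measurable] = X_stopped_measurable[OF \<tau>]
  \<comment> \<open>\<open>X 0\<close> vanishes only almost surely; elsewhere \<open>X\<close> may start above the boundary.\<close>
  have below: "X t \<omega> \<le> ?B * sqrt (1 - t)"
    if w: "\<omega> \<in> space M" "X 0 \<omega> = 0" and t: "0 \<le> t" "t \<le> ?\<tau> \<omega>" "t < 1" for \<omega> t
  proof (rule ccontr)
    assume not: "\<not> ?thesis"
    let ?g = "\<lambda>s. X s \<omega> - ?B * sqrt (1 - s)"
    \<comment> \<open>A path that starts at 0 and lies above the boundary at \<open>t\<close> has
      met it strictly earlier, against \<open>t\<close> \<le> \<open>tau_star\<close>.\<close>
    have "\<exists>s. 0 \<le> s \<and> s \<le> t \<and> ?g s = 0"
      by (rule IVT') (use not w(2) B(1) t in \<open>auto intro!: continuous_intros continuous_on_subset[OF X_continuous[OF w(1)]]\<close>)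
    then obtain s where s: "0 \<le> s" "s \<le> t" "?g s = 0" by blast
    then have "?\<tau> \<omega> \<le> s" using tau_star_bounds(5)[OF \<alpha> w(1), of s] t by simp
    then have "s = t" using s(2) t(2) by simp
    then show False using not s(3) by simp
  qed
  have Y_le: "P.Y t \<omega> \<le> ?B * sqrt (1 - t)"
    if w: "\<omega> \<in> space M" "X 0 \<omega> = 0" and t: "0 \<le> t" "t \<le> ?\<tau> \<omega>" "t < 1" for \<omega> t
  proof -
    have "X t \<omega> / sqrt (1 - t) \<le> ?B" using below[OF w t] t(3) by (simp add: pos_divide_le_eq)
    then have "f (X t \<omega> / sqrt (1 - t)) \<le> ?B" using monoD[OF mono] B(2) by metis
    then have "sqrt (1 - t) * f (X t \<omega> / sqrt (1 - t)) \<le> sqrt (1 - t) * ?B"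
      using t(3) by (intro mult_left_mono) auto
    then show ?thesis using t(3) by (simp add: P.Y_def self_similar_N mult.commute)
  qed
  have V_le: "V m \<omega> \<le> ?B * sqrt (1 - min (?\<tau> \<omega>) (trunc m))" if w: "\<omega> \<in> space M" "X 0 \<omega> = 0" for m \<omega>
    unfolding V_def
    using trunc_bounds[of m] tau_star_bounds(1)[OF \<alpha> w(1)] by (intro Y_le w) auto
  have V_le_B: "V m \<omega> \<le> ?B" if w: "\<omega> \<in> space M" "X 0 \<omega> = 0" for m \<omega>
  proof -
    have "sqrt (1 - min (?\<tau> \<omega>) (trunc m)) \<le> 1"
      using trunc_bounds[of m] tau_star_bounds(1)[OF \<alpha> w(1)] by auto
    then have "?B * sqrt (1 - min (?\<tau> \<omega>) (trunc m)) \<le> ?B * 1" using B(1) by (intro mult_left_mono) auto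
    then show ?thesis using V_le[OF w, of m] by simp
  qed
  have V_int: "(\<integral>\<^sup>+\<omega>. ennreal (V m \<omega>) \<partial>M) = ennreal (f 0)" for m
  proof -
    have "AE \<omega> in M. P.Y (min (?\<tau> \<omega>) (trunc m)) \<omega> \<le> ?B"
      using AE_X_zero AE_space by eventually_elim (use V_le_B[of _ m] in \<open>simp add: V_def\<close>)
    from P.optional_stopping_eq[OF admissible_trunc[OF \<tau>] trunc_bounds this]
    show ?thesis by (simp add: V_def self_similar_0)
  qed
  have V_lim: "(\<lambda>m. V m \<omega>) \<longlonglongrightarrow> X (?\<tau> \<omega>) \<omega>" and X_nonneg: "0 \<le> X (?\<tau> \<omega>) \<omega>"
    if w: "\<omega> \<in> space M" "X 0 \<omega> = 0" for \<omega>
  proof -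
    have "(\<lambda>m. V m \<omega>) \<longlonglongrightarrow> X (?\<tau> \<omega>) \<omega> \<and> 0 \<le> X (?\<tau> \<omega>) \<omega>"
    proof (cases "?\<tau> \<omega> < 1")
      case True
      have "X (?\<tau> \<omega>) \<omega> = ?B * sqrt (1 - ?\<tau> \<omega>)"
        using below[OF w _ order_refl True] tau_star_bounds(1,4)[OF \<alpha> w(1)] True by simp
      moreover from this have "P.Y (?\<tau> \<omega>) \<omega> = X (?\<tau> \<omega>) \<omega>"
        using True B(2) by (simp add: P.Y_def self_similar_N)
      moreover have "\<forall>\<^sub>F m in sequentially. V m \<omega> = P.Y (?\<tau> \<omega>) \<omega>"
        using min_trunc_eventually[OF True] by eventually_elim (simp add: V_def)
      then have "(\<lambda>m. V m \<omega>) \<longlonglongrightarrow> P.Y (?\<tau> \<omega>) \<omega>" by (rule tendsto_eventually)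
      ultimately show ?thesis using B(1) True by simp
    next
      case False
      then have \<tau>1: "?\<tau> \<omega> = 1" using tau_star_bounds(2)[OF \<alpha> w(1)] by simp
      have "(\<lambda>m. V m \<omega>) \<longlonglongrightarrow> 0"
      proof (rule tendsto_sandwich[OF always_eventually always_eventually tendsto_const])
        show "\<forall>m. 0 \<le> V m \<omega>" by (simp add: V_def)
        show "\<forall>m. V m \<omega> \<le> ?B * sqrt (1 - min (?\<tau> \<omega>) (trunc m))" using V_le[OF w] by blast
        have "(\<lambda>m. ?B * sqrt (1 - min (?\<tau> \<omega>) (trunc m))) \<longlonglongrightarrow> ?B * sqrt (1 - 1)"
          by (intro tendsto_intros) (use min_trunc_tendsto[of "?\<tau> \<omega>"] \<tau>1 in simp)
        then show "(\<lambda>m. ?B * sqrt (1 - min (?\<tau> \<omega>) (trunc m))) \<longlonglongrightarrow> 0" by simp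
      qed
      then show ?thesis using \<tau>1 X1[OF w(1)] by simp
    qed
    then show "(\<lambda>m. V m \<omega>) \<longlonglongrightarrow> X (?\<tau> \<omega>) \<omega>" "0 \<le> X (?\<tau> \<omega>) \<omega>" by auto
  qed
  have "(\<lambda>m. \<integral>\<^sup>+\<omega>. ennreal (V m \<omega>) \<partial>M) \<longlonglongrightarrow> (\<integral>\<^sup>+\<omega>. ennreal (X (?\<tau> \<omega>) \<omega>) \<partial>M)"
  proof (rule nn_integral_dominated_convergence[where w = "\<lambda>_. ennreal ?B"])
    show "AE \<omega> in M. ennreal (V m \<omega>) \<le> ennreal ?B" for m
      using AE_X_zero AE_space by eventually_elim (auto intro!: ennreal_leI V_le_B)
    show "(\<integral>\<^sup>+\<omega>. ennreal ?B \<partial>M) < \<infinity>" by (simp add: emeasure_space_1)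
    show "AE \<omega> in M. (\<lambda>m. ennreal (V m \<omega>)) \<longlonglongrightarrow> ennreal (X (?\<tau> \<omega>) \<omega>)"
      using AE_X_zero AE_space by eventually_elim (auto intro!: tendsto_ennrealI V_lim)
  qed measurable
  then have "(\<integral>\<^sup>+\<omega>. ennreal (X (?\<tau> \<omega>) \<omega>) \<partial>M) = ennreal (f 0)"
    by (simp add: V_int LIMSEQ_const_iff)
  moreover have "AE \<omega> in M. 0 \<le> X (?\<tau> \<omega>) \<omega>"
    using AE_X_zero AE_space by eventually_elim (rule X_nonneg)
  ultimately show ?thesis
    unfolding stopped_expectation_def using f(2)[of 0]
    by (subst integral_eq_nn_integral) auto
qed

section \<open>Brownian motion, the case \<alpha> = 0\<close>

text \<open>The Wiener integral identifies \<open>X t\<close> with \<open>W t\<close> for each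
  \<open>t\<close> separately. Equality of whole paths links \<open>X\<close> on [0, 1) continuously
  to its value \<open>X 1\<close> = \<open>W 1\<close>.\<close>

lemma AE_X_eq_W:
  assumes \<alpha>: "\<alpha> = 0"
  shows "AE \<omega> in M. \<forall>t\<in>{0..<1}. X t \<omega> = W t \<omega>"
proof -
  have each: "AE \<omega> in M. X t \<omega> = W t \<omega>" if t: "t \<in> {0..<1}" for t
  proof -
    have W_int: "has_wiener_integral M W t (\<lambda>u. (1 - u) powr - \<alpha>) (W t)"
    proof -
      \<comment> \<open>The single cell from 0 to \<open>t\<close> with coefficient 1 represents the
        constant integrand exactly, apart from the point 0.\<close>
      define p where "p k i = (if i = 0 then 0 else t)" for k i :: nat
      have p: "\<forall>k. mono_on {..1} (p k) \<and> p k ` {..1} \<subseteq> {0..t}"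
        using t by (auto simp: p_def intro!: mono_onI)
      have "sqnorm_on {0..t} (\<lambda>s. (1 - s) powr - \<alpha> - step_function 1 (p k) (\<lambda>_. 1) s)
          = (\<integral>\<^sup>+s. 0 \<partial>(lborel :: real measure))" for k
      proof (rule nn_integral_cong_AE)
        have "AE s in lborel. s \<noteq> (0::real)" by (rule AE_lborel_singleton)
        then show "AE s in lborel. ennreal (((1 - s) powr - \<alpha> - step_function 1 (p k) (\<lambda>_. 1) s)\<^sup>2) * indicator {0..t} s = 0"
          by eventually_elim (use t \<alpha> in \<open>auto simp: step_function_def indicator_def p_def\<close>)
      qed
      then have 1: "(\<lambda>k. sqnorm_on {0..t} (\<lambda>s. (1 - s) powr - \<alpha> - step_function 1 (p k) (\<lambda>_. 1) s))
          \<longlonglongrightarrow> 0" by simp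
      have "sqnorm M (\<lambda>\<omega>. W t \<omega> - step_integral W 1 (p k) (\<lambda>_. 1) \<omega>) = (\<integral>\<^sup>+\<omega>. 0 \<partial>M)" for k
        by (intro nn_integral_cong) (simp add: step_integral_def W_zero p_def)
      then have 2: "(\<lambda>k. sqnorm M (\<lambda>\<omega>. W t \<omega> - step_integral W 1 (p k) (\<lambda>_. 1) \<omega>)) \<longlonglongrightarrow> 0"
        by simp
      have W: "W t \<in> borel_measurable M" using t by (intro W_measurable) auto
      have f: "(\<lambda>u. (1 - u) powr - \<alpha>) \<in> borel_measurable borel" by measurable
      show ?thesis
        unfolding has_wiener_integral_def
        by (rule conjI[OF f conjI[OF W]], rule exI[of _ "\<lambda>_. 1"], rule exI[of _ p],
            rule exI[of _ "\<lambda>_ _. 1"]) (intro conjI p 1 2)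
    qed
    have X_int: "has_wiener_integral M W t (\<lambda>u. (1 - u) powr - \<alpha>) (X t)"
    proof -
      have "N t \<omega> = X t \<omega>" for \<omega>
        unfolding N_def using \<alpha> t by simp
      then have "N t = X t" by (rule ext)
      then show ?thesis using N_wiener_integral[of t] t by simp
    qed
    have [measurable]: "X t \<in> borel_measurable M" "W t \<in> borel_measurable M"
      using t by (auto intro: X_measurable W_measurable)
    \<comment> \<open>\<open>W t\<close> and \<open>X t\<close> are integrals of the same function
      up to the same time, so their difference is approximated on the degenerate interval
      [t, t].\<close>
    obtain n p c where p: "\<And>k::nat. p k ` {..n k} \<subseteq> {t..t}"
      and lim: "(\<lambda>k. sqnorm M (\<lambda>\<omega>. X t \<omega> - W t \<omega> - step_integral W (n k) (p k) (c k) \<omega>)) \<longlonglongrightarrow> 0"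
      by (rule wiener_integral_increment[OF W_int X_int]) (use t in auto)
    have "step_integral W (n k) (p k) (c k) \<omega> = 0" for k \<omega>
      unfolding step_integral_def
    proof (rule sum.neutral, rule ballI)
      fix i assume "i \<in> {..<n k}"
      then have "i \<in> {..n k}" "Suc i \<in> {..n k}" by auto
      then have "p k i \<in> {t..t}" "p k (Suc i) \<in> {t..t}" using p[of k] by blast+
      then show "c k i * (W (p k (Suc i)) \<omega> - W (p k i) \<omega>) = 0" by simp
    qed
    then have "sqnorm M (\<lambda>\<omega>. X t \<omega> - W t \<omega>) = 0"
      using lim by (simp add: LIMSEQ_const_iff)
    then have "AE \<omega> in M. ennreal ((X t \<omega> - W t \<omega>)\<^sup>2) = 0"
      by (subst (asm) nn_integral_0_iff_AE) auto
    then show ?thesis by eventually_elim auto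
  qed
  obtain D where D: "countable D" "D \<subseteq> {0..<1::real}" "{0..<1} \<subseteq> closure D"
    by (rule separable[of "{0..<1::real}"]) blast
  have "AE \<omega> in M. \<forall>t\<in>D. X t \<omega> = W t \<omega>"
    using each D(2) by (subst AE_ball_countable[OF D(1)]) blast
  with AE_space show ?thesis
  proof eventually_elim
    case (elim \<omega>)
    show ?case
    proof
      fix t :: real assume t: "t \<in> {0..<1}"
      obtain s where s: "\<And>n. s n \<in> D" "s \<longlonglongrightarrow> t"
        using closure_sequential[THEN iffD1, OF subsetD[OF D(3) t]] by blast
      have ev: "\<forall>\<^sub>F n in sequentially. s n \<in> {0..<1}" using s(1) D(2) by (intro always_eventually) blast
      have "(\<lambda>n. X (s n) \<omega>) \<longlonglongrightarrow> X t \<omega>"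
        by (rule continuous_on_tendsto_compose[OF X_continuous[OF elim(1)] s(2) t ev])
      moreover have "continuous_on {0..<1} (\<lambda>t. W t \<omega>)"
        by (rule continuous_on_subset[OF W_continuous[OF elim(1)]]) auto
      then have "(\<lambda>n. W (s n) \<omega>) \<longlonglongrightarrow> W t \<omega>"
        by (rule continuous_on_tendsto_compose[OF _ s(2) t ev])
      moreover have "X (s n) \<omega> = W (s n) \<omega>" for n using elim(2) s(1) by blast
      ultimately show "X t \<omega> = W t \<omega>" using LIMSEQ_unique by simp
    qed
  qed
qed

text \<open>Here the value at time 1 is not 0; it is reached as a limit by the continuity of
  \<open>W\<close> on [0, 1].\<close>

lemma brownian_exp_bound:
  assumes \<alpha>: "\<alpha> = 0" and \<tau>: "\<tau> \<in> admissible_times M W"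
  shows "(\<integral>\<^sup>+\<omega>. ennreal (exp (r * X (\<tau> \<omega>) \<omega>)) \<partial>M) \<le> ennreal (exp (r\<^sup>2 / 2))"
proof -
  interpret P: bridge_martingale M W \<alpha> X "\<lambda>t n. exp (r\<^sup>2 * (1 - t) / 2) * exp (r * n)"
    by unfold_locales (use heat_martingale_exp_0[of r] \<alpha> in simp)
  have "(\<integral>\<^sup>+\<omega>. ennreal (exp (r * X (\<tau> \<omega>) \<omega>)) \<partial>M)
      \<le> (\<integral>\<^sup>+\<omega>. liminf (\<lambda>m. ennreal (P.Y (min (\<tau> \<omega>) (trunc m)) \<omega>)) \<partial>M)"
  proof (rule nn_integral_mono_AE)
    show "AE \<omega> in M. ennreal (exp (r * X (\<tau> \<omega>) \<omega>)) \<le> liminf (\<lambda>m. ennreal (P.Y (min (\<tau> \<omega>) (trunc m)) \<omega>))"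
      using AE_X_eq_W[OF \<alpha>] AE_space
    proof eventually_elim
      case (elim \<omega>)
      have \<tau>01: "0 \<le> \<tau> \<omega>" "\<tau> \<omega> \<le> 1" using admissibleD(2)[OF \<tau> elim(2)] by auto
      have XW: "X t \<omega> = W t \<omega>" if "0 \<le> t" "t \<le> 1" for t
        using elim that X_one[OF elim(2)] \<alpha> by (cases "t = 1") auto
      let ?t = "\<lambda>m. min (\<tau> \<omega>) (trunc m)"
      have t01: "?t m \<in> {0..1}" "?t m < 1" for m
        using \<tau>01 trunc_bounds[of m] by auto
      have "(\<lambda>m. W (?t m) \<omega>) \<longlonglongrightarrow> W (\<tau> \<omega>) \<omega>"
        by (rule continuous_on_tendsto_compose[OF W_continuous[OF elim(2)] min_trunc_tendsto[OF \<tau>01(2)]])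
          (use \<tau>01 t01 in auto)
      then have "(\<lambda>m. exp (r * W (?t m) \<omega>)) \<longlonglongrightarrow> exp (r * W (\<tau> \<omega>) \<omega>)"
        by (intro tendsto_intros)
      then have "(\<lambda>m. ennreal (exp (r * W (?t m) \<omega>))) \<longlonglongrightarrow> ennreal (exp (r * W (\<tau> \<omega>) \<omega>))"
        by (rule tendsto_ennrealI)
      from lim_imp_Liminf[OF _ this]
      have "ennreal (exp (r * X (\<tau> \<omega>) \<omega>)) = liminf (\<lambda>m. ennreal (exp (r * W (?t m) \<omega>)))"
        using XW[OF \<tau>01] by simp
      also have "\<dots> \<le> liminf (\<lambda>m. ennreal (P.Y (?t m) \<omega>))"
      proof (intro Liminf_mono always_eventually allI ennreal_leI)
        fix m
        have "P.Y (?t m) \<omega> = exp (r\<^sup>2 * (1 - ?t m) / 2) * exp (r * W (?t m) \<omega>)"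
        proof -
          have "N (?t m) \<omega> = X (?t m) \<omega>" unfolding N_def using t01[of m] \<alpha> by simp
          then show ?thesis using t01[of m] XW[of "?t m"] unfolding P.Y_def by simp
        qed
        moreover have "1 \<le> exp (r\<^sup>2 * (1 - ?t m) / 2)" using t01[of m] by simp
        ultimately show "exp (r * W (?t m) \<omega>) \<le> P.Y (?t m) \<omega>"
          using mult_right_mono[of 1 "exp (r\<^sup>2 * (1 - ?t m) / 2)" "exp (r * W (?t m) \<omega>)"] by simp
      qed
      finally show ?case .
    qed
  qed
  also have "\<dots> \<le> ennreal (exp (r\<^sup>2 / 2))"
    using P.nn_integral_liminf_Y_le[OF \<tau>] by simp
  finally show ?thesis .
qed

lemma brownian_stopped:
  assumes \<alpha>: "\<alpha> = 0" and \<tau>: "\<tau> \<in> admissible_times M W"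
  shows brownian_integrable: "integrable M (\<lambda>\<omega>. X (\<tau> \<omega>) \<omega>)"
    and brownian_expectation_le: "stopped_expectation M X \<tau> \<le> 0"
proof -
  note [measurable] = X_stopped_measurable[OF \<tau>]
  have le_exp: "z \<le> exp z" for z :: real using exp_ge_add_one_self[of z] by linarith
  show int: "integrable M (\<lambda>\<omega>. X (\<tau> \<omega>) \<omega>)"
  proof (rule integrable_of_nn_integral)
    show "(\<integral>\<^sup>+\<omega>. ennreal (X (\<tau> \<omega>) \<omega>) \<partial>M) \<le> ennreal (exp (1\<^sup>2 / 2))"
      by (rule order_trans[OF nn_integral_mono brownian_exp_bound[OF \<alpha> \<tau>]]) (auto intro!: ennreal_leI le_exp)
    show "(\<integral>\<^sup>+\<omega>. ennreal (- X (\<tau> \<omega>) \<omega>) \<partial>M) \<le> ennreal (exp ((-1)\<^sup>2 / 2))"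
      by (rule order_trans[OF nn_integral_mono brownian_exp_bound[OF \<alpha> \<tau>]]) (auto intro!: ennreal_leI le_exp)
  qed measurable
  let ?e = "stopped_expectation M X \<tau>"
  \<comment> \<open>\<open>1 + r x \<le> exp (r x)\<close> bounds \<open>1 + r ?e\<close> by \<open>exp (r\<^sup>2/2) = 1 + O(r\<^sup>2)\<close>.\<close>
  have "?e \<le> r" if r: "0 < r" "r \<le> 1" for r
  proof -
    have "(\<integral>\<omega>. 1 + r * X (\<tau> \<omega>) \<omega> \<partial>M) \<le> exp (r\<^sup>2 / 2)"
    proof (rule integral_le_of_nn_integral)
      show "(\<integral>\<^sup>+\<omega>. ennreal (1 + r * X (\<tau> \<omega>) \<omega>) \<partial>M) \<le> ennreal (exp (r\<^sup>2 / 2))"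
        by (rule order_trans[OF nn_integral_mono brownian_exp_bound[OF \<alpha> \<tau>]])
          (auto intro!: ennreal_leI exp_ge_add_one_self)
    qed (use int in auto)
    moreover have "exp (r\<^sup>2 / 2) \<le> 1 + 2 * (r\<^sup>2 / 2)"
    proof -
      have "r\<^sup>2 \<le> 1" using r by (simp add: power_le_one)
      then show ?thesis using exp_bound_lemma[of "r\<^sup>2 / 2"] by simp
    qed
    ultimately have "1 + r * ?e \<le> 1 + r\<^sup>2"
      using int by (simp add: stopped_expectation_def prob_space)
    then show ?thesis using r by (simp add: power2_eq_square)
  qed
  \<comment> \<open>r = 1 shows that \<open>?e\<close> is at most 1; if \<open>?e\<close> were
    positive, \<open>?e / 2\<close> would then be an admissible \<open>r\<close>, giving
    \<open>?e\<close> \<le> \<open>?e / 2\<close>.\<close>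
  from this[of "min 1 ?e"] this[of "?e / 2"] this[of 1] show "?e \<le> 0"
    by (cases "0 < ?e") (auto simp: min_def split: if_splits)
qed

lemma stopping_value_eqI:
  assumes "\<And>\<tau>. \<tau> \<in> admissible_times M W \<Longrightarrow> stopped_expectation M X \<tau> \<le> v"
    and "\<sigma> \<in> admissible_times M W" "stopped_expectation M X \<sigma> = v"
  shows "stopping_value M W X = ereal v"
  unfolding stopping_value_def
  by (rule antisym[OF SUP_least SUP_upper2[OF assms(2)]]) (use assms in auto)

lemma optimal_stopping:
  assumes f: "heat_martingale \<alpha> (self_similar \<alpha> f)" "\<And>y. 0 \<le> f y" "\<And>y. y \<le> f y" and \<alpha>: "\<alpha> \<noteq> 0"
    and mono: "mono f" and B: "0 < B_bound \<alpha>" "f (B_bound \<alpha>) = B_bound \<alpha>"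
  shows "(\<forall>\<tau>\<in>admissible_times M W. integrable M (\<lambda>\<omega>. X (\<tau> \<omega>) \<omega>)) \<and>
    stopping_value M W X = ereal (f 0) \<and>
    tau_star \<alpha> X \<in> admissible_times M W \<and> ereal (stopped_expectation M X (tau_star \<alpha> X)) = stopping_value M W X"
proof -
  have opt: "stopped_expectation M X (tau_star \<alpha> X) = f 0"
    by (rule tau_star_optimal[OF f \<alpha> mono B])
  have "stopping_value M W X = ereal (f 0)"
    by (rule stopping_value_eqI[OF majorant_bound[OF f \<alpha>] tau_star_admissible[OF \<alpha>] opt])
  then show ?thesis
    using opt majorant_integrable[OF f \<alpha>] tau_star_admissible[OF \<alpha>] by simp
qed

end

theorem mainTheorem2:
  fixes M :: "'a measure" and W X :: "real \<Rightarrow> 'a \<Rightarrow> real" and \<alpha> :: real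
  assumes "alpha_brownian_bridge M W \<alpha> X"
  shows "(\<forall>\<tau>\<in>admissible_times M W. integrable M (\<lambda>\<omega>. X (\<tau> \<omega>) \<omega>)) \<and>
    stopping_value M W X = ereal
      (if \<alpha> = 0 then 0
       else if \<alpha> < 1/2 then
         C_coeff \<alpha> * (Gamma (1 - \<alpha> / (2 * \<alpha> - 1)) /
           (sqrt (2 * (1 - 2 * \<alpha>)) * Gamma (3/2 - \<alpha> / (2 * \<alpha> - 1))))
       else if \<alpha> = 1/2 then 1 / exp 1
       else
         C_coeff \<alpha> * (Gamma (\<alpha> / (2 * \<alpha> - 1) - 1/2) /
           (sqrt (2 * (2 * \<alpha> - 1)) * Gamma (\<alpha> / (2 * \<alpha> - 1))))) \<and>
    (0 < \<alpha> \<longrightarrow>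
       tau_star \<alpha> X \<in> admissible_times M W \<and>
       ereal (stopped_expectation M X (tau_star \<alpha> X)) = stopping_value M W X)"
proof -
  interpret alpha_brownian_bridge M W \<alpha> X by (rule assms)
  consider "\<alpha> = 0" | "\<alpha> = 1/2" | "0 < \<alpha>" "\<alpha> \<noteq> 1/2" using alpha_nonneg by linarith
  then show ?thesis
  proof cases
    case 1
    \<comment> \<open>The upper bound 0 is attained by stopping at once, as \<open>X 0\<close>
      vanishes almost surely.\<close>
    have zero: "(\<lambda>_. 0) \<in> admissible_times M W"
      by (simp add: admissible_times_def stopping_time_const)
    have "stopped_expectation M X (\<lambda>_. 0) = 0"
      unfolding stopped_expectation_def using AE_X_zero by (rule integral_eq_zero_AE)
    from stopping_value_eqI[OF brownian_expectation_le[OF 1] zero this]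
    show ?thesis using brownian_integrable[OF 1] 1 by simp
  next
    case 2
    have "(\<forall>\<tau>\<in>admissible_times M W. integrable M (\<lambda>\<omega>. X (\<tau> \<omega>) \<omega>)) \<and>
      stopping_value M W X = ereal (exp (0 - 1)) \<and>
      tau_star \<alpha> X \<in> admissible_times M W \<and> ereal (stopped_expectation M X (tau_star \<alpha> X)) = stopping_value M W X"
    proof (rule optimal_stopping[where f = "\<lambda>y. exp (y - 1)"])
      show "heat_martingale \<alpha> (self_similar \<alpha> (\<lambda>y. exp (y - 1)))"
        unfolding 2 by (rule heat_martingale_exp_half)
      show "y \<le> exp (y - 1)" for y :: real using exp_ge_add_one_self[of "y - 1"] by simp
      show "mono (\<lambda>y::real. exp (y - 1))" by (rule monoI) simp
    qed (use 2 in \<open>auto simp: B_bound_def\<close>)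
    then show ?thesis unfolding 2 by (simp add: exp_minus inverse_eq_divide)
  next
    case 3
    define f where "f y = C_coeff \<alpha> * F_fun y \<alpha>" for y
    note BC = B_bound_C_coeff[OF 3]
    have heat: "heat_martingale \<alpha> (self_similar \<alpha> f)"
    proof (cases "1/2 < \<alpha>")
      case True
      let ?\<kappa> = "2 * \<alpha> - 1"
      let ?r = "C_coeff \<alpha> / (sqrt ?\<kappa> * gm_coeff (1 / ?\<kappa>) 1)"
      have "f = (\<lambda>y. ?r * gauss_mellin (1 / ?\<kappa>) (sqrt ?\<kappa> * y))"
        by (simp add: f_def fun_eq_iff F_fun_gauss_mellin[OF True])
      moreover have "0 \<le> ?r"
        using True BC(2) gm_coeff_pos[of "1 / ?\<kappa>" 1] by simp
      ultimately show ?thesis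
        using heat_martingale_gauss_mellin[OF True, of ?r] by (simp only:)
    next
      case False
      then have lt: "\<alpha> < 1/2" using 3 by simp
      let ?\<kappa> = "1 - 2 * \<alpha>"
      let ?r = "C_coeff \<alpha> / (sqrt ?\<kappa> * gm_coeff (1 / ?\<kappa> + 1) 1)"
      have "f = (\<lambda>y. ?r * gauss_power (1 / ?\<kappa>) (sqrt ?\<kappa> * y))"
        by (simp add: f_def fun_eq_iff F_fun_gauss_power[OF 3(1) lt])
      moreover have "0 \<le> ?r"
        using lt BC(2) gm_coeff_pos[of "1 / ?\<kappa> + 1" 1] by (simp add: add_pos_pos)
      ultimately show ?thesis
        using heat_martingale_gauss_power[OF lt, of ?r] by (simp only:)
    qed
    have "0 \<le> f y" for y using BC(2) BC(6)[of y] by (simp add: f_def)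
    moreover have "mono f"
      using BC(2) monoD[OF BC(5)] by (auto simp: f_def intro!: monoI)
    moreover have "y \<le> f y" "f (B_bound \<alpha>) = B_bound \<alpha>" "\<alpha> \<noteq> 0" for y
      using BC(3,4) 3 by (auto simp: f_def)
    ultimately have "(\<forall>\<tau>\<in>admissible_times M W. integrable M (\<lambda>\<omega>. X (\<tau> \<omega>) \<omega>)) \<and>
      stopping_value M W X = ereal (f 0) \<and>
      tau_star \<alpha> X \<in> admissible_times M W \<and> ereal (stopped_expectation M X (tau_star \<alpha> X)) = stopping_value M W X"
      using heat BC(1) by (intro optimal_stopping)
    \<comment> \<open>At y = 0 only the second hypergeometric term of F survives, so
      \<open>f 0\<close> is \<open>C_coeff \<alpha> * K_coeff \<alpha>\<close>.\<close>
    then show ?thesis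
      using 3 by (auto simp: f_def F_fun_0 K_coeff_def gamma_par_def)
  qed
qed

end
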